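(* For every integer $d\ge 1$ there exists a constant $C_d>0$, depending only on $d$, such that for all $P,Q\in\mathcal{P}_d$, \[ d_{\mathrm H}\bigl(\psi^*(P),\psi^*(Q)\bigr)\le C_d\cdot\left[\frac{d_{\mathrm W}(P,Q)}{\max\{\epsilon_P,\epsilon_Q\}}\right]^{1/4}. \]
   Context: $\mathcal{P}_d$ is the set of probability distributions $P$ on $\mathbb{R}^d$ with $\mathbb{E}_P[\|X\|]<\infty$ and $\mathbb{P}_P\{X\in H\}<1$ for every (affine) hyperplane $H\subseteq\mathbb{R}^d$; here $\|\cdot\|$ is the Euclidean norm and the subscript $P$ means $X\sim P$. $\mathcal{F}_d$ is the set of upper semi-continuous log-concave probability densities (with respect to Lebesgue measure) on $\mathbb{R}^d$. The log-concave projection $\psi^*:\mathcal{P}_d\to\mathcal{F}_d$ is $\psi^*(P)=\operatorname{argmax}_{f\in\mathcal{F}_d}\mathbb{E}_P[\log f(X)]$; it is known that for $P\in\mathcal{P}_d$ the maximizer exists and is unique. For $P$ with $\mathbb{E}_P[\|X\|]<\infty$, $\mu_P=\mathbb{E}_P[X]$ and $\epsilon_P=\inf_{u\in\mathbb{R}^d,\|u\|=1}\mathbb{E}_P\bigl[|u^\top(X-\mu_P)|\bigr]$; one has $\epsilon_P>0$ for $P\in\mathcal{P}_d$. $d_{\mathrm W}(P,Q)=\inf\mathbb{E}[\|X-Y\|]$, the infimum over all couplings $(X,Y)$ with $X\sim P$, $Y\sim Q$ ($L_1$-Wasserstein distance). For densities $f,g$ on $\mathbb{R}^d$, the Hellinger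 distance $d_{\mathrm H}\ge 0$ is given by $d_{\mathrm H}^2(f,g)=\int_{\mathbb{R}^d}(\sqrt{f(x)}-\sqrt{g(x)})^2\,dx$. *)

theory Defs
  imports "HOL-Probability.Probability"
begin

definition nondegenerate_distributions :: "'a::euclidean_space measure set" where
  "nondegenerate_distributions =
     {P. prob_space P \<and> sets P = sets borel \<and> integrable P norm \<and>
         (\<forall>u c. u \<noteq> 0 \<longrightarrow> measure P {x. u \<bullet> x = c} < 1)}"

text \<open>The extended logarithm with value \<open>-\<infinity>\<close> at 0; it is only applied to nonnegative numbers.\<close>

definition elog :: "real \<Rightarrow> ereal" where
  "elog y = (if y \<le> 0 then -\<infinity> else ereal (ln y))"

definition upper_semicontinuous :: "('a::topological_space \<Rightarrow> real) \<Rightarrow> bool" where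
  "upper_semicontinuous f \<longleftrightarrow> (\<forall>x. \<forall>a > f x. \<forall>\<^sub>F z in nhds x. f z < a)"

text \<open>For \<open>0 < t < 1\<close> both summands below are \<open>< \<infinity>\<close>, so \<open>\<infinity> - \<infinity>\<close> does not occur.\<close>

definition log_concave :: "('a::real_vector \<Rightarrow> real) \<Rightarrow> bool" where
  "log_concave f \<longleftrightarrow> (\<forall>x. 0 \<le> f x) \<and>
     (\<forall>x y. \<forall>t\<in>{0<..<1}.
        ereal (1 - t) * elog (f x) + ereal t * elog (f y) \<le> elog (f ((1 - t) *\<^sub>R x + t *\<^sub>R y)))"

definition prob_density :: "('a::euclidean_space \<Rightarrow> real) \<Rightarrow> bool" where
  "prob_density f \<longleftrightarrow> f \<in> borel_measurable borel \<and> (\<forall>x. 0 \<le> f x) \<and>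
     (\<integral>\<^sup>+ x. ennreal (f x) \<partial>lborel) = 1"

definition log_concave_densities :: "('a::euclidean_space \<Rightarrow> real) set" where
  "log_concave_densities = {f. prob_density f \<and> upper_semicontinuous f \<and> log_concave f}"

text \<open>The expectation of \<open>log f(X)\<close> may be \<open>-\<infinity>\<close>, so it is the difference of the integrals of the
  positive and the negative part (\<open>e2ennreal\<close> sends negative numbers to 0). A log-concave density
  is bounded, so the first integral is finite whenever \<open>f\<close> is one and \<open>P\<close> is a distribution.\<close>

definition expected_log :: "'a measure \<Rightarrow> ('a \<Rightarrow> real) \<Rightarrow> ereal" where
  "expected_log P f =
     enn2ereal (\<integral>\<^sup>+ x. e2ennreal (elog (f x)) \<partial>P) - enn2ereal (\<integral>\<^sup>+ x. e2ennreal (- elog (f x)) \<partial>P)"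

definition log_concave_projection :: "'a::euclidean_space measure \<Rightarrow> 'a \<Rightarrow> real" where
  "log_concave_projection P = arg_max_on (expected_log P) log_concave_densities"

definition mean :: "'a::euclidean_space measure \<Rightarrow> 'a" where
  "mean P = (\<integral>x. x \<partial>P)"

definition min_abs_deviation :: "'a::euclidean_space measure \<Rightarrow> real" where
  "min_abs_deviation P = (INF u\<in>sphere 0 1. \<integral>x. \<bar>u \<bullet> (x - mean P)\<bar> \<partial>P)"

definition couplings :: "'a measure \<Rightarrow> 'b measure \<Rightarrow> ('a \<times> 'b) measure set" where
  "couplings P Q =
     {\<pi>. sets \<pi> = sets (P \<Otimes>\<^sub>M Q) \<and> distr \<pi> P fst = P \<and> distr \<pi> Q snd = Q}"

text \<open>The infimum is finite if \<open>P\<close> and \<open>Q\<close> are distributions with finite first moments, because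
  of the product coupling, so \<open>enn2real\<close> does not truncate it.\<close>

definition wasserstein :: "'a::euclidean_space measure \<Rightarrow> 'a measure \<Rightarrow> real" where
  "wasserstein P Q =
     enn2real (INF \<pi>\<in>couplings P Q. \<integral>\<^sup>+ z. ennreal (norm (fst z - snd z)) \<partial>\<pi>)"

definition hellinger :: "('a::euclidean_space \<Rightarrow> real) \<Rightarrow> ('a \<Rightarrow> real) \<Rightarrow> real" where
  "hellinger f g = sqrt (\<integral>x. (sqrt (f x) - sqrt (g x))\<^sup>2 \<partial>lborel)"

end

theory Submission
  imports Defs
begin

text \<open>
  For \<open>L > 0\<close> let \<open>f\<^sup>L x = sup\<^sub>y f y exp (- L |x - y|)\<close> be the smallest majorant of a log-concave
  density \<open>f\<close> whose logarithm is \<open>L\<close>-Lipschitz; it is again log-concave.  Let \<open>f\<close> and \<open>g\<close> be the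
  projections of \<open>P\<close> and \<open>Q\<close>.  Comparing the optimal value for \<open>P\<close> with the value of the normalised
  \<open>sqrt (f g\<^sup>L)\<close>, and the optimal value for \<open>Q\<close> with that of the normalised \<open>f\<^sup>L\<close>, bounds the squared
  Hellinger distance of \<open>f\<close> and \<open>g\<close> by a multiple of \<open>L d\<^sub>W(P,Q) + (\<integral>f\<^sup>L - 1) + (\<integral>g\<^sup>L - 1)\<close>, because
  integrals of \<open>L\<close>-Lipschitz functions differ by at most \<open>L d\<^sub>W(P,Q)\<close>.  The superlevel set of \<open>f\<close> at
  height \<open>max f / e\<close> contains a ball of radius of order \<open>\<epsilon>\<^sub>P\<close>, so the superlevel sets of \<open>f\<^sup>L\<close> lie in
  slight dilations of those of \<open>f\<close>, and \<open>\<integral>f\<^sup>L - 1\<close> is of order \<open>1 / (L \<epsilon>\<^sub>P)\<close>.  Balancing the terms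
  gives \<open>L\<close> of order \<open>(d\<^sub>W(P,Q) \<epsilon>)\<^sup>-\<^sup>1\<^sup>/\<^sup>2\<close>.

  The same geometric mean argument shows that maximising sequences are Cauchy in the Hellinger
  distance, which yields existence of the projection without any compactness.
\<close>

section \<open>Log-concave functions\<close>

text \<open>The obstacle is that \<open>ln g\<close>, for the projection \<open>g\<close> of
  \<open>Q\<close>, is neither Lipschitz nor finite off the support of \<open>g\<close>, so its
  expectation under \<open>P\<close> may be minus infinity however close \<open>P\<close> and
  \<open>Q\<close> are. Majorants avoid this: replacing a density by its envelope never lowers an
  expected logarithm, and the price is paid in mass alone, through the logarithm of an integral. The
  ball has radius of order \<epsilon> with a purely dimensional factor because an optimal density
  cannot be too peaked: stretching it by 2 about a near-maximum costs \<open>DIM('a) * ln 2\<close>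
  in normalisation but at least halves the gap between the log-height there and the expected
  logarithm. The exponent 1/4 is a square root from balancing \<open>L\<close> and another from the
  squared distance. The maximum of the two deviations is admissible because they differ by at most
  twice the distance: either they are comparable, or the trivial bound 2 on the squared Hellinger
  distance suffices. For existence, Lebesgue-almost everywhere convergence says nothing about
  expectations under a singular \<open>P\<close>; log-concavity must give control at every
  point.\<close>

lemma elog_mix_le_iff:
  assumes "0 \<le> a" "0 \<le> b" "0 \<le> c" and t: "0 < t" "t < 1"
  shows "ereal (1 - t) * elog a + ereal t * elog b \<le> elog c \<longleftrightarrow> a powr (1 - t) * b powr t \<le> c"
proof (cases "a = 0 \<or> b = 0")
  \<comment> \<open>Both sides hold: the left sum is minus infinity, and the product on the right
    vanishes because \<open>0 powr r = 0\<close>.\<close>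
  case True
  then show ?thesis using assms by (auto simp: elog_def)
next
  case False
  with assms have ab: "0 < a" "0 < b" by auto
  have e: "a powr (1 - t) * b powr t = exp ((1 - t) * ln a + t * ln b)"
    using ab by (simp add: powr_def exp_add)
  show ?thesis
  proof (cases "c = 0")
    case True
    then show ?thesis using ab by (auto simp: elog_def e)
  next
    case False
    then have "0 < c" using assms by simp
    then show ?thesis using ab by (simp add: elog_def e ln_ge_iff)
  qed
qed

lemma log_concave_iff_powr:
  "log_concave f \<longleftrightarrow> (\<forall>x. 0 \<le> f x) \<and>
     (\<forall>x y. \<forall>t\<in>{0<..<1}. f x powr (1 - t) * f y powr t \<le> f ((1 - t) *\<^sub>R x + t *\<^sub>R y))"
  unfolding log_concave_def by (auto simp: elog_mix_le_iff)

lemma log_concaveI: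
  assumes "\<And>x. 0 \<le> f x"
    and "\<And>x y t. 0 < t \<Longrightarrow> t < 1 \<Longrightarrow> 0 < f x \<Longrightarrow> 0 < f y \<Longrightarrow>
      f x powr (1 - t) * f y powr t \<le> f ((1 - t) *\<^sub>R x + t *\<^sub>R y)"
  shows "log_concave f"
  unfolding log_concave_iff_powr
proof (intro conjI allI ballI)
  fix x y t assume "t \<in> {0<..<1::real}"
  then show "f x powr (1 - t) * f y powr t \<le> f ((1 - t) *\<^sub>R x + t *\<^sub>R y)"
    using assms(1)[of x] assms(1)[of y] assms(1)[of "(1 - t) *\<^sub>R x + t *\<^sub>R y"]
      assms(2)[of t x y] by (cases "f x = 0 \<or> f y = 0") auto
qed (fact assms(1))

lemma log_concave_nonneg: "log_concave f \<Longrightarrow> 0 \<le> f x"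
  by (simp add: log_concave_def)

lemma log_concaveD:
  "log_concave f \<Longrightarrow> 0 < t \<Longrightarrow> t < 1 \<Longrightarrow> f x powr (1 - t) * f y powr t \<le> f ((1 - t) *\<^sub>R x + t *\<^sub>R y)"
  by (simp add: log_concave_iff_powr)

lemma log_concave_mix_le:
  assumes "log_concave f" "0 < t" "t < 1" "0 \<le> a" "a \<le> f x" "0 \<le> b" "b \<le> f y"
  shows "a powr (1 - t) * b powr t \<le> f ((1 - t) *\<^sub>R x + t *\<^sub>R y)"
proof -
  have "a powr (1 - t) * b powr t \<le> f x powr (1 - t) * f y powr t"
    using assms by (intro mult_mono powr_mono2) auto
  with log_concaveD[OF assms(1-3), of x y] show ?thesis by linarith
qed

lemma log_concave_mix_less:
  assumes "log_concave f" "0 < t" "t < 1" "0 \<le> a" "a < f x" "0 \<le> b" "b < f y"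
  shows "a powr (1 - t) * b powr t < f ((1 - t) *\<^sub>R x + t *\<^sub>R y)"
proof -
  have "a powr (1 - t) * b powr t < f x powr (1 - t) * f y powr t"
    using assms by (intro mult_strict_mono powr_less_mono2) auto
  with log_concaveD[OF assms(1-3), of x y] show ?thesis by linarith
qed

lemma log_concave_mult:
  assumes f: "log_concave f" and g: "log_concave g"
  shows "log_concave (\<lambda>x. f x * g x)"
proof (rule log_concaveI)
  fix x y t assume t: "0 < t" "t < (1::real)"
  have "(f x * g x) powr (1 - t) * (f y * g y) powr t =
      (f x powr (1 - t) * f y powr t) * (g x powr (1 - t) * g y powr t)"
    using f g by (simp add: powr_mult log_concave_nonneg)
  also have "\<dots> \<le> f ((1 - t) *\<^sub>R x + t *\<^sub>R y) * g ((1 - t) *\<^sub>R x + t *\<^sub>R y)"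
    using f g t by (intro mult_mono log_concaveD) (auto simp: log_concave_nonneg)
  finally show "(f x * g x) powr (1 - t) * (f y * g y) powr t \<le> \<dots>" .
qed (use f g in \<open>auto simp: log_concave_nonneg\<close>)

lemma log_concave_powr:
  assumes f: "log_concave f" and "0 < p"
  shows "log_concave (\<lambda>x. f x powr p)"
proof (rule log_concaveI)
  fix x y t assume t: "0 < t" "t < (1::real)"
  have "(f x powr p) powr (1 - t) * (f y powr p) powr t = (f x powr (1 - t) * f y powr t) powr p"
    using f by (simp add: powr_mult powr_powr mult.commute log_concave_nonneg)
  also have "\<dots> \<le> f ((1 - t) *\<^sub>R x + t *\<^sub>R y) powr p"
    using f t \<open>0 < p\<close> by (intro powr_mono2 log_concaveD) auto
  finally show "(f x powr p) powr (1 - t) * (f y powr p) powr t \<le> \<dots>" .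
qed auto

lemma log_concave_sqrt:
  assumes "log_concave f" shows "log_concave (\<lambda>x. sqrt (f x))"
  using log_concave_powr[OF assms, of "1/2"] assms by (simp add: powr_half_sqrt log_concave_nonneg)

lemma log_concave_const: "0 \<le> c \<Longrightarrow> log_concave (\<lambda>_. c)"
  by (rule log_concaveI) (auto simp flip: powr_add)

lemma log_concave_cmult: "0 \<le> c \<Longrightarrow> log_concave f \<Longrightarrow> log_concave (\<lambda>x. c * f x)"
  by (intro log_concave_mult log_concave_const)

lemma log_concave_affine:
  assumes f: "log_concave f"
  shows "log_concave (\<lambda>x. f (a + c *\<^sub>R x))"
proof (rule log_concaveI)
  fix x y t assume t: "0 < t" "t < (1::real)"
  have "(1 - t) *\<^sub>R (a + c *\<^sub>R x) + t *\<^sub>R (a + c *\<^sub>R y) = a + c *\<^sub>R ((1 - t) *\<^sub>R x + t *\<^sub>R y)"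
    by (simp add: algebra_simps)
  then show "f (a + c *\<^sub>R x) powr (1 - t) * f (a + c *\<^sub>R y) powr t
      \<le> f (a + c *\<^sub>R ((1 - t) *\<^sub>R x + t *\<^sub>R y))"
    using log_concaveD[OF f t, of "a + c *\<^sub>R x" "a + c *\<^sub>R y"] by simp
qed (use f in \<open>auto simp: log_concave_nonneg\<close>)

lemma log_concave_indicator:
  assumes "convex A" shows "log_concave (indicator A)"
  by (rule log_concaveI) (use assms in \<open>auto simp: indicator_def convex_alt split: if_splits\<close>)

lemma convex_superlevel:
  assumes f: "log_concave f" and "0 \<le> a"
  shows "convex {x. a < f x}"
  unfolding convex_alt
proof (intro ballI allI impI)
  fix x y and t :: real assume x: "x \<in> {x. a < f x}" and y: "y \<in> {x. a < f x}" and t: "0 \<le> t \<and> t \<le> 1"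
  show "(1 - t) *\<^sub>R x + t *\<^sub>R y \<in> {x. a < f x}"
  proof (cases "t = 0 \<or> t = 1")
    case False
    then have "a powr (1 - t) * a powr t < f ((1 - t) *\<^sub>R x + t *\<^sub>R y)"
      using t x y assms by (intro log_concave_mix_less) auto
    then show ?thesis using \<open>0 \<le> a\<close> by (simp flip: powr_add)
  qed (use x y in auto)
qed

lemma emeasure_le_integral_div:
  fixes f :: "'a \<Rightarrow> real"
  assumes "integrable M f" "\<And>x. 0 \<le> f x" "A \<in> sets M" "A \<subseteq> {x. a \<le> f x}" "0 < a"
  shows "emeasure M A \<le> ennreal ((\<integral>x. f x \<partial>M) / a)"
proof -
  have "ennreal a * emeasure M A = (\<integral>\<^sup>+x. ennreal a * indicator A x \<partial>M)"
    using assms by (simp add: nn_integral_cmult_indicator)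
  also have "\<dots> \<le> (\<integral>\<^sup>+x. ennreal (f x) \<partial>M)"
    using assms by (intro nn_integral_mono) (auto split: split_indicator intro!: ennreal_leI)
  also have "\<dots> = ennreal (\<integral>x. f x \<partial>M)"
    using assms by (simp add: nn_integral_eq_integral)
  also have "\<dots> = ennreal a * ennreal ((\<integral>x. f x \<partial>M) / a)"
    using assms by (simp flip: ennreal_mult)
  finally show ?thesis using \<open>0 < a\<close>
    by (simp add: ennreal_mult_le_mult_iff)
qed

text \<open>The superlevel sets at heights \<open>1 / (n + 1)\<close> are convex. If all had empty
  interior they would be null, and so would their union, the set where \<open>f\<close> is
  positive.\<close>

lemma ex_ball_superlevel:
  fixes f :: "'a::euclidean_space \<Rightarrow> real"
  assumes f: "log_concave f" "f \<in> borel_measurable borel" and pos: "0 < (\<integral>\<^sup>+x. ennreal (f x) \<partial>lborel)"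
  obtains a z \<rho> where "0 < a" "0 < \<rho>" "ball z \<rho> \<subseteq> {x. a < f x}"
proof -
  have "\<exists>n. interior {x. inverse (real (Suc n)) < f x} \<noteq> {}"
  proof (rule ccontr)
    assume "\<not> ?thesis"
    then have "{x. inverse (real (Suc n)) < f x} \<in> null_sets lebesgue" for n
      using negligible_convex_interior[OF convex_superlevel[OF f(1), of "inverse (real (Suc n))"]]
      by (simp add: negligible_iff_null_sets)
    then have "(\<Union>n. {x. inverse (real (Suc n)) < f x}) \<in> null_sets lebesgue"
      by (rule null_sets_UN)
    also have eq: "(\<Union>n. {x. inverse (real (Suc n)) < f x}) = {x. 0 < f x}"
    proof (intro set_eqI iffI; simp)
      show "0 < f x" if "\<exists>n. inverse (1 + real n) < f x" for x
      proof -
        from that obtain n where "inverse (1 + real n) < f x" ..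
        moreover have "0 < inverse (1 + real n)" by simp
        ultimately show ?thesis by linarith
      qed
      show "\<exists>n. inverse (1 + real n) < f x" if "0 < f x" for x
        using reals_Archimedean[OF that] by simp
    qed
    finally have "{x. 0 < f x} \<in> null_sets lborel"
      using f(2) by (subst null_sets_completion_iff[symmetric]) auto
    then have "AE x in lborel. f x \<le> 0"
      by (intro AE_I') auto
    then have "(\<integral>\<^sup>+x. ennreal (f x) \<partial>lborel) = nn_integral lborel (\<lambda>x::'a. 0)"
      by (intro nn_integral_cong_AE) (auto simp: ennreal_eq_0_iff)
    then show False
      using pos by simp
  qed
  then obtain n x where "x \<in> interior {x. inverse (real (Suc n)) < f x}" by blast
  then obtain \<rho> where "0 < \<rho>" "ball x \<rho> \<subseteq> {x. inverse (real (Suc n)) < f x}"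
    using mem_interior by blast
  then show ?thesis by (intro that[of "inverse (real (Suc n))" \<rho> x]) auto
qed

section \<open>Balls in convex sets\<close>

text \<open>By Helly's theorem, some point divides every chord through it in a ratio of at most
  the dimension.\<close>

lemma convex_compact_asymmetry:
  fixes C :: "'a::euclidean_space set"
  assumes C: "convex C" "compact C" "C \<noteq> {}"
  obtains c where "c \<in> C" "\<And>x. x \<in> C \<Longrightarrow> c + (1 / real DIM('a)) *\<^sub>R (c - x) \<in> C"
proof -
  define d where "d = DIM('a)"
  have d: "d > 0" by (simp add: d_def)
  define h where "h x c = c + (1 / real d) *\<^sub>R (c - x)" for x c :: 'a
  define A where "A x = h x -` C" for x
  have cont: "continuous_on UNIV (h x)" for x
    unfolding h_def by (intro continuous_intros)
  have closed_A: "closed (A x)" for x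
    unfolding A_def using C(2) by (intro closed_vimage cont compact_imp_closed)
  have h_mix: "h x ((1 - t) *\<^sub>R p + t *\<^sub>R q) = (1 - t) *\<^sub>R h x p + t *\<^sub>R h x q" for x p q t
  proof -
    define k y where "k = 1 / real d" and "y = k *\<^sub>R x"
    have h_eq: "h x c = c + (k *\<^sub>R c - y)" for c
      by (simp add: h_def k_def y_def scaleR_diff_right)
    show ?thesis unfolding h_eq by (simp add: algebra_simps)
  qed
  have convex_A: "convex (A x)" for x
    using C(1) by (auto simp: convex_alt A_def h_mix)
  have small: "C \<inter> \<Inter>(A ` X) \<noteq> {}" if X: "finite X" "X \<subseteq> C" "X \<noteq> {}" "card X \<le> Suc d" for X
  proof -
    obtain b where b: "bij_betw b {0..<card X} X"
      using ex_bij_betw_nat_finite[OF X(1)] by blast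
    obtain x0 where "x0 \<in> X" using X by blast
    \<comment> \<open>Pads \<open>X\<close> to exactly \<open>d + 1\<close> points, indexed by
      \<open>0, ..., d\<close>, by repeating \<open>x0\<close>.\<close>
    define p where "p i = (if i < card X then b i else x0)" for i
    have p: "p i \<in> X" for i
      using b \<open>x0 \<in> X\<close> by (auto simp: p_def bij_betw_def)
    have surj: "\<exists>i\<le>d. p i = x" if xX: "x \<in> X" for x
    proof -
      have "x \<in> b ` {0..<card X}" using b xX by (simp add: bij_betw_def)
      then obtain i where "i < card X" "b i = x" by auto
      then show ?thesis using X(4) by (intro exI[of _ i]) (auto simp: p_def)
    qed
    define q where "q = (\<Sum>i\<le>d. (1 / real (Suc d)) *\<^sub>R p i)"
    have "q \<in> C"
      unfolding q_def by (rule convex_sum) (use C p X in auto)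
    moreover have "h x q \<in> C" if xX: "x \<in> X" for x
    proof -
      obtain j where j: "j \<le> d" "p j = x" using surj[OF xX] by blast
      \<comment> \<open>Dropping one of the \<open>d + 1\<close> points whose centroid is
        \<open>q\<close> leaves \<open>d\<close> points, and their centroid is \<open>h x q\<close>.
        This is what fixes the ratio \<open>1 / d\<close>.\<close>
      have "(\<Sum>i\<in>{..d} - {j}. (1 / real d) *\<^sub>R p i) \<in> C"
        by (rule convex_sum) (use C p X d j in auto)
      also have "(\<Sum>i\<in>{..d} - {j}. (1 / real d) *\<^sub>R p i) = (1 / real d) *\<^sub>R ((\<Sum>i\<le>d. p i) - x)"
        using j by (simp add: sum_diff1 flip: scaleR_sum_right)
      also have "\<dots> = h x q"
      proof -
        have s: "(\<Sum>i\<le>d. p i) = real (Suc d) *\<^sub>R q"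
          unfolding q_def by (simp flip: scaleR_sum_right)
        have "(1 / real d) * real (Suc d) = 1 + 1 / real d" using d by (simp add: field_simps)
        then have "(1 / real d) *\<^sub>R (real (Suc d) *\<^sub>R q) = (1 + 1 / real d) *\<^sub>R q"
          by (simp only: scaleR_scaleR)
        then show ?thesis
          unfolding s h_def scaleR_diff_right by (simp add: scaleR_add_left)
      qed
      finally show ?thesis .
    qed
    ultimately show ?thesis by (auto simp: A_def)
  qed
  have fin: "C \<inter> \<Inter>\<F> \<noteq> {}" if F: "finite \<F>" "\<F> \<subseteq> A ` C" for \<F>
  proof -
    obtain X where X: "X \<subseteq> C" "inj_on A X" "\<F> = A ` X"
      using F(2) subset_image_inj by metis
    have fX: "finite X" using X F finite_image_iff by blast
    show ?thesis
    proof (cases "card X \<le> Suc d")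
      case True
      then show ?thesis using small[OF fX X(1)] X(3) C(3) by (cases "X = {}") auto
    next
      case False
      have "\<Inter>\<F> \<noteq> {}"
      proof (rule Helly)
        show "DIM('a) + 1 \<le> card \<F>"
          using False X card_image[of A X] by (simp add: d_def)
        show "\<forall>S\<in>\<F>. convex S" using X convex_A by auto
        fix t assume t: "t \<subseteq> \<F>" "card t = DIM('a) + 1"
        obtain Y where Y: "Y \<subseteq> X" "inj_on A Y" "t = A ` Y"
          using t(1) X(3) subset_image_inj by metis
        have "card Y = Suc d" using Y t card_image[of A Y] by (simp add: d_def)
        then show "\<Inter>t \<noteq> {}"
          using small[of Y] Y X fX finite_subset by fastforce
      qed
      \<comment> \<open>Helly's theorem does not place \<open>q\<close> in \<open>C\<close>. But
        \<open>q\<close> lies on the segment from \<open>x\<close> to \<open>h x q\<close>, and both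
        endpoints are in \<open>C\<close>.\<close>
      then obtain q where q: "q \<in> \<Inter>\<F>" by blast
      obtain x where "x \<in> X" using False by fastforce
      then have y: "h x q \<in> C" "x \<in> C" using q X by (auto simp: A_def)
      have "real d / (real d + 1) + 1 / (real d + 1) = 1" using d by (simp add: field_simps)
      then have "(real d / (real d + 1)) *\<^sub>R h x q + (1 / (real d + 1)) *\<^sub>R x \<in> C"
        using d by (intro convexD[OF C(1) y]) auto
      also have "(real d / (real d + 1)) *\<^sub>R h x q + (1 / (real d + 1)) *\<^sub>R x = q"
      proof -
        have "real d *\<^sub>R h x q = (real d + 1) *\<^sub>R q - x"
          using d by (simp add: h_def algebra_simps)
        then have "(1 / (real d + 1)) *\<^sub>R (real d *\<^sub>R h x q) = (1 / (real d + 1)) *\<^sub>R ((real d + 1) *\<^sub>R q - x)"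
          by simp
        then show ?thesis by (simp add: scaleR_diff_right)
      qed
      finally show ?thesis using q by blast
    qed
  qed
  have "C \<inter> \<Inter>(A ` C) \<noteq> {}"
    by (rule compact_imp_fip) (use C closed_A fin in auto)
  then obtain c where "c \<in> C" "\<forall>x\<in>C. h x c \<in> C" by (auto simp: A_def)
  then show ?thesis using that by (auto simp: h_def d_def)
qed

text \<open>Take the point \<open>c\<close> that divides chords in ratio at most \<open>d\<close>.
  If a point within \<open>w0 / (d + 1)\<close> of \<open>c\<close> were outside \<open>C\<close>, a
  separating hyperplane would show that \<open>C\<close> extends by some \<beta> below
  \<open>w0 / (d + 1)\<close> on one side of \<open>c\<close>, hence by at most
  \<open>d * \<beta>\<close> on the other, and the total width would be less than
  \<open>w0\<close>.\<close>

lemma convex_compact_inball: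
  fixes C :: "'a::euclidean_space set"
  assumes C: "convex C" "compact C" "C \<noteq> {}"
    and width: "\<And>u a w. norm u = 1 \<Longrightarrow> C \<subseteq> {x. a \<le> u \<bullet> x \<and> u \<bullet> x \<le> a + w} \<Longrightarrow> w0 \<le> w"
  obtains c where "cball c (w0 / (real DIM('a) + 1)) \<subseteq> C"
proof -
  define d where "d = real DIM('a)"
  have d: "d > 0" by (simp add: d_def)
  obtain c where c: "c \<in> C" "\<And>x. x \<in> C \<Longrightarrow> c + (1 / d) *\<^sub>R (c - x) \<in> C"
    using convex_compact_asymmetry[OF C] unfolding d_def by blast
  have "cball c (w0 / (d + 1)) \<subseteq> C"
  proof
    fix p assume p: "p \<in> cball c (w0 / (d + 1))"
    show "p \<in> C"
    proof (rule ccontr)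
      assume "p \<notin> C"
      then obtain v b where v: "v \<bullet> p < b" "\<And>x. x \<in> C \<Longrightarrow> b < v \<bullet> x"
        using separating_hyperplane_closed_point[OF C(1) compact_imp_closed[OF C(2)]] by metis
      have "v \<noteq> 0" using v(1) v(2)[OF c(1)] by auto
      define u where "u = v /\<^sub>R norm v"
      define \<beta> where "\<beta> = u \<bullet> c - b / norm v"
      have u: "norm u = 1" using \<open>v \<noteq> 0\<close> by (simp add: u_def)
      have "u \<bullet> (c - p) \<le> norm (c - p)"
        using Cauchy_Schwarz_ineq2[of u "c - p"] u by simp
      also have "\<dots> \<le> w0 / (d + 1)" using p by (simp add: dist_norm)
      finally have "u \<bullet> c - u \<bullet> p \<le> w0 / (d + 1)" by (simp add: inner_diff_right)
      moreover have "u \<bullet> p < b / norm v"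
        using v(1) \<open>v \<noteq> 0\<close> by (simp add: u_def field_simps)
      ultimately have \<beta>: "\<beta> < w0 / (d + 1)" by (simp add: \<beta>_def)
      have low: "u \<bullet> c - \<beta> \<le> u \<bullet> x" if "x \<in> C" for x
        using v(2)[OF that] \<open>v \<noteq> 0\<close> by (simp add: u_def \<beta>_def field_simps)
      have up: "u \<bullet> x \<le> u \<bullet> c + d * \<beta>" if "x \<in> C" for x
      proof -
        have "(u \<bullet> x - u \<bullet> c) / d \<le> \<beta>"
          using low[OF c(2)[OF that]] by (simp add: inner_simps diff_divide_distrib)
        then show ?thesis using d by (simp add: field_simps)
      qed
      have "w0 \<le> (d + 1) * \<beta>"
        by (rule width[OF u, of "u \<bullet> c - \<beta>"]) (use low up in \<open>auto simp: algebra_simps\<close>)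
      with \<beta> d show False by (simp add: field_simps)
    qed
  qed
  then show ?thesis using that by (simp add: d_def)
qed

text \<open>The convex hull of a ball and a far point contains many disjoint balls of half the
  radius, lined up on the half of the segment nearer to the ball. Their number grows with the
  distance, so finite volume bounds it.\<close>

lemma bounded_convex_finite_measure:
  fixes D :: "'a::euclidean_space set"
  assumes D: "convex D" "D \<in> sets borel" "emeasure lborel D < \<infinity>" "interior D \<noteq> {}"
  shows "bounded D"
proof -
  obtain z r where r: "0 < r" "ball z r \<subseteq> D"
    using D(4) mem_interior by blast
  define m where "m = measure lborel (ball (0::'a) (r / 2))"
  have m: "0 < m" using r by (simp add: m_def content_ball_pos)
  have shift: "measure lborel (ball c (r/2)) = m" for c :: 'a
    using content_ball[of "r/2" c] content_ball[of "r/2" "0::'a"] r by (simp add: m_def)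
  define V where "V = measure lborel D"
  have "norm (y - z) \<le> 2 * r * (V / m + 1)" if y: "y \<in> D" for y
  proof (rule ccontr)
    assume far: "\<not> ?thesis"
    define R where "R = norm (y - z)"
    define n where "n = nat \<lfloor>V / m\<rfloor> + 1"
    have V0: "0 \<le> V" by (simp add: V_def)
    have n: "V / m < real n" "real n \<le> V / m + 1"
      using V0 m by (simp_all add: n_def) linarith+
    have "2 * r * (V / m + 1) < R" using far by (simp add: R_def)
    moreover have "0 \<le> 2 * r * (V / m + 1)" using r V0 m by simp
    ultimately have R: "0 < R" by linarith
    have nR: "2 * r * real n < R"
    proof -
      have "2 * r * real n \<le> 2 * r * (V / m + 1)" using n r by (intro mult_left_mono) auto
      with \<open>2 * r * (V / m + 1) < R\<close> show ?thesis by linarith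
    qed
    define p where "p k = z + (real k * r / R) *\<^sub>R (y - z)" for k
    have sub: "ball (p k) (r/2) \<subseteq> D" if "k < n" for k
    proof
      fix x assume x: "x \<in> ball (p k) (r/2)"
      define t where "t = real k * r / R"
      have "2 * r * real k \<le> 2 * r * real n" using that r by (intro mult_left_mono) auto
      then have "2 * (real k * r) \<le> R" using nR by (simp add: mult_ac)
      then have t: "0 \<le> t" "t \<le> 1/2"
        using r R by (auto simp: t_def field_simps)
      \<comment> \<open>The preimage of \<open>x\<close> under the homothety with centre
        \<open>y\<close> and ratio \<open>1 - t\<close>, which maps \<open>ball z r\<close> onto a
        ball around \<open>p k\<close>. Since \<open>t\<close> is at most 1/2, the radius of the
        image is at least \<open>r / 2\<close>.\<close>
      define q where "q = z + (1 / (1 - t)) *\<^sub>R (x - p k)"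
      have "norm (q - z) = norm (x - p k) / (1 - t)" using t by (simp add: q_def)
      also have "\<dots> < r"
      proof -
        have "norm (x - p k) < r / 2" using x by (simp add: dist_norm norm_minus_commute)
        also have "\<dots> \<le> r * (1 - t)" using t r by (simp add: field_simps)
        finally show ?thesis using t by (simp add: field_simps)
      qed
      finally have "q \<in> D" using r by (auto simp: dist_norm norm_minus_commute subset_iff)
      have q_eq: "(1 - t) *\<^sub>R q = (1 - t) *\<^sub>R z + (x - p k)"
        using t by (simp add: q_def scaleR_add_right)
      have "p k = z + t *\<^sub>R (y - z)" by (simp add: p_def t_def)
      then have "x = (1 - t) *\<^sub>R q + t *\<^sub>R y"
        unfolding q_eq by (simp add: algebra_simps)
      also have "\<dots> \<in> D" using D(1) \<open>q \<in> D\<close> y t by (auto simp: convex_alt)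
      finally show "x \<in> D" .
    qed
    have dist_p: "norm (p j - p k) = \<bar>real j - real k\<bar> * r" for j k
    proof -
      have "p j - p k = ((real j - real k) * r / R) *\<^sub>R (y - z)"
        by (simp add: p_def algebra_simps diff_divide_distrib)
      then show ?thesis using R r by (simp add: R_def abs_mult)
    qed
    have disj: "ball (p j) (r/2) \<inter> ball (p k) (r/2) = {}" if "j \<noteq> k" for j k
    proof -
      have "1 \<le> \<bar>real j - real k\<bar>" using that by linarith
      then have "1 * r \<le> \<bar>real j - real k\<bar> * r" using r by (intro mult_right_mono) auto
      then have "r/2 + r/2 \<le> dist (p j) (p k)" by (simp add: dist_norm dist_p)
      then show ?thesis by (rule disjoint_ballI)
    qed
    have "real n * m = (\<Sum>k<n. measure lborel (ball (p k) (r/2)))"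
      by (simp add: shift)
    also have "\<dots> = measure lborel (\<Union>k<n. ball (p k) (r/2))"
      by (rule measure_finite_Union[symmetric])
        (use disj emeasure_lborel_ball_finite in \<open>auto simp: disjoint_family_on_def less_top\<close>)
    also have "\<dots> \<le> V"
      unfolding V_def using D sub by (intro measure_mono_fmeasurable) (auto simp: fmeasurable_def)
    finally show False using n m by (simp add: field_simps)
  qed
  then have "D \<subseteq> cball z (2 * r * (V / m + 1))"
    by (auto simp: dist_norm norm_minus_commute)
  then show ?thesis using bounded_cball bounded_subset by blast
qed

section \<open>Upper semicontinuous hulls and boundedness\<close>

text \<open>The upper semicontinuous regularisation, that is the limit superior of \<open>f\<close>
  at \<open>x\<close> including the value at \<open>x\<close>, written as an infimum of local upper
  bounds. It restores the semicontinuity that limits and geometric means of densities may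
  lose.\<close>

definition usc_hull :: "('a::metric_space \<Rightarrow> real) \<Rightarrow> 'a \<Rightarrow> real" where
  "usc_hull f x = Inf {c. \<exists>r>0. \<forall>y\<in>ball x r. f y \<le> c}"

lemma upper_semicontinuous_measurable:
  assumes "upper_semicontinuous f" shows "f \<in> borel_measurable borel"
proof (rule borel_measurableI_less)
  fix a
  have "open {x. f x < a}"
  proof (subst open_subopen, intro ballI)
    fix x assume "x \<in> {x. f x < a}"
    then have "\<forall>\<^sub>F z in nhds x. f z < a"
      using assms unfolding upper_semicontinuous_def by blast
    then show "\<exists>T. open T \<and> x \<in> T \<and> T \<subseteq> {x. f x < a}"
      unfolding eventually_nhds by blast
  qed
  then show "{x \<in> space borel. f x < a} \<in> sets borel" by simp
qed

context
  fixes f :: "'a::euclidean_space \<Rightarrow> real" and B :: real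
  assumes f0: "\<And>x. 0 \<le> f x" and fB: "\<And>x. f x \<le> B"
begin

lemma usc_hull_le: "0 < r \<Longrightarrow> (\<And>y. y \<in> ball x r \<Longrightarrow> f y \<le> c) \<Longrightarrow> usc_hull f x \<le> c"
  unfolding usc_hull_def
proof (rule cInf_lower)
  show "bdd_below {c. \<exists>r>0. \<forall>y\<in>ball x r. f y \<le> c}"
  proof (rule bdd_belowI)
    fix c assume "c \<in> {c. \<exists>r>0. \<forall>y\<in>ball x r. f y \<le> c}"
    then show "0 \<le> c" using f0[of x] by (force intro: order_trans)
  qed
qed auto

lemma le_usc_hull: "(\<And>r c. 0 < r \<Longrightarrow> (\<And>y. y \<in> ball x r \<Longrightarrow> f y \<le> c) \<Longrightarrow> a \<le> c) \<Longrightarrow> a \<le> usc_hull f x"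
  unfolding usc_hull_def
proof (rule cInf_greatest)
  show "{c. \<exists>r>0. \<forall>y\<in>ball x r. f y \<le> c} \<noteq> {}"
    using fB zero_less_one by blast
qed blast

lemma usc_hull_lessD:
  assumes "usc_hull f x < a"
  obtains r c where "0 < r" "c < a" "\<And>y. y \<in> ball x r \<Longrightarrow> f y \<le> c"
proof -
  have "\<exists>r c. 0 < r \<and> c < a \<and> (\<forall>y\<in>ball x r. f y \<le> c)"
  proof (rule ccontr)
    assume "\<not> ?thesis"
    then have "a \<le> usc_hull f x" by (intro le_usc_hull) (meson not_le)
    with assms show False by simp
  qed
  then show ?thesis using that by blast
qed

lemma usc_hull_ge: "f x \<le> usc_hull f x"
  by (rule le_usc_hull) auto

lemma usc_hull_nonneg: "0 \<le> usc_hull f x"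
  using f0 usc_hull_ge order_trans by blast

lemma usc_hull_bound: "usc_hull f x \<le> B"
  by (rule usc_hull_le[of 1]) (use fB in auto)

lemma upper_semicontinuous_usc_hull: "upper_semicontinuous (usc_hull f)"
  unfolding upper_semicontinuous_def
proof (intro allI impI)
  fix x a assume "usc_hull f x < a"
  then obtain r c where r: "0 < r" "c < a" "\<And>y. y \<in> ball x r \<Longrightarrow> f y \<le> c"
    using usc_hull_lessD by blast
  have "usc_hull f z < a" if z: "z \<in> ball x r" for z
  proof -
    obtain s where "0 < s" "ball z s \<subseteq> ball x r"
      using z open_ball open_contains_ball by metis
    then have "usc_hull f z \<le> c" by (intro usc_hull_le[of s]) (use r in auto)
    with r show ?thesis by simp
  qed
  then show "\<forall>\<^sub>F z in nhds x. usc_hull f z < a"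
    unfolding eventually_nhds by (intro exI[of _ "ball x r"]) (use r in auto)
qed

lemma log_concave_usc_hull:
  assumes f: "log_concave f" shows "log_concave (usc_hull f)"
proof (rule log_concaveI)
  fix x y t assume t: "0 < t" "t < (1::real)" and pos: "0 < usc_hull f x" "0 < usc_hull f y"
  have approx: "\<exists>v\<in>ball u r. s * usc_hull f u < f v"
    if "0 < usc_hull f u" "0 < r" "s < 1" for u r s
  proof (rule ccontr)
    assume "\<not> ?thesis"
    then have "usc_hull f u \<le> s * usc_hull f u"
      by (intro usc_hull_le[OF \<open>0 < r\<close>]) (meson not_le)
    with that show False by simp
  qed
  show "usc_hull f x powr (1 - t) * usc_hull f y powr t \<le> usc_hull f ((1 - t) *\<^sub>R x + t *\<^sub>R y)"
  proof (rule le_usc_hull)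
    fix r c assume r: "0 < r" and c: "\<And>v. v \<in> ball ((1 - t) *\<^sub>R x + t *\<^sub>R y) r \<Longrightarrow> f v \<le> c"
    show "usc_hull f x powr (1 - t) * usc_hull f y powr t \<le> c"
    \<comment> \<open>Local suprema need not be attained, so the hull values are first lowered by a
      factor \<open>s < 1\<close>. The exponents sum to 1, hence the factor comes out of the
      geometric mean unchanged.\<close>
    proof (rule field_le_mult_one_interval)
      fix s :: real assume s: "0 < s" "s < 1"
      obtain x' where x': "x' \<in> ball x r" "s * usc_hull f x < f x'" using approx pos r s by blast
      obtain y' where y': "y' \<in> ball y r" "s * usc_hull f y < f y'" using approx pos r s by blast
      have "s * (usc_hull f x powr (1 - t) * usc_hull f y powr t) =
          (s * usc_hull f x) powr (1 - t) * (s * usc_hull f y) powr t"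
      proof -
        have "s powr (1 - t) * s powr t = s" using s by (simp flip: powr_add)
        moreover have "(s * usc_hull f x) powr (1 - t) * (s * usc_hull f y) powr t =
            (s powr (1 - t) * s powr t) * (usc_hull f x powr (1 - t) * usc_hull f y powr t)"
          using s pos by (simp add: powr_mult)
        ultimately show ?thesis by simp
      qed
      also have "\<dots> \<le> f ((1 - t) *\<^sub>R x' + t *\<^sub>R y')"
        using x' y' pos s t by (intro log_concave_mix_le[OF f]) auto
      also have "\<dots> \<le> c"
      proof (rule c)
        have "((1 - t) *\<^sub>R x + t *\<^sub>R y) - ((1 - t) *\<^sub>R x' + t *\<^sub>R y') = (1 - t) *\<^sub>R (x - x') + t *\<^sub>R (y - y')"
          by (simp add: algebra_simps)
        then have "dist ((1 - t) *\<^sub>R x + t *\<^sub>R y) ((1 - t) *\<^sub>R x' + t *\<^sub>R y') =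
            norm ((1 - t) *\<^sub>R (x - x') + t *\<^sub>R (y - y'))"
          by (simp only: dist_norm)
        also have "\<dots> \<le> norm ((1 - t) *\<^sub>R (x - x')) + norm (t *\<^sub>R (y - y'))"
          by (rule norm_triangle_ineq)
        also have "\<dots> = (1 - t) * norm (x - x') + t * norm (y - y')"
          using t by simp
        also have "\<dots> < (1 - t) * r + t * r"
          using x' y' t by (intro add_strict_mono mult_strict_left_mono) (auto simp: dist_norm)
        finally show "(1 - t) *\<^sub>R x' + t *\<^sub>R y' \<in> ball ((1 - t) *\<^sub>R x + t *\<^sub>R y) r"
          by (simp add: algebra_simps)
      qed
      finally show "s * (usc_hull f x powr (1 - t) * usc_hull f y powr t) \<le> c" .
    qed
  qed
qed (fact usc_hull_nonneg)

text \<open>The hull can differ from \<open>f\<close> only on the frontier of the convex set where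
  \<open>f\<close> is positive, and such a frontier is null. In the interior \<open>- ln f\<close>
  is convex, hence continuous; outside the closure both functions vanish.\<close>

lemma usc_hull_eq_AE:
  assumes f: "log_concave f" shows "AE x in lborel. usc_hull f x = f x"
proof -
  define W where "W = {x. 0 < f x}"
  have "convex W" unfolding W_def by (rule convex_superlevel[OF f]) simp
  then have "frontier W \<in> null_sets lebesgue"
    using negligible_convex_frontier negligible_iff_null_sets by blast
  then have null: "frontier W \<in> null_sets lborel"
    by (subst null_sets_completion_iff[symmetric]) (auto simp: frontier_closed borel_closed)
  have conv: "convex_on (interior W) (\<lambda>x. - ln (f x))"
  proof (rule convex_onI)
    show "convex (interior W)" using \<open>convex W\<close> by (rule convex_interior)
    fix x y \<mu> assume xy: "x \<in> interior W" "y \<in> interior W" and \<mu>: "0 < \<mu>" "\<mu> < (1::real)"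
    have pos: "0 < f x" "0 < f y" using xy interior_subset by (auto simp: W_def)
    have m: "f x powr (1 - \<mu>) * f y powr \<mu> \<le> f ((1 - \<mu>) *\<^sub>R x + \<mu> *\<^sub>R y)"
      by (rule log_concaveD[OF f \<mu>])
    moreover have "0 < f x powr (1 - \<mu>) * f y powr \<mu>" using pos by simp
    ultimately have "ln (f x powr (1 - \<mu>) * f y powr \<mu>) \<le> ln (f ((1 - \<mu>) *\<^sub>R x + \<mu> *\<^sub>R y))"
      by (intro ln_mono) auto
    then show "- ln (f ((1 - \<mu>) *\<^sub>R x + \<mu> *\<^sub>R y)) \<le> (1 - \<mu>) * - ln (f x) + \<mu> * - ln (f y)"
      using pos by (simp add: ln_mult ln_powr)
  qed
  have "continuous_on (interior W) (\<lambda>x. exp (- (- ln (f x))))"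
    by (intro continuous_intros convex_on_continuous[OF open_interior conv])
  moreover have "exp (- (- ln (f x))) = f x" if "x \<in> interior W" for x
    using that interior_subset by (auto simp: W_def)
  ultimately have "continuous_on (interior W) f"
    by (rule continuous_on_eq)
  then have cont: "isCont f x" if "x \<in> interior W" for x
    using that by (simp add: continuous_on_eq_continuous_at)
  have "usc_hull f x = f x" if x: "x \<notin> frontier W" for x
  proof (rule antisym[OF _ usc_hull_ge])
    consider "x \<in> interior W" | "x \<notin> closure W" using x by (auto simp: frontier_def)
    then show "usc_hull f x \<le> f x"
    proof cases
      case 1
      show ?thesis
      proof (rule field_le_epsilon)
        fix e :: real assume "0 < e"
        then obtain r where "0 < r" "\<And>y. dist y x < r \<Longrightarrow> dist (f y) (f x) < e"
          using cont[OF 1] unfolding continuous_at_eps_delta by blast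
        then show "usc_hull f x \<le> f x + e"
          by (intro usc_hull_le[of r]) (fastforce simp: dist_commute dist_real_def)+
      qed
    next
      case 2
      then obtain r where "0 < r" "ball x r \<subseteq> - closure W"
        using open_contains_ball[of "- closure W"] by auto
      then have "f y \<le> 0" if "y \<in> ball x r" for y
        using that closure_subset[of W] by (force simp: W_def not_less[symmetric])
      then have "usc_hull f x \<le> 0" using \<open>0 < r\<close> by (intro usc_hull_le[of r]) auto
      then show ?thesis using f0[of x] by simp
    qed
  qed
  then show ?thesis using null by (intro AE_I'[OF null]) auto
qed

end

text \<open>A large value at \<open>x\<close> forces large values at the midpoints between
  \<open>x\<close> and a ball on which \<open>f\<close> exceeds \<open>a\<close>. These midpoints
  fill a ball of fixed volume, so Markov's inequality limits \<open>sqrt (f x * a)\<close>.\<close>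

lemma log_concave_bounded:
  fixes f :: "'a::euclidean_space \<Rightarrow> real"
  assumes f: "log_concave f" "integrable lborel f" and pos: "0 < (\<integral>x. f x \<partial>lborel)"
  obtains B where "\<And>x. f x \<le> B"
proof -
  have "(\<integral>\<^sup>+x. ennreal (f x) \<partial>lborel) = ennreal (\<integral>x. f x \<partial>lborel)"
    using f by (intro nn_integral_eq_integral) (auto simp: log_concave_nonneg)
  moreover have "0 < ennreal (\<integral>x. f x \<partial>lborel)" using pos by simp
  ultimately have pos': "0 < (\<integral>\<^sup>+x. ennreal (f x) \<partial>lborel)" by (simp only:)
  have meas: "f \<in> borel_measurable borel" using f by auto
  obtain a z \<rho> where az: "0 < a" "0 < \<rho>" "ball z \<rho> \<subseteq> {x. a < f x}"
    by (rule ex_ball_superlevel[OF f(1) meas pos'])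
  define v where "v = measure lborel (ball (0::'a) (\<rho> / 2))"
  have v: "0 < v" using az by (simp add: v_def content_ball_pos)
  define I where "I = (\<integral>x. f x \<partial>lborel)"
  have "f x \<le> (I / v)\<^sup>2 / a" for x
  proof (cases "f x = 0")
    case True
    then show ?thesis using az by simp
  next
    case False
    then have fx: "0 < f x" using log_concave_nonneg[OF f(1), of x] by simp
    define m where "m = f x powr (1/2) * a powr (1/2)"
    have m: "0 < m" using fx az by (simp add: m_def)
    have "ball ((1/2) *\<^sub>R x + (1/2) *\<^sub>R z) (\<rho> / 2) \<subseteq> {y. m \<le> f y}"
    proof safe
      fix y assume y: "y \<in> ball ((1/2) *\<^sub>R x + (1/2) *\<^sub>R z) (\<rho> / 2)"
      define q where "q = 2 *\<^sub>R y - x"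
      have "z - q = 2 *\<^sub>R (((1/2) *\<^sub>R x + (1/2) *\<^sub>R z) - y)" by (simp add: q_def algebra_simps)
      then have "norm (z - q) < \<rho>" using y by (simp add: dist_norm)
      then have "q \<in> ball z \<rho>" by (simp add: dist_norm)
      then have "m \<le> f ((1 - 1/2) *\<^sub>R x + (1/2) *\<^sub>R q)"
        unfolding m_def using log_concave_mix_le[OF f(1), of "1/2" "f x" x a q] az fx by auto
      also have "(1 - 1/2) *\<^sub>R x + (1/2) *\<^sub>R q = y" by (simp add: q_def algebra_simps)
      finally show "m \<le> f y" .
    qed
    then have "emeasure lborel (ball ((1/2) *\<^sub>R x + (1/2) *\<^sub>R z) (\<rho> / 2)) \<le> ennreal (I / m)"
      unfolding I_def by (intro emeasure_le_integral_div) (use f m in \<open>auto simp: log_concave_nonneg\<close>)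
    then have "measure lborel (ball ((1/2) *\<^sub>R x + (1/2) *\<^sub>R z) (\<rho> / 2)) \<le> I / m"
      using m pos by (simp add: measure_def enn2real_leI I_def)
    then have "v \<le> I / m"
      using content_ball[of "\<rho>/2" "(1/2) *\<^sub>R x + (1/2) *\<^sub>R z"] content_ball[of "\<rho>/2" "0::'a"] az
      by (simp add: v_def)
    then have "m \<le> I / v" using m v by (simp add: field_simps)
    then have "m\<^sup>2 \<le> (I / v)\<^sup>2" using m by (intro power_mono) auto
    moreover have "m\<^sup>2 = f x * a"
      using fx az by (simp add: m_def power_mult_distrib powr_half_sqrt)
    ultimately show ?thesis using az by (simp add: pos_le_divide_eq)
  qed
  then show ?thesis using that by blast
qed

section \<open>The log-Lipschitz envelope\<close>

definition log_lipschitz_envelope :: "real \<Rightarrow> ('a::real_normed_vector \<Rightarrow> real) \<Rightarrow> 'a \<Rightarrow> real" where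
  "log_lipschitz_envelope L f x = (SUP y. f y * exp (- (L * norm (x - y))))"

context
  fixes f :: "'a::euclidean_space \<Rightarrow> real" and L B :: real
  assumes f0: "\<And>x. 0 \<le> f x" and fB: "\<And>x. f x \<le> B" and L: "0 \<le> L"
begin

lemma envelope_term_le: "f y * exp (- (L * norm (x - y))) \<le> B"
proof -
  have "f y * exp (- (L * norm (x - y))) \<le> B * 1"
    using f0[of y] fB[of y] L by (intro mult_mono) auto
  then show ?thesis by simp
qed

lemma envelope_ge: "f y * exp (- (L * norm (x - y))) \<le> log_lipschitz_envelope L f x"
  unfolding log_lipschitz_envelope_def
  by (rule cSUP_upper) (auto intro!: bdd_aboveI2 envelope_term_le)

lemma envelope_le: "(\<And>y. f y * exp (- (L * norm (x - y))) \<le> c) \<Longrightarrow> log_lipschitz_envelope L f x \<le> c"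
  unfolding log_lipschitz_envelope_def by (rule cSUP_least) auto

lemma less_envelopeD: "c < log_lipschitz_envelope L f x \<Longrightarrow> \<exists>y. c < f y * exp (- (L * norm (x - y)))"
  using envelope_le[of x c] by (meson not_le)

lemma envelope_ge_self: "f x \<le> log_lipschitz_envelope L f x"
  using envelope_ge[of x x] by simp

lemma envelope_le_bound: "log_lipschitz_envelope L f x \<le> B"
  by (rule envelope_le) (rule envelope_term_le)

lemma envelope_nonneg: "0 \<le> log_lipschitz_envelope L f x"
  using f0 envelope_ge_self order_trans by blast

text \<open>The triangle inequality, applied to each term of the supremum. The multiplicative form
  makes sense even where the envelope vanishes.\<close>

lemma envelope_lipschitz:
  "log_lipschitz_envelope L f x \<le> exp (L * norm (x - x')) * log_lipschitz_envelope L f x'"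
proof (rule envelope_le)
  fix y
  have "norm (x' - y) \<le> norm (x - x') + norm (x - y)"
    using norm_triangle_ineq[of "x' - x" "x - y"] by (simp add: norm_minus_commute)
  then have "L * norm (x' - y) \<le> L * norm (x - x') + L * norm (x - y)"
    using L mult_left_mono distrib_left by metis
  then have "exp (- (L * norm (x - y))) \<le> exp (L * norm (x - x')) * exp (- (L * norm (x' - y)))"
    by (simp flip: exp_add)
  then have "f y * exp (- (L * norm (x - y))) \<le>
      f y * (exp (L * norm (x - x')) * exp (- (L * norm (x' - y))))"
    using f0 by (intro mult_left_mono)
  also have "\<dots> = exp (L * norm (x - x')) * (f y * exp (- (L * norm (x' - y))))"
    by simp
  also have "\<dots> \<le> exp (L * norm (x - x')) * log_lipschitz_envelope L f x'"
    by (intro mult_left_mono envelope_ge) simp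
  finally show "f y * exp (- (L * norm (x - y))) \<le> \<dots>" .
qed

lemma envelope_pos:
  assumes "0 < f z" shows "0 < log_lipschitz_envelope L f x"
proof -
  have "0 < f z * exp (- (L * norm (x - z)))" using assms by simp
  then show ?thesis using envelope_ge less_le_trans by blast
qed

text \<open>One point with \<open>f z > 0\<close> makes the envelope positive everywhere, so the
  conventional value \<open>ln 0 = 0\<close> never enters.\<close>

lemma ln_envelope_lipschitz:
  assumes "0 < f z"
  shows "L-lipschitz_on UNIV (\<lambda>x. ln (log_lipschitz_envelope L f x))"
proof (rule lipschitz_onI)
  have *: "ln (log_lipschitz_envelope L f x) \<le> ln (log_lipschitz_envelope L f y) + L * norm (x - y)" for x y
  proof -
    have "ln (log_lipschitz_envelope L f x) \<le> ln (exp (L * norm (x - y)) * log_lipschitz_envelope L f y)"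
      using envelope_pos[OF assms] by (intro ln_mono envelope_lipschitz) auto
    moreover have "ln (exp (L * norm (x - y)) * log_lipschitz_envelope L f y) =
        L * norm (x - y) + ln (log_lipschitz_envelope L f y)"
      using envelope_pos[OF assms, of y] by (subst ln_mult_pos) auto
    ultimately show ?thesis by simp
  qed
  fix x y
  show "dist (ln (log_lipschitz_envelope L f x)) (ln (log_lipschitz_envelope L f y)) \<le> L * dist x y"
    using *[of x y] *[of y x] by (simp add: dist_norm norm_minus_commute abs_le_iff)
qed (fact L)

lemma continuous_envelope:
  assumes "0 < f z"
  shows "continuous_on UNIV (log_lipschitz_envelope L f)"
proof -
  have "continuous_on UNIV (\<lambda>x. exp (ln (log_lipschitz_envelope L f x)))"
    by (intro continuous_intros lipschitz_on_continuous_on[OF ln_envelope_lipschitz[OF assms]])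
  then show ?thesis using envelope_pos[OF assms] by simp
qed

text \<open>The terms of the supremum are jointly log-concave in \<open>x\<close> and
  \<open>y\<close>, and log-concavity survives a supremum over one variable: near-maximisers for
  \<open>x\<close> and \<open>x'\<close> are mixed with the same weights. The factor
  \<open>s < 1\<close> provides these near-maximisers.\<close>

lemma log_concave_envelope:
  assumes lc: "log_concave f"
  shows "log_concave (log_lipschitz_envelope L f)"
proof (rule log_concaveI)
  fix x x' t assume t: "0 < t" "t < (1::real)"
    and pos: "0 < log_lipschitz_envelope L f x" "0 < log_lipschitz_envelope L f x'"
  define E where "E = log_lipschitz_envelope L f"
  have pos': "0 < E x" "0 < E x'" using pos by (simp_all add: E_def)
  show "E x powr (1 - t) * E x' powr t \<le> E ((1 - t) *\<^sub>R x + t *\<^sub>R x')"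
  proof (rule field_le_mult_one_interval)
    fix s :: real assume s: "0 < s" "s < 1"
    obtain y where y: "s * E x < f y * exp (- (L * norm (x - y)))"
      using less_envelopeD[of "s * E x" x] s pos' by (auto simp: E_def)
    obtain y' where y': "s * E x' < f y' * exp (- (L * norm (x' - y')))"
      using less_envelopeD[of "s * E x'" x'] s pos' by (auto simp: E_def)
    have pow: "exp r powr u = exp (u * r)" for r u :: real by (simp add: powr_def)
    have "s * (E x powr (1 - t) * E x' powr t) = (s powr (1 - t) * s powr t) * (E x powr (1 - t) * E x' powr t)"
      using s by (simp flip: powr_add)
    also have "\<dots> = (s * E x) powr (1 - t) * (s * E x') powr t"
      using s pos' by (simp add: powr_mult)
    also have "\<dots> \<le> (f y * exp (- (L * norm (x - y)))) powr (1 - t) * (f y' * exp (- (L * norm (x' - y')))) powr t"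
      using y y' s pos' t f0 by (intro mult_mono[of "_ powr _" "_ powr _" "_ powr _" "_ powr _"] powr_mono2) (auto intro!: mult_nonneg_nonneg)
    also have "\<dots> = (f y powr (1 - t) * f y' powr t) *
        exp (- (L * ((1 - t) * norm (x - y) + t * norm (x' - y'))))"
    proof -
      have "exp (- (L * ((1 - t) * norm (x - y) + t * norm (x' - y')))) =
          exp ((1 - t) * - (L * norm (x - y))) * exp (t * - (L * norm (x' - y')))"
      proof -
        have "- (L * ((1 - t) * norm (x - y) + t * norm (x' - y'))) =
            (1 - t) * - (L * norm (x - y)) + t * - (L * norm (x' - y'))"
          by (simp add: algebra_simps)
        then show ?thesis by (simp only: exp_add)
      qed
      then show ?thesis using f0 by (simp add: powr_mult pow)
    qed
    also have "\<dots> \<le> f ((1 - t) *\<^sub>R y + t *\<^sub>R y') *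
        exp (- (L * norm (((1 - t) *\<^sub>R x + t *\<^sub>R x') - ((1 - t) *\<^sub>R y + t *\<^sub>R y'))))"
    proof (intro mult_mono log_concaveD[OF lc t])
      have "((1 - t) *\<^sub>R x + t *\<^sub>R x') - ((1 - t) *\<^sub>R y + t *\<^sub>R y') = (1 - t) *\<^sub>R (x - y) + t *\<^sub>R (x' - y')"
        by (simp add: algebra_simps)
      then have "norm (((1 - t) *\<^sub>R x + t *\<^sub>R x') - ((1 - t) *\<^sub>R y + t *\<^sub>R y')) \<le>
          norm ((1 - t) *\<^sub>R (x - y)) + norm (t *\<^sub>R (x' - y'))"
        using norm_triangle_ineq by metis
      also have "\<dots> = (1 - t) * norm (x - y) + t * norm (x' - y')" using t by simp
      finally show "exp (- (L * ((1 - t) * norm (x - y) + t * norm (x' - y'))))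
          \<le> exp (- (L * norm (((1 - t) *\<^sub>R x + t *\<^sub>R x') - ((1 - t) *\<^sub>R y + t *\<^sub>R y'))))"
        using L by (simp add: mult_left_mono)
    qed (use f0 in auto)
    also have "\<dots> \<le> E ((1 - t) *\<^sub>R x + t *\<^sub>R x')"
      unfolding E_def by (rule envelope_ge)
    finally show "s * (E x powr (1 - t) * E x' powr t) \<le> E ((1 - t) *\<^sub>R x + t *\<^sub>R x')" .
  qed
qed (fact envelope_nonneg)

end

section \<open>Scaling of Lebesgue measure and the layer-cake formula\<close>

lemma nn_integral_affine:
  fixes a :: "'a::euclidean_space" and g :: "'a \<Rightarrow> ennreal"
  assumes [measurable]: "g \<in> borel_measurable borel" and c: "c \<noteq> 0"
  shows "(\<integral>\<^sup>+x. g x \<partial>lborel) = ennreal (\<bar>c\<bar> ^ DIM('a)) * (\<integral>\<^sup>+x. g (a + c *\<^sub>R x) \<partial>lborel)"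
  by (subst lborel_affine[OF c, of a])
     (simp add: nn_integral_density nn_integral_distr nn_integral_cmult ennreal_power)

text \<open>The set is the image of \<open>A\<close> under the homothety with centre
  \<open>c\<close> and ratio \<open>k\<close>, written as a preimage so that measurability is
  immediate.\<close>

lemma emeasure_homothety_vimage:
  fixes A :: "'a::euclidean_space set"
  assumes A: "A \<in> sets borel" and k: "0 < k"
  shows "emeasure lborel {x. c + (1 / k) *\<^sub>R (x - c) \<in> A} = ennreal (k ^ DIM('a)) * emeasure lborel A"
proof -
  have [measurable]: "A \<in> sets borel" by (fact A)
  have "{x. c + (1 / k) *\<^sub>R (x - c) \<in> A} = (\<lambda>x. c + (1 / k) *\<^sub>R (x - c)) -` A \<inter> space borel"
    by auto
  also have "\<dots> \<in> sets borel" by measurable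
  finally have m: "{x. c + (1 / k) *\<^sub>R (x - c) \<in> A} \<in> sets borel" .
  have "emeasure lborel {x. c + (1 / k) *\<^sub>R (x - c) \<in> A} = (\<integral>\<^sup>+x. indicator {x. c + (1 / k) *\<^sub>R (x - c) \<in> A} x \<partial>lborel)"
    using m by simp
  also have "\<dots> = ennreal (k ^ DIM('a)) *
      (\<integral>\<^sup>+x. indicator {x. c + (1 / k) *\<^sub>R (x - c) \<in> A} ((c - k *\<^sub>R c) + k *\<^sub>R x) \<partial>lborel)"
    using nn_integral_affine[of "indicator {x. c + (1 / k) *\<^sub>R (x - c) \<in> A}" k "c - k *\<^sub>R c"] m k by simp
  also have "(\<lambda>x. indicator {x. c + (1 / k) *\<^sub>R (x - c) \<in> A} ((c - k *\<^sub>R c) + k *\<^sub>R x)) = (indicator A :: 'a \<Rightarrow> ennreal)"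
  proof
    fix x
    have "c - k *\<^sub>R c + k *\<^sub>R x - c = k *\<^sub>R (x - c)" by (simp add: algebra_simps)
    then show "indicator {x. c + (1 / k) *\<^sub>R (x - c) \<in> A} ((c - k *\<^sub>R c) + k *\<^sub>R x) = (indicator A x :: ennreal)"
      using k by (simp add: indicator_def)
  qed
  finally show ?thesis using A by simp
qed

lemma nn_integral_layer_cake:
  fixes h :: "'a::euclidean_space \<Rightarrow> real"
  assumes [measurable]: "h \<in> borel_measurable borel" and h0: "\<And>x. 0 \<le> h x"
  shows "(\<integral>\<^sup>+x. ennreal (h x) \<partial>lborel) = (\<integral>\<^sup>+t. indicator {0<..} t * emeasure lborel {x. t < h x} \<partial>lborel)"
proof -
  define J where "J x t = (if 0 < t \<and> t < h x then 1 else 0 :: ennreal)" for x t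
  have [measurable]: "case_prod J \<in> borel_measurable (lborel \<Otimes>\<^sub>M lborel)"
    unfolding J_def by measurable
  have "(\<integral>\<^sup>+x. ennreal (h x) \<partial>lborel) = (\<integral>\<^sup>+x. (\<integral>\<^sup>+t. J x t \<partial>lborel) \<partial>lborel)"
  proof (rule nn_integral_cong)
    fix x
    have "J x = indicator {0<..<h x}"
      by (auto simp: indicator_def fun_eq_iff J_def)
    then show "ennreal (h x) = (\<integral>\<^sup>+t. J x t \<partial>lborel)"
      using h0[of x] by simp
  qed
  also have "\<dots> = (\<integral>\<^sup>+t. (\<integral>\<^sup>+x. J x t \<partial>lborel) \<partial>lborel)"
    by (rule lborel_pair.Fubini') measurable
  also have "\<dots> = (\<integral>\<^sup>+t. indicator {0<..} t * emeasure lborel {x. t < h x} \<partial>lborel)"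
  proof (rule nn_integral_cong)
    fix t
    have "(\<lambda>x. J x t) = (\<lambda>x. indicator {0<..} t * indicator {x. t < h x} x)"
      by (auto simp: indicator_def fun_eq_iff J_def)
    then show "(\<integral>\<^sup>+x. J x t \<partial>lborel) = indicator {0<..} t * emeasure lborel {x. t < h x}"
      by (simp add: nn_integral_cmult)
  qed
  finally show ?thesis .
qed

section \<open>Superlevel sets of a log-concave density\<close>

locale log_concave_density =
  fixes f :: "'a::euclidean_space \<Rightarrow> real"
  assumes log_concave: "log_concave f"
    and integrable: "integrable lborel f"
    and integral_1: "(\<integral>x. f x \<partial>lborel) = 1"
begin

definition peak :: real where "peak = (SUP x. f x)"

text \<open>A fixed fraction of the maximum serves as reference level: Markov's inequality bounds
  the volume by \<open>exp 1 / peak\<close>, while points at logarithmic depth 1/2 still lie inside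
  and can anchor interpolations.\<close>

definition core :: "'a set" where "core = {x. peak * exp (- 1) < f x}"

lemma measurable_f [measurable]: "f \<in> borel_measurable borel"
  using integrable by auto

lemma nonneg: "0 \<le> f x"
  using log_concave by (rule log_concave_nonneg)

lemma nn_integral_1: "(\<integral>\<^sup>+x. ennreal (f x) \<partial>lborel) = 1"
  using nn_integral_eq_integral[OF integrable] nonneg by (simp add: integral_1)

lemma le_peak: "f x \<le> peak"
proof -
  obtain B where "\<And>x. f x \<le> B"
    using log_concave_bounded[OF log_concave integrable] integral_1 by auto
  then have "bdd_above (range f)" by (intro bdd_aboveI[of _ B]) auto
  then show ?thesis unfolding peak_def by (rule cSUP_upper2) auto
qed

lemma near_peak: "s < peak \<Longrightarrow> \<exists>x. s < f x"
proof (rule ccontr)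
  assume s: "s < peak" "\<not> (\<exists>x. s < f x)"
  then have "peak \<le> s" unfolding peak_def by (intro cSUP_least) (auto simp: not_less)
  with s show False by simp
qed

lemma peak_pos: "0 < peak"
proof (rule ccontr)
  assume "\<not> 0 < peak"
  then have "f x = 0" for x using le_peak[of x] nonneg[of x] by linarith
  then have "f = (\<lambda>x. 0)" by auto
  with integral_1 show False by simp
qed

lemma near_peak_exp: assumes "0 < \<delta>" obtains x where "peak * exp (- \<delta>) < f x"
proof -
  have "peak * exp (- \<delta>) < peak * 1" using assms peak_pos by (intro mult_strict_left_mono) auto
  then show ?thesis using near_peak that by auto
qed

lemma convex_core: "convex core"
  unfolding core_def using peak_pos by (intro convex_superlevel log_concave) auto

lemma core_sets [measurable]: "core \<in> sets borel"
  unfolding core_def by measurable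

lemma emeasure_core_le: "emeasure lborel core \<le> ennreal (exp 1 / peak)"
proof -
  have "emeasure lborel core \<le> ennreal ((\<integral>x. f x \<partial>lborel) / (peak * exp (- 1)))"
    using peak_pos by (intro emeasure_le_integral_div integrable nonneg core_sets[simplified]) (auto simp: core_def)
  then show ?thesis using peak_pos by (simp add: integral_1 exp_minus field_simps)
qed

lemma core_nonempty: "core \<noteq> {}"
  using near_peak_exp[of 1] by (auto simp: core_def)

text \<open>Moving from a point near the peak towards \<open>x\<close> leaves the core after a
  distance of order \<open>w\<close>, with a drop of at least 1/2 in \<open>ln f\<close>. By
  concavity the drop continues at least at this rate up to \<open>x\<close>. The extra factor
  \<open>exp 1\<close> makes the bound trivial within distance \<open>4 * w\<close>.\<close>

lemma decay_outside_slab: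
  assumes w: "0 < w" and slab: "core \<subseteq> {x. a \<le> u \<bullet> x \<and> u \<bullet> x \<le> a + w}"
  shows "f x \<le> peak * exp (1 - \<bar>u \<bullet> x - a\<bar> / (4 * w))"
proof -
  define \<rho> where "\<rho> = \<bar>u \<bullet> x - a\<bar>"
  have triv: ?thesis if "\<rho> \<le> 4 * w"
  proof -
    have "0 \<le> 1 - \<rho> / (4 * w)" using that w by (simp add: field_simps)
    then have "peak * 1 \<le> peak * exp (1 - \<rho> / (4 * w))" using peak_pos by (intro mult_left_mono) auto
    then show ?thesis using le_peak[of x] by (simp add: \<rho>_def)
  qed
  show ?thesis
  proof (cases "\<rho> \<le> 4 * w \<or> f x = 0")
    case True
    then show ?thesis using triv peak_pos by auto
  next
    case False
    then have \<rho>: "4 * w < \<rho>" and fx: "0 < f x" using nonneg[of x] by auto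
    \<comment> \<open>Shifts \<open>z\<close> by exactly \<open>2 * w\<close> along
      \<open>u\<close>, which passes out of a slab of width \<open>w\<close> in either
      direction.\<close>
    define \<kappa> where "\<kappa> = 2 * w / \<rho>"
    have \<kappa>: "0 < \<kappa>" "\<kappa> < 1" "\<kappa> * \<rho> = 2 * w" using \<rho> w by (auto simp: \<kappa>_def)
    obtain x0 where x0: "peak * exp (- (1/2)) < f x0" using near_peak_exp[of "1/2"] by auto
    have "peak * exp (- 1) < peak * exp (- (1/2))" using peak_pos by simp
    then have "x0 \<in> core" using x0 by (simp add: core_def)
    then have u0: "0 \<le> u \<bullet> x0 - a" "u \<bullet> x0 - a \<le> w" using slab by auto
    define z where "z = (1 - \<kappa>) *\<^sub>R x0 + \<kappa> *\<^sub>R x"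
    have uz: "u \<bullet> z - a = (1 - \<kappa>) * (u \<bullet> x0 - a) + \<kappa> * (u \<bullet> x - a)"
      by (simp add: z_def inner_simps algebra_simps)
    have "(1 - \<kappa>) * (u \<bullet> x0 - a) \<le> 1 * (u \<bullet> x0 - a)"
      using u0 \<kappa> by (intro mult_right_mono) auto
    then have c0: "0 \<le> (1 - \<kappa>) * (u \<bullet> x0 - a)" "(1 - \<kappa>) * (u \<bullet> x0 - a) \<le> w"
      using u0 \<kappa> by auto
    have "u \<bullet> z - a > w \<or> u \<bullet> z - a < 0"
    proof (cases "0 \<le> u \<bullet> x - a")
      case True
      then have "\<kappa> * (u \<bullet> x - a) = 2 * w" using \<kappa> by (simp add: \<rho>_def)
      then show ?thesis using uz c0 w by linarith
    next
      case False
      then have "\<kappa> * (u \<bullet> x - a) = - (2 * w)" using \<kappa> by (simp add: \<rho>_def algebra_simps)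
      then show ?thesis using uz c0 w by linarith
    qed
    then have "z \<notin> core" using slab by auto
    then have "f z \<le> peak * exp (- 1)" by (simp add: core_def)
    moreover have "(peak * exp (- (1/2))) powr (1 - \<kappa>) * f x powr \<kappa> \<le> f z"
      unfolding z_def using x0 \<kappa> peak_pos fx by (intro log_concave_mix_le[OF log_concave]) auto
    ultimately have "(peak * exp (- (1/2))) powr (1 - \<kappa>) * f x powr \<kappa> \<le> peak * exp (- 1)" by simp
    then have "ln ((peak * exp (- (1/2))) powr (1 - \<kappa>) * f x powr \<kappa>) \<le> ln (peak * exp (- 1))"
      using peak_pos fx by (intro ln_mono) auto
    then have "(1 - \<kappa>) * (ln peak - 1/2) + \<kappa> * ln (f x) \<le> ln peak - 1"
      using peak_pos fx by (simp add: ln_mult_pos ln_powr)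
    moreover have "(1 - \<kappa>) * (ln peak - 1/2) = ln peak - 1/2 - \<kappa> * ln peak + \<kappa> / 2"
      by (simp add: left_diff_distrib right_diff_distrib diff_divide_distrib)
    ultimately have a: "\<kappa> * (ln (f x) - ln peak) \<le> - (1/2)"
      using \<kappa> unfolding right_diff_distrib by linarith
    have b: "\<kappa> * (- (\<rho> / (4 * w))) = - (1/2)" using \<kappa> w by simp
    have "\<kappa> * (ln (f x) - ln peak) \<le> \<kappa> * (- (\<rho> / (4 * w)))" unfolding b by (rule a)
    then have "ln (f x) - ln peak \<le> - (\<rho> / (4 * w))"
      using \<kappa>(1) by (simp only: mult_le_cancel_left_pos)
    then have "ln (f x) \<le> ln peak + (1 - \<rho> / (4 * w))" by simp
    then have "exp (ln (f x)) \<le> exp (ln peak + (1 - \<rho> / (4 * w)))" by simp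
    then show ?thesis using fx peak_pos by (simp add: exp_add \<rho>_def)
  qed
qed

text \<open>The inscribed ball is found in the closure, which is compact because the core has finite
  volume and nonempty interior. Its open version returns to the core, since a convex set contains
  the interior of its closure.\<close>

lemma core_inball:
  assumes w0: "0 < w0"
    and width: "\<And>u a w. norm u = 1 \<Longrightarrow> 0 < w \<Longrightarrow> core \<subseteq> {x. a \<le> u \<bullet> x \<and> u \<bullet> x \<le> a + w} \<Longrightarrow> w0 \<le> w"
  obtains c where "ball c (w0 / (real DIM('a) + 1)) \<subseteq> core"
proof -
  have "interior core \<noteq> {}"
  proof
    assume "interior core = {}"
    then obtain v b where v: "v \<noteq> 0" "core \<subseteq> {x. v \<bullet> x = b}"
      using empty_interior_subset_hyperplane[OF convex_core] by blast
    \<comment> \<open>A core inside a hyperplane fits into slabs of every positive width, in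
      particular \<open>w0 / 2\<close>.\<close>
    have "w0 \<le> w0 / 2"
      by (rule width[of "v /\<^sub>R norm v" _ "b / norm v"]) (use v w0 in \<open>auto simp: field_simps\<close>)
    with w0 show False by simp
  qed
  moreover have "emeasure lborel core < \<infinity>"
    using emeasure_core_le by (rule le_less_trans) simp
  ultimately have "bounded core"
    by (intro bounded_convex_finite_measure convex_core core_sets)
  obtain c where c: "cball c (w0 / (real DIM('a) + 1)) \<subseteq> closure core"
  proof (rule convex_compact_inball)
    show "convex (closure core)" "compact (closure core)" "closure core \<noteq> {}"
      using convex_core \<open>bounded core\<close> core_nonempty by (auto simp: convex_closure)
    fix u :: 'a and a w
    assume u: "norm u = 1" and sub: "closure core \<subseteq> {x. a \<le> u \<bullet> x \<and> u \<bullet> x \<le> a + w}"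
    then have sub: "core \<subseteq> {x. a \<le> u \<bullet> x \<and> u \<bullet> x \<le> a + w}" using closure_subset by blast
    then have "0 \<le> w" using core_nonempty by fastforce
    show "w0 \<le> w"
    \<comment> \<open>The slab may have width 0, while \<open>width\<close> speaks of positive
      widths only, so the slab is widened by \<open>e\<close>.\<close>
    proof (rule field_le_epsilon)
      fix e :: real assume "0 < e"
      then show "w0 \<le> w + e"
        using sub \<open>0 \<le> w\<close> by (intro width[OF u, of _ a]) fastforce+
    qed
  qed
  have "ball c (w0 / (real DIM('a) + 1)) \<subseteq> interior (closure core)"
    using c ball_subset_cball by (intro interior_maximal) (auto simp: subset_iff)
  also have "\<dots> \<subseteq> core" by (simp add: convex_interior_closure[OF convex_core] interior_subset)
  finally show ?thesis using that by blast
qed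

text \<open>Contracting by \<open>1 / (2 + 2 * \<tau>)\<close> towards a point at logarithmic depth
  1/2 turns depth \<tau> into depth at most 1. So the superlevel set lies in a dilation of the core,
  whose volume is known.\<close>

lemma emeasure_superlevel_le:
  assumes t: "0 < t" "t < peak"
  shows "emeasure lborel {x. t < f x} \<le> ennreal ((2 + 2 * ln (peak / t)) ^ DIM('a) * (exp 1 / peak))"
proof -
  define \<tau> where "\<tau> = ln (peak / t)"
  have \<tau>: "0 < \<tau>" "t = peak * exp (- \<tau>)" using t by (auto simp: \<tau>_def exp_minus)
  obtain x0 where x0: "peak * exp (- (1/2)) < f x0" using near_peak_exp[of "1/2"] by auto
  define \<kappa> where "\<kappa> = 1 / (2 + 2 * \<tau>)"
  have \<kappa>: "0 < \<kappa>" "\<kappa> < 1" using \<tau> by (auto simp: \<kappa>_def field_simps)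
  have "{x. t < f x} \<subseteq> {x. x0 + (1 / (2 + 2 * \<tau>)) *\<^sub>R (x - x0) \<in> core}"
  proof safe
    fix x assume x: "t < f x"
    have "(1 - \<kappa>) * (1/2) + \<kappa> * \<tau> \<le> 1"
    proof -
      have "\<kappa> * \<tau> \<le> 1/2" using \<tau> by (simp add: \<kappa>_def field_simps)
      moreover have "(1 - \<kappa>) * (1/2) \<le> 1/2" using \<kappa> by simp
      ultimately show ?thesis by linarith
    qed
    then have "peak * exp (- 1) \<le> peak * exp ((1 - \<kappa>) * - (1/2) + \<kappa> * - \<tau>)"
      using peak_pos by (intro mult_left_mono) auto
    also have "\<dots> = (peak powr (1 - \<kappa>) * peak powr \<kappa>) * (exp ((1 - \<kappa>) * - (1/2)) * exp (\<kappa> * - \<tau>))"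
      using peak_pos by (simp only: exp_add powr_add[symmetric]) simp
    also have "\<dots> = (peak * exp (- (1/2))) powr (1 - \<kappa>) * (peak * exp (- \<tau>)) powr \<kappa>"
      using peak_pos by (simp add: powr_mult exp_powr_real mult.commute)
    also have "\<dots> < f ((1 - \<kappa>) *\<^sub>R x0 + \<kappa> *\<^sub>R x)"
      using x x0 \<tau> \<kappa> peak_pos by (intro log_concave_mix_less[OF log_concave]) auto
    also have "(1 - \<kappa>) *\<^sub>R x0 + \<kappa> *\<^sub>R x = x0 + (1 / (2 + 2 * \<tau>)) *\<^sub>R (x - x0)"
      unfolding \<kappa>_def[symmetric] by (simp add: algebra_simps)
    finally show "x0 + (1 / (2 + 2 * \<tau>)) *\<^sub>R (x - x0) \<in> core" by (simp add: core_def)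
  qed
  then have "emeasure lborel {x. t < f x} \<le> emeasure lborel {x. x0 + (1 / (2 + 2 * \<tau>)) *\<^sub>R (x - x0) \<in> core}"
    by (rule emeasure_mono) measurable
  also have "\<dots> = ennreal ((2 + 2 * \<tau>) ^ DIM('a)) * emeasure lborel core"
    using \<tau> by (intro emeasure_homothety_vimage core_sets) auto
  also have "\<dots> \<le> ennreal ((2 + 2 * \<tau>) ^ DIM('a)) * ennreal (exp 1 / peak)"
    by (intro mult_left_mono emeasure_core_le) auto
  also have "\<dots> = ennreal ((2 + 2 * \<tau>) ^ DIM('a) * (exp 1 / peak))"
    using \<tau> peak_pos by (intro ennreal_mult[symmetric]) auto
  finally show ?thesis by (simp add: \<tau>_def)
qed

text \<open>Mix a point at depth \<open>\<tau> / 2\<close> with the ball at depth 1, giving the ball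
  weight \<open>\<kappa> = \<tau> / (2 + \<tau>)\<close>. The resulting depth is below
  \<open>2 * \<kappa>\<close>, which is at most \<tau>. What matters is that the radius shrinks only
  linearly as \<tau> tends to 0.\<close>

lemma superlevel_inball:
  assumes ball: "ball c r \<subseteq> core" and \<tau>: "0 < \<tau>"
  obtains c' where "ball c' (r * \<tau> / (2 + \<tau>)) \<subseteq> {x. peak * exp (- \<tau>) < f x}"
proof -
  obtain x0 where x0: "peak * exp (- (\<tau>/2)) < f x0" using near_peak_exp[of "\<tau>/2"] \<tau> by auto
  define \<kappa> where "\<kappa> = \<tau> / (2 + \<tau>)"
  have \<kappa>: "0 < \<kappa>" "\<kappa> < 1" using \<tau> by (auto simp: \<kappa>_def)
  have "ball ((1 - \<kappa>) *\<^sub>R x0 + \<kappa> *\<^sub>R c) (r * \<tau> / (2 + \<tau>)) \<subseteq> {x. peak * exp (- \<tau>) < f x}"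
  proof safe
    fix x assume x: "x \<in> ball ((1 - \<kappa>) *\<^sub>R x0 + \<kappa> *\<^sub>R c) (r * \<tau> / (2 + \<tau>))"
    define q where "q = c + (1 / \<kappa>) *\<^sub>R (x - ((1 - \<kappa>) *\<^sub>R x0 + \<kappa> *\<^sub>R c))"
    have "norm (q - c) = norm (x - ((1 - \<kappa>) *\<^sub>R x0 + \<kappa> *\<^sub>R c)) / \<kappa>"
      using \<kappa> by (simp add: q_def)
    also have "\<dots> < r * \<kappa> / \<kappa>"
      using x \<kappa> by (intro divide_strict_right_mono) (auto simp: dist_norm norm_minus_commute \<kappa>_def)
    finally have "q \<in> ball c r" using \<kappa> by (simp add: dist_norm norm_minus_commute)
    then have q: "peak * exp (- 1) < f q" using ball by (auto simp: core_def)
    have "(1 - \<kappa>) * (\<tau>/2) + \<kappa> = \<kappa> * 2"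
    proof -
      have "1 - \<kappa> = 2 / (2 + \<tau>)" using \<tau> by (simp add: \<kappa>_def field_simps)
      then have "(1 - \<kappa>) * (\<tau>/2) = \<kappa>" using \<tau> by (simp add: \<kappa>_def field_simps)
      then show ?thesis by simp
    qed
    also have "\<dots> \<le> \<tau>" using \<tau> by (simp add: \<kappa>_def field_simps)
    finally have "peak * exp (- \<tau>) \<le> peak * exp ((1 - \<kappa>) * - (\<tau>/2) + \<kappa> * - 1)"
      using peak_pos by (intro mult_left_mono) auto
    also have "\<dots> = (peak powr (1 - \<kappa>) * peak powr \<kappa>) * (exp ((1 - \<kappa>) * - (\<tau>/2)) * exp (\<kappa> * - 1))"
      using peak_pos by (simp only: exp_add powr_add[symmetric]) simp
    also have "\<dots> = (peak * exp (- (\<tau>/2))) powr (1 - \<kappa>) * (peak * exp (- 1)) powr \<kappa>"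
      using peak_pos by (simp add: powr_mult exp_powr_real mult.commute)
    also have "\<dots> < f ((1 - \<kappa>) *\<^sub>R x0 + \<kappa> *\<^sub>R q)"
      using q x0 \<kappa> peak_pos by (intro log_concave_mix_less[OF log_concave]) auto
    also have "(1 - \<kappa>) *\<^sub>R x0 + \<kappa> *\<^sub>R q = x"
      using \<kappa> by (simp add: q_def scaleR_add_right)
    finally show "peak * exp (- \<tau>) < f x" .
  qed
  then show ?thesis using that by blast
qed

text \<open>At depth \<tau> the envelope enlarges the superlevel set by less than
  \<open>\<tau> / L\<close>, and a convex set containing a ball absorbs such an enlargement in a
  dilation about the centre of the ball. The radius is itself proportional to \<tau> for small
  \<tau>, so the dilation factor stays bounded up to the peak.\<close>

lemma emeasure_superlevel_envelope_le:
  assumes ball: "ball c r \<subseteq> core" and L: "0 < L" "0 < r" and t: "0 < t" "t < peak"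
  shows "emeasure lborel {x. t < log_lipschitz_envelope L f x} \<le>
    ennreal ((1 + (2 + ln (peak / t)) / (L * r)) ^ DIM('a)) * emeasure lborel {x. t < f x}"
proof -
  define \<tau> where "\<tau> = ln (peak / t)"
  have \<tau>: "0 < \<tau>" "peak * exp (- \<tau>) = t" using t by (auto simp: \<tau>_def exp_minus)
  define \<eta> where "\<eta> = (2 + \<tau>) / (L * r)"
  have \<eta>: "0 < \<eta>" using \<tau> L by (simp add: \<eta>_def)
  obtain c' where c': "ball c' (r * \<tau> / (2 + \<tau>)) \<subseteq> {x. t < f x}"
    using superlevel_inball[OF ball \<tau>(1), unfolded \<tau>(2)] by blast
  have conv: "convex {x. t < f x}" using t by (intro convex_superlevel log_concave) auto
  have "{x. t < log_lipschitz_envelope L f x} \<subseteq> {x. c' + (1 / (1 + \<eta>)) *\<^sub>R (x - c') \<in> {x. t < f x}}"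
  proof
    fix x assume "x \<in> {x. t < log_lipschitz_envelope L f x}"
    then obtain y where y: "t < f y * exp (- (L * norm (x - y)))"
      using less_envelopeD[of f peak L t x, OF nonneg le_peak less_imp_le[OF L(1)]] by auto
    define s where "s = norm (x - y)"
    have s0: "0 \<le> s" by (simp add: s_def)
    have "f y * exp (- (L * s)) \<le> f y * 1"
      using L nonneg s0 by (intro mult_left_mono) auto
    then have fy: "t < f y" using y by (simp add: s_def)
    have "f y * exp (- (L * s)) \<le> peak * exp (- (L * s))"
      using le_peak by (intro mult_right_mono) auto
    then have "t < peak * exp (- (L * s))" using y unfolding s_def by linarith
    then have "peak * exp (- \<tau>) < peak * exp (- (L * s))" by (simp only: \<tau>(2))
    then have "L * s < \<tau>" using peak_pos by simp
    moreover have "\<eta> * (r * \<tau> / (2 + \<tau>)) = \<tau> / L"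
      using L \<tau> by (simp add: \<eta>_def divide_simps)
    moreover have "s < \<tau> / L" using \<open>L * s < \<tau>\<close> L by (simp add: field_simps)
    ultimately have "s < \<eta> * (r * \<tau> / (2 + \<tau>))" by (simp only:)
    then have "norm ((1 / \<eta>) *\<^sub>R (x - y)) < r * \<tau> / (2 + \<tau>)"
    proof -
      have "norm ((1 / \<eta>) *\<^sub>R (x - y)) = s / \<eta>" using \<eta> by (simp only: norm_scaleR) (simp add: s_def)
      moreover have "s / \<eta> < r * \<tau> / (2 + \<tau>)"
        using \<open>s < \<eta> * (r * \<tau> / (2 + \<tau>))\<close> \<eta> by (simp only: pos_divide_less_eq mult.commute)
      ultimately show ?thesis by (simp only:)
    qed
    then have "c' + (1 / \<eta>) *\<^sub>R (x - y) \<in> ball c' (r * \<tau> / (2 + \<tau>))"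
      by (simp add: dist_norm del: norm_scaleR)
    then have "c' + (1 / \<eta>) *\<^sub>R (x - y) \<in> {x. t < f x}"
      using c' by blast
    moreover have "1 / (1 + \<eta>) + \<eta> / (1 + \<eta>) = 1" using \<eta> by (simp add: field_simps)
    \<comment> \<open>The weights are chosen so that \<open>y\<close> cancels: the point of the
      superlevel set and the point of the inscribed ball combine to the contraction of
      \<open>x\<close> towards \<open>c'\<close>.\<close>
    ultimately have "(1 / (1 + \<eta>)) *\<^sub>R y + (\<eta> / (1 + \<eta>)) *\<^sub>R (c' + (1 / \<eta>) *\<^sub>R (x - y)) \<in> {x. t < f x}"
      using \<eta> fy by (intro convexD[OF conv]) auto
    also have "(1 / (1 + \<eta>)) *\<^sub>R y + (\<eta> / (1 + \<eta>)) *\<^sub>R (c' + (1 / \<eta>) *\<^sub>R (x - y)) =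
        c' + (1 / (1 + \<eta>)) *\<^sub>R (x - c')"
    proof -
      define k where "k = 1 / (1 + \<eta>)"
      have k: "\<eta> / (1 + \<eta>) = 1 - k" "(1 - k) * (1 / \<eta>) = k" using \<eta> by (auto simp: k_def field_simps)
      have "(1 - k) *\<^sub>R (c' + (1 / \<eta>) *\<^sub>R (x - y)) = (1 - k) *\<^sub>R c' + k *\<^sub>R (x - y)"
        unfolding scaleR_add_right scaleR_scaleR k(2) ..
      then show ?thesis unfolding k(1) k_def[symmetric] by (simp add: algebra_simps)
    qed
    finally show "x \<in> {x. c' + (1 / (1 + \<eta>)) *\<^sub>R (x - c') \<in> {x. t < f x}}" by simp
  qed
  then have "emeasure lborel {x. t < log_lipschitz_envelope L f x} \<le>
      emeasure lborel {x. c' + (1 / (1 + \<eta>)) *\<^sub>R (x - c') \<in> {x. t < f x}}"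
    by (rule emeasure_mono) measurable
  also have "\<dots> = ennreal ((1 + \<eta>) ^ DIM('a)) * emeasure lborel {x. t < f x}"
    using \<eta> by (intro emeasure_homothety_vimage) auto
  finally show ?thesis by (simp add: \<eta>_def \<tau>_def)
qed

end

text \<open>The left side is convex in \<open>1 / K\<close>, so on the interval from 0 to 1 it lies
  below its chord. The excess over 1 thereby becomes proportional to \<open>1 / K\<close>.\<close>

lemma power_one_plus_div_le:
  fixes a K :: real
  assumes "0 \<le> a" "1 \<le> K"
  shows "(1 + a / K) ^ n \<le> 1 + ((1 + a) ^ n - 1) / K"
proof (induction n)
  case (Suc n)
  define X where "X = (1 + a) ^ n - 1"
  have X: "0 \<le> X" using assms by (simp add: X_def one_le_power)
  have "a * X / K / K \<le> a * X / K"
    using assms mult_right_mono[of 1 K "a * X"] X by (simp add: field_simps)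
  have "(1 + a / K) ^ Suc n \<le> (1 + a / K) * (1 + X / K)"
    using Suc assms by (simp add: X_def mult_left_mono)
  also have "\<dots> = 1 + a / K + X / K + a * X / K / K" by (simp add: distrib_left distrib_right mult_ac)
  also have "\<dots> \<le> 1 + a / K + X / K + a * X / K" using \<open>a * X / K / K \<le> a * X / K\<close> by simp
  also have "\<dots> = 1 + ((1 + a) ^ Suc n - 1) / K"
    by (simp add: X_def algebra_simps flip: add_divide_distrib)
  finally show ?case .
qed simp

text \<open>The 2 comes from integrating \<open>t powr (-1/2)\<close>, \<open>exp 1\<close> from the
  volume of the core, and the power from trading the volume polynomials in \<tau> for
  \<open>exp (\<tau> / 2)\<close>.\<close>

definition envelope_const :: "nat \<Rightarrow> real" where
  "envelope_const d = 2 * exp 1 * (6 * (4 * real d)\<^sup>2) ^ d"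

text \<open>With \<open>\<tau> = ln (peak / t)\<close>, the exponential is
  \<open>sqrt (peak / t)\<close>, which is integrable at 0. The factor \<open>4 * real d\<close>
  distributes the exponent \<open>\<tau> / 2\<close> evenly over \<open>2 * d\<close> factors
  \<open>1 + \<tau>\<close>.\<close>

lemma power_product_le_exp:
  fixes \<tau> :: real
  assumes "0 \<le> \<tau>" "0 < d"
  shows "(3 + \<tau>) ^ d * (2 + 2 * \<tau>) ^ d \<le> (6 * (4 * real d)\<^sup>2) ^ d * exp (\<tau> / 2)"
proof -
  have "1 + \<tau> \<le> 4 * real d * (1 + \<tau> / (4 * real d))"
    using assms by (simp add: field_simps)
  also have "\<dots> \<le> 4 * real d * exp (\<tau> / (4 * real d))"
    using assms by (intro mult_left_mono exp_ge_add_one_self) auto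
  finally have "(1 + \<tau>)\<^sup>2 \<le> (4 * real d * exp (\<tau> / (4 * real d)))\<^sup>2"
    using assms by (intro power_mono) auto
  also have "\<dots> = (4 * real d)\<^sup>2 * exp (\<tau> / (2 * real d))"
    by (simp add: power_mult_distrib flip: exp_double)
  finally have *: "(1 + \<tau>)\<^sup>2 \<le> (4 * real d)\<^sup>2 * exp (\<tau> / (2 * real d))" .
  have "(3 + \<tau>) * (2 + 2 * \<tau>) \<le> 6 * (1 + \<tau>)\<^sup>2"
    using assms by (simp add: power2_eq_square algebra_simps)
  also have "\<dots> \<le> 6 * ((4 * real d)\<^sup>2 * exp (\<tau> / (2 * real d)))" using * by simp
  finally have "((3 + \<tau>) * (2 + 2 * \<tau>)) ^ d \<le> (6 * ((4 * real d)\<^sup>2 * exp (\<tau> / (2 * real d)))) ^ d"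
    using assms by (intro power_mono) auto
  also have "\<dots> = (6 * (4 * real d)\<^sup>2) ^ d * exp (\<tau> / (2 * real d)) ^ d"
    by (simp only: mult.assoc[symmetric] power_mult_distrib)
  also have "exp (\<tau> / (2 * real d)) ^ d = exp (\<tau> / 2)"
    using assms by (simp flip: exp_of_nat_mult)
  finally show ?thesis by (simp add: power_mult_distrib)
qed

context log_concave_density begin

text \<open>Level by level, the dilation factor exceeds 1 by at most
  \<open>(3 + \<tau>) ^ d / K\<close>. Multiplied by the volume of the superlevel set this excess is
  at most \<open>C * t powr (-1/2)\<close>, and integration over heights up to \<open>peak\<close>
  gives the surplus mass.\<close>

lemma envelope_integral:
  assumes ball: "ball c r \<subseteq> core" and r: "0 < r" and Lr: "1 \<le> L * r"
  shows "integrable lborel (log_lipschitz_envelope L f)"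
    and "(\<integral>x. log_lipschitz_envelope L f x \<partial>lborel) \<le> 1 + envelope_const DIM('a) / (L * r)"
proof -
  define E where "E = log_lipschitz_envelope L f"
  define K where "K = L * r"
  define d where "d = DIM('a)"
  have d: "0 < d" by (simp add: d_def)
  have "0 < L" using r Lr zero_less_mult_pos2[of L r] by linarith
  have K: "1 \<le> K" "0 < K" using Lr by (auto simp: K_def)
  have E0: "0 \<le> E x" for x unfolding E_def by (rule envelope_nonneg[of f peak L, OF nonneg le_peak less_imp_le[OF \<open>0 < L\<close>]])
  have Ep: "E x \<le> peak" for x unfolding E_def by (rule envelope_le_bound[of f peak L, OF nonneg le_peak less_imp_le[OF \<open>0 < L\<close>]])
  obtain z where "0 < f z" using near_peak[OF peak_pos] by blast
  have "continuous_on UNIV E"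
    unfolding E_def by (rule continuous_envelope[of f peak L z, OF nonneg le_peak less_imp_le[OF \<open>0 < L\<close>] \<open>0 < f z\<close>])
  then have [measurable]: "E \<in> borel_measurable borel" by (rule borel_measurable_continuous_onI)
  define C where "C = (6 * (4 * real d)\<^sup>2) ^ d * (exp 1 / peak) / K * peak powr (1/2)"
  have C: "0 \<le> C" using K peak_pos by (simp add: C_def)
  have main: "indicator {0<..} t * emeasure lborel {x. t < E x} \<le>
      indicator {0<..} t * emeasure lborel {x. t < f x} + ennreal (C * t powr (- (1/2))) * indicator {0..peak} t"
    for t :: real
  proof -
    consider "t \<le> 0" | "peak \<le> t" | "0 < t" "t < peak" by linarith
    then show ?thesis
    proof cases
      case 2
      then have "{x. t < E x} = {}" using Ep by (auto simp: not_less intro: order_trans)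
      then show ?thesis by simp
    next
      case 3
      define \<tau> where "\<tau> = ln (peak / t)"
      have \<tau>: "0 < \<tau>" using 3 by (simp add: \<tau>_def)
      have "emeasure lborel {x. t < E x} \<le> ennreal ((1 + (2 + \<tau>) / K) ^ d) * emeasure lborel {x. t < f x}"
        unfolding E_def K_def \<tau>_def d_def by (rule emeasure_superlevel_envelope_le[OF ball \<open>0 < L\<close> r 3])
      also have "\<dots> \<le> ennreal (1 + (3 + \<tau>) ^ d / K) * emeasure lborel {x. t < f x}"
      proof (intro mult_right_mono ennreal_leI)
        have "(1 + (2 + \<tau>) / K) ^ d \<le> 1 + ((1 + (2 + \<tau>)) ^ d - 1) / K"
          using \<tau> K by (intro power_one_plus_div_le) auto
        also have "\<dots> \<le> 1 + (3 + \<tau>) ^ d / K"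
          using K by (intro add_left_mono divide_right_mono) auto
        finally show "(1 + (2 + \<tau>) / K) ^ d \<le> 1 + (3 + \<tau>) ^ d / K" .
      qed auto
      also have "\<dots> = emeasure lborel {x. t < f x} + ennreal ((3 + \<tau>) ^ d / K) * emeasure lborel {x. t < f x}"
        using \<tau> K by (simp add: ennreal_plus distrib_right del: ennreal_plus[symmetric])
      also have "\<dots> \<le> emeasure lborel {x. t < f x} +
          ennreal ((3 + \<tau>) ^ d / K) * ennreal ((2 + 2 * \<tau>) ^ d * (exp 1 / peak))"
        unfolding d_def \<tau>_def by (intro add_left_mono mult_left_mono emeasure_superlevel_le 3) auto
      also have "ennreal ((3 + \<tau>) ^ d / K) * ennreal ((2 + 2 * \<tau>) ^ d * (exp 1 / peak)) =
          ennreal ((3 + \<tau>) ^ d / K * ((2 + 2 * \<tau>) ^ d * (exp 1 / peak)))"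
        using \<tau> K peak_pos by (intro ennreal_mult[symmetric]) auto
      also have "(3 + \<tau>) ^ d / K * ((2 + 2 * \<tau>) ^ d * (exp 1 / peak)) =
          ((3 + \<tau>) ^ d * (2 + 2 * \<tau>) ^ d) * (exp 1 / peak / K)" by (simp add: mult_ac)
      also have "ennreal \<dots> \<le> ennreal (C * t powr (- (1/2)))"
      proof (rule ennreal_leI)
        have "((3 + \<tau>) ^ d * (2 + 2 * \<tau>) ^ d) * (exp 1 / peak / K) \<le>
            ((6 * (4 * real d)\<^sup>2) ^ d * exp (\<tau> / 2)) * (exp 1 / peak / K)"
          using \<tau> d K peak_pos by (intro mult_right_mono power_product_le_exp) auto
        also have "exp (\<tau> / 2) = peak powr (1/2) * t powr (- (1/2))"
        proof -
          have "\<tau> / 2 = 1/2 * ln peak + (- (1/2)) * ln t"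
            using 3 peak_pos by (simp add: \<tau>_def ln_div)
          then show ?thesis using 3 peak_pos by (simp only: exp_add) (simp add: powr_def)
        qed
        finally show "((3 + \<tau>) ^ d * (2 + 2 * \<tau>) ^ d) * (exp 1 / peak / K) \<le> C * t powr (- (1/2))"
          by (simp add: C_def mult_ac)
      qed
      finally show ?thesis using 3 by simp
    qed simp
  qed
  have "(\<integral>\<^sup>+x. ennreal (E x) \<partial>lborel) = (\<integral>\<^sup>+t. indicator {0<..} t * emeasure lborel {x. t < E x} \<partial>lborel)"
    by (rule nn_integral_layer_cake) (auto simp: E0)
  also have "\<dots> \<le> (\<integral>\<^sup>+t. indicator {0<..} t * emeasure lborel {x. t < f x} +
      ennreal (C * t powr (- (1/2))) * indicator {0..peak} t \<partial>lborel)"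
    by (intro nn_integral_mono main)
  also have "\<dots> = (\<integral>\<^sup>+t. indicator {0<..} t * emeasure lborel {x. t < f x} \<partial>lborel) +
      (\<integral>\<^sup>+t. ennreal (C * t powr (- (1/2))) * indicator {0..peak} t \<partial>lborel)"
    by (intro nn_integral_add) measurable
  also have "(\<integral>\<^sup>+t. indicator {0<..} t * emeasure lborel {x. t < f x} \<partial>lborel) = 1"
    using nn_integral_layer_cake[of f] nonneg nn_integral_1 by simp
  also have "(\<integral>\<^sup>+t. ennreal (C * t powr (- (1/2))) * indicator {0..peak} t \<partial>lborel) = ennreal (envelope_const d / K)"
  proof -
    have "((\<lambda>t. C * t powr (- (1/2))) has_integral C * (peak powr (- (1/2) + 1) / (- (1/2) + 1))) {0..peak}"
      using peak_pos by (intro has_integral_mult_right has_integral_powr_from_0) auto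
    then have "(\<integral>\<^sup>+t. ennreal (C * t powr (- (1/2))) * indicator {0..peak} t \<partial>lborel) =
        ennreal (C * (peak powr (- (1/2) + 1) / (- (1/2) + 1)))"
      using C by (intro nn_integral_has_integral_lebesgue') auto
    also have "C * (peak powr (- (1/2) + 1) / (- (1/2) + 1)) =
        2 * ((6 * (4 * real d)\<^sup>2) ^ d * (exp 1 / peak) / K) * (peak powr (1/2) * peak powr (1/2))"
      by (simp add: C_def)
    also have "peak powr (1/2) * peak powr (1/2) = peak"
      using peak_pos by (simp flip: powr_add)
    finally show ?thesis using peak_pos by (simp add: envelope_const_def mult_ac)
  qed
  also have "1 + ennreal (envelope_const d / K) = ennreal (1 + envelope_const d / K)"
    using K by (subst ennreal_plus) (auto simp: envelope_const_def)
  finally have bound: "(\<integral>\<^sup>+x. ennreal (E x) \<partial>lborel) \<le> ennreal (1 + envelope_const d / K)" .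
  show "integrable lborel (log_lipschitz_envelope L f)"
    unfolding E_def[symmetric] using bound E0
    by (intro integrableI_nonneg) (auto intro: le_less_trans)
  then have "ennreal (\<integral>x. E x \<partial>lborel) \<le> ennreal (1 + envelope_const d / K)"
    using bound E0 by (subst nn_integral_eq_integral[symmetric]) (auto simp: E_def)
  moreover have "0 \<le> 1 + envelope_const d / K" using K by (simp add: envelope_const_def)
  ultimately have "(\<integral>x. E x \<partial>lborel) \<le> 1 + envelope_const d / K" by (simp only: ennreal_le_iff)
  then show "(\<integral>x. log_lipschitz_envelope L f x \<partial>lborel) \<le> 1 + envelope_const DIM('a) / (L * r)"
    by (simp only: E_def K_def d_def)
qed

end

section \<open>Expected log-densities\<close>

text \<open>Positivity is demanded separately because \<open>ln 0 = 0\<close>: otherwise a density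
  vanishing on a set of positive \<open>P\<close>-measure could appear to have a finite expected
  logarithm.\<close>

definition log_integrable :: "'a measure \<Rightarrow> ('a \<Rightarrow> real) \<Rightarrow> bool" where
  "log_integrable P f \<longleftrightarrow> (AE x in P. 0 < f x) \<and> integrable P (\<lambda>x. ln (f x))"

lemma expected_log_eq_integral:
  assumes "log_integrable P f"
  shows "expected_log P f = ereal (\<integral>x. ln (f x) \<partial>P)"
proof -
  have AE: "AE x in P. 0 < f x" and int: "integrable P (\<lambda>x. ln (f x))"
    using assms by (auto simp: log_integrable_def)
  define a where "a = (\<integral>\<^sup>+x. ennreal (ln (f x)) \<partial>P)"
  define b where "b = (\<integral>\<^sup>+x. ennreal (- ln (f x)) \<partial>P)"
  have "(\<integral>\<^sup>+x. e2ennreal (elog (f x)) \<partial>P) = a"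
    unfolding a_def by (rule nn_integral_cong_AE) (use AE in \<open>auto simp: elog_def\<close>)
  moreover have "(\<integral>\<^sup>+x. e2ennreal (- elog (f x)) \<partial>P) = b"
    unfolding b_def by (rule nn_integral_cong_AE) (use AE in \<open>auto simp: elog_def\<close>)
  moreover have "a \<noteq> \<infinity>" "b \<noteq> \<infinity>" "(\<integral>x. ln (f x) \<partial>P) = enn2real a - enn2real b"
    using int real_lebesgue_integral_def[OF int] by (auto simp: a_def b_def real_integrable_def)
  moreover have "enn2ereal z = ereal (enn2real z)" if "z \<noteq> \<infinity>" for z
    using that by (cases z) auto
  ultimately show ?thesis by (simp add: expected_log_def)
qed

text \<open>The upper bound on \<open>f\<close> makes the integral of the positive part finite, so
  the value can fail to be finite only by being minus infinity.\<close>

lemma log_integrableI_expected_log: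
  fixes P :: "'a measure"
  assumes P: "prob_space P" and f: "f \<in> borel_measurable P" "\<And>x. 0 \<le> f x" "\<And>x. f x \<le> B"
    and fin: "expected_log P f \<noteq> - \<infinity>"
  shows "log_integrable P f"
proof -
  interpret prob_space P by (fact P)
  have [measurable]: "f \<in> borel_measurable P" by (fact f(1))
  \<comment> \<open>The negative part of the extended logarithm, in a form whose measurability is
    automatic; the value infinity records the zeros of \<open>f\<close>.\<close>
  define b where "b x = (if 0 < f x then ennreal (- ln (f x)) else \<infinity>)" for x
  have [measurable]: "b \<in> borel_measurable P" unfolding b_def by measurable
  have "e2ennreal (elog (f x)) \<le> ennreal (ln (max B 1))" for x
    using f(2)[of x] f(3)[of x] by (auto simp: elog_def e2ennreal_neg intro!: ennreal_leI)
  then have "(\<integral>\<^sup>+x. e2ennreal (elog (f x)) \<partial>P) \<le> (\<integral>\<^sup>+x. ennreal (ln (max B 1)) \<partial>P)"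
    by (intro nn_integral_mono)
  also have "\<dots> < \<infinity>" by (simp add: emeasure_space_1)
  finally have a: "(\<integral>\<^sup>+x. e2ennreal (elog (f x)) \<partial>P) < \<infinity>" .
  have "(\<integral>\<^sup>+x. e2ennreal (- elog (f x)) \<partial>P) = (\<integral>\<^sup>+x. b x \<partial>P)"
    by (rule nn_integral_cong) (auto simp: elog_def b_def)
  moreover have "(\<integral>\<^sup>+x. e2ennreal (- elog (f x)) \<partial>P) \<noteq> \<infinity>"
  proof
    assume "(\<integral>\<^sup>+x. e2ennreal (- elog (f x)) \<partial>P) = \<infinity>"
    moreover have "enn2ereal z - \<infinity> = - \<infinity>" if "z < \<infinity>" for z using that by (cases z) auto
    ultimately show False using fin a by (simp add: expected_log_def)
  qed
  ultimately have b: "(\<integral>\<^sup>+x. b x \<partial>P) < \<infinity>" by (simp add: less_top)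
  then have "AE x in P. b x \<noteq> \<infinity>" by (intro nn_integral_PInf_AE) auto
  then have pos: "AE x in P. 0 < f x" by eventually_elim (auto simp: b_def split: if_splits)
  have "(\<integral>\<^sup>+x. ennreal (norm (ln (f x))) \<partial>P) \<le> (\<integral>\<^sup>+x. e2ennreal (elog (f x)) + b x \<partial>P)"
  proof (rule nn_integral_mono_AE)
    show "AE x in P. ennreal (norm (ln (f x))) \<le> e2ennreal (elog (f x)) + b x"
      using pos by eventually_elim (auto simp: elog_def b_def abs_if)
  qed
  also have "\<dots> = (\<integral>\<^sup>+x. e2ennreal (elog (f x)) \<partial>P) + (\<integral>\<^sup>+x. b x \<partial>P)"
    by (rule nn_integral_add) (auto simp: elog_def)
  also have "\<dots> < \<infinity>" using a b by simp
  finally have "integrable P (\<lambda>x. ln (f x))" by (intro integrableI_bounded) auto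
  with pos show ?thesis by (simp add: log_integrable_def)
qed

section \<open>Distributions not carried by a hyperplane, and their directional deviations\<close>

locale nondegenerate_distribution = prob_space P for P :: "'a::euclidean_space measure" +
  assumes sets_eq: "sets P = sets borel"
    and integrable_norm: "integrable P norm"
    and hyperplane: "u \<noteq> 0 \<Longrightarrow> measure P {x. u \<bullet> x = c} < 1"

lemma nondegenerate_distribution_iff:
  "nondegenerate_distribution P \<longleftrightarrow> P \<in> nondegenerate_distributions"
  by (auto simp: nondegenerate_distribution_def nondegenerate_distribution_axioms_def nondegenerate_distributions_def)

context nondegenerate_distribution begin

lemma measurable_eq: "borel_measurable P = borel_measurable borel"
  using sets_eq by (rule measurable_cong_sets) simp

lemma measurable_P [measurable (raw)]: "g \<in> borel_measurable borel \<Longrightarrow> g \<in> borel_measurable P"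
  by (simp add: measurable_eq)

lemma integrable_lipschitz:
  fixes h :: "'a \<Rightarrow> real"
  assumes h: "L-lipschitz_on UNIV h" shows "integrable P h"
proof (rule Bochner_Integration.integrable_bound)
  show "integrable P (\<lambda>x. \<bar>h 0\<bar> + L * norm x)"
    using integrable_norm by (intro Bochner_Integration.integrable_add integrable_mult_right) auto
  show "h \<in> borel_measurable P"
    by (intro measurable_P borel_measurable_continuous_onI lipschitz_on_continuous_on[OF h])
  have "\<bar>h x\<bar> \<le> \<bar>h 0\<bar> + L * norm x" for x
    using lipschitz_onD[OF h, of x 0] by (simp add: dist_norm)
  moreover have "0 \<le> L" using h by (rule lipschitz_on_nonneg)
  ultimately show "AE x in P. norm (h x) \<le> norm (\<bar>h 0\<bar> + L * norm x)"
    by (auto intro: order_trans)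
qed

lemma integrable_id: "integrable P (\<lambda>x. x)"
  using integrable_norm by (subst integrable_norm_iff[symmetric]) auto

lemma abs_inner_lipschitz:
  fixes u :: 'a
  assumes "norm u = 1" shows "1-lipschitz_on UNIV (\<lambda>x. \<bar>u \<bullet> (x - a)\<bar>)"
proof (rule lipschitz_onI)
  fix x y :: 'a
  have "\<bar>\<bar>u \<bullet> (x - a)\<bar> - \<bar>u \<bullet> (y - a)\<bar>\<bar> \<le> \<bar>u \<bullet> (x - y)\<bar>"
    by (simp add: inner_diff_right)
  also have "\<dots> \<le> norm (x - y)" using Cauchy_Schwarz_ineq2[of u "x - y"] assms by simp
  finally show "dist \<bar>u \<bullet> (x - a)\<bar> \<bar>u \<bullet> (y - a)\<bar> \<le> 1 * dist x y"
    by (simp add: dist_norm)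
qed simp

lemma min_abs_deviation_le:
  assumes u: "norm u = 1" shows "min_abs_deviation P \<le> (\<integral>x. \<bar>u \<bullet> (x - mean P)\<bar> \<partial>P)"
  unfolding min_abs_deviation_def
  by (rule cINF_lower) (use u in \<open>auto intro!: bdd_belowI2[of _ 0] integral_nonneg_AE\<close>)

text \<open>Recentring from \<open>a\<close> to the mean costs at most the deviation around
  \<open>a\<close> once more, since the mean is off from \<open>a\<close> by no more than
  that.\<close>

lemma min_abs_deviation_le_double:
  assumes u: "norm u = 1" shows "min_abs_deviation P \<le> 2 * (\<integral>x. \<bar>u \<bullet> x - a\<bar> \<partial>P)"
proof -
  have int: "integrable P (\<lambda>x. u \<bullet> x - a)" using integrable_id by (auto intro!: Bochner_Integration.integrable_diff)
  have "(\<integral>x. u \<bullet> x - a \<partial>P) = u \<bullet> mean P - a"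
    using integrable_id prob_space by (simp add: mean_def)
  then have m: "\<bar>u \<bullet> mean P - a\<bar> \<le> (\<integral>x. \<bar>u \<bullet> x - a\<bar> \<partial>P)"
    using integral_abs_bound[of P "\<lambda>x. u \<bullet> x - a"] by simp
  have "(\<integral>x. \<bar>u \<bullet> (x - mean P)\<bar> \<partial>P) \<le> (\<integral>x. \<bar>u \<bullet> x - a\<bar> + \<bar>u \<bullet> mean P - a\<bar> \<partial>P)"
    using int integrable_lipschitz[OF abs_inner_lipschitz[OF u]]
    by (intro integral_mono) (auto simp: inner_diff_right)
  also have "\<dots> = (\<integral>x. \<bar>u \<bullet> x - a\<bar> \<partial>P) + \<bar>u \<bullet> mean P - a\<bar>"
    using int prob_space by simp
  finally show ?thesis using m min_abs_deviation_le[OF u] by simp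
qed

text \<open>The deviation in direction \<open>u\<close> is Lipschitz in \<open>u\<close>, so its
  minimum over the sphere is attained. A minimum of 0 would put all of \<open>P\<close> on a
  hyperplane.\<close>

lemma min_abs_deviation_pos: "0 < min_abs_deviation P"
proof -
  define h where "h u = (\<integral>x. \<bar>u \<bullet> (x - mean P)\<bar> \<partial>P)" for u
  have int: "integrable P (\<lambda>x. \<bar>u \<bullet> (x - mean P)\<bar>)" for u
    using integrable_id by (auto intro!: integrable_inner_right)
  have int': "integrable P (\<lambda>x. norm (x - mean P))"
    using integrable_id by (intro Bochner_Integration.integrable_norm Bochner_Integration.integrable_diff) auto
  have "(\<integral>x. norm (x - mean P) \<partial>P)-lipschitz_on UNIV h"
  proof (rule lipschitz_onI)
    have *: "h u \<le> h v + (\<integral>x. norm (x - mean P) \<partial>P) * dist u v" for u v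
    proof -
      have "h u \<le> (\<integral>x. \<bar>v \<bullet> (x - mean P)\<bar> + norm (u - v) * norm (x - mean P) \<partial>P)"
        unfolding h_def
      proof (rule integral_mono)
        fix x
        have "\<bar>(u - v) \<bullet> (x - mean P)\<bar> \<le> norm (u - v) * norm (x - mean P)"
          by (rule Cauchy_Schwarz_ineq2)
        then show "\<bar>u \<bullet> (x - mean P)\<bar> \<le> \<bar>v \<bullet> (x - mean P)\<bar> + norm (u - v) * norm (x - mean P)"
          by (simp add: inner_diff_left)
      qed (use int int' in auto)
      also have "\<dots> = h v + norm (u - v) * (\<integral>x. norm (x - mean P) \<partial>P)"
        unfolding h_def using int int' by simp
      finally show ?thesis by (simp add: dist_norm mult.commute)
    qed
    fix u v show "dist (h u) (h v) \<le> (\<integral>x. norm (x - mean P) \<partial>P) * dist u v"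
      using *[of u v] *[of v u] by (simp add: dist_commute dist_real_def abs_le_iff)
  qed (auto intro: integral_nonneg_AE)
  then have "continuous_on (sphere 0 1) h"
    using lipschitz_on_continuous_on continuous_on_subset by blast
  moreover have "sphere (0::'a) 1 \<noteq> {}" by simp
  ultimately obtain u where u: "u \<in> sphere 0 1" "\<And>v. v \<in> sphere 0 1 \<Longrightarrow> h u \<le> h v"
    using continuous_attains_inf[of "sphere 0 1" h] by auto
  have "0 < h u"
  proof (rule ccontr)
    assume "\<not> 0 < h u"
    moreover have "0 \<le> h u" unfolding h_def by (auto intro: integral_nonneg_AE)
    ultimately have "h u = 0" by simp
    then have "AE x in P. \<bar>u \<bullet> (x - mean P)\<bar> = 0"
      unfolding h_def using int by (subst (asm) integral_nonneg_eq_0_iff_AE) auto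
    then have "AE x in P. x \<in> {x. u \<bullet> x = u \<bullet> mean P}"
      by eventually_elim (simp add: inner_diff_right)
    moreover have "{x. u \<bullet> x = u \<bullet> mean P} \<in> events"
      unfolding sets_eq by (intro borel_closed closed_hyperplane)
    ultimately have "prob {x. u \<bullet> x = u \<bullet> mean P} = 1" by (subst prob_eq_1) auto
    then show False using hyperplane[of u "u \<bullet> mean P"] u by fastforce
  qed
  also have "h u \<le> min_abs_deviation P"
    unfolding min_abs_deviation_def h_def[symmetric] by (rule cINF_greatest) (use u in auto)
  finally show ?thesis .
qed

end

lemma log_concave_density_of_mem:
  assumes "f \<in> log_concave_densities" shows "log_concave_density f"
proof -
  have f: "f \<in> borel_measurable borel" "\<And>x. 0 \<le> f x" "(\<integral>\<^sup>+x. ennreal (f x) \<partial>lborel) = 1" "log_concave f"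
    using assms by (auto simp: log_concave_densities_def prob_density_def)
  have "integrable lborel f" using f by (intro integrableI_nonneg) auto
  moreover have "(\<integral>x. f x \<partial>lborel) = 1" using f by (subst integral_eq_nn_integral) auto
  ultimately show ?thesis using f by (simp add: log_concave_density_def)
qed

section \<open>Competitors in the maximisation and bounds for near-optimal densities\<close>

context nondegenerate_distribution begin

lemma log_integrable_mono:
  assumes h: "log_integrable P h" and g: "g \<in> borel_measurable borel"
    and hg: "\<And>x. h x \<le> g x" and gB: "\<And>x. g x \<le> B"
  shows "log_integrable P g" and "(\<integral>x. ln (h x) \<partial>P) \<le> (\<integral>x. ln (g x) \<partial>P)"
proof -
  have pos: "AE x in P. 0 < h x" and int: "integrable P (\<lambda>x. ln (h x))"
    using h by (auto simp: log_integrable_def)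
  have [measurable]: "g \<in> borel_measurable P" using g by (rule measurable_P)
  have le: "AE x in P. ln (h x) \<le> ln (g x)"
    using pos by eventually_elim (use hg in \<open>auto intro: ln_mono less_le_trans\<close>)
  have pos': "AE x in P. 0 < g x"
    using pos by eventually_elim (use hg in \<open>auto intro: less_le_trans\<close>)
  have "integrable P (\<lambda>x. ln (g x))"
  proof (rule Bochner_Integration.integrable_bound)
    show "integrable P (\<lambda>x. \<bar>ln (h x)\<bar> + \<bar>ln B\<bar>)" using int by auto
    show "AE x in P. norm (ln (g x)) \<le> norm (\<bar>ln (h x)\<bar> + \<bar>ln B\<bar>)"
      using le pos'
    proof eventually_elim
      case (elim x)
      have "ln (g x) \<le> ln B" using elim gB[of x] by (intro ln_mono) auto
      with elim show ?case by auto
    qed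
  qed measurable
  then show "log_integrable P g" using pos' by (simp add: log_integrable_def)
  then show "(\<integral>x. ln (h x) \<partial>P) \<le> (\<integral>x. ln (g x) \<partial>P)"
    using int le by (intro integral_mono_AE) (auto simp: log_integrable_def)
qed

text \<open>If the integral were 0, the convex set where \<open>h\<close> is positive would be null,
  hence contained in a hyperplane, yet it carries all of \<open>P\<close>. This legitimises
  normalising \<open>h\<close> and taking the logarithm of its mass.\<close>

lemma integral_pos_of_log_concave:
  assumes h: "log_concave h" "integrable lborel h" and pos: "AE x in P. 0 < h x"
  shows "0 < (\<integral>x. h x \<partial>lborel)"
proof (rule ccontr)
  assume "\<not> ?thesis"
  moreover have "0 \<le> (\<integral>x. h x \<partial>lborel)" using h by (auto intro!: integral_nonneg_AE simp: log_concave_nonneg)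
  ultimately have "(\<integral>x. h x \<partial>lborel) = 0" by simp
  then have "AE x in lborel. h x = 0"
    using h by (subst (asm) integral_nonneg_eq_0_iff_AE) (auto simp: log_concave_nonneg)
  then have "AE x in lborel. x \<notin> {x. 0 < h x}" by eventually_elim simp
  moreover have [measurable]: "h \<in> borel_measurable borel" using h by auto
  ultimately have "{x. 0 < h x} \<in> null_sets lborel" by (subst AE_iff_null_sets) auto
  then have "negligible {x. 0 < h x}"
    unfolding negligible_iff_null_sets by (rule null_sets_completionI)
  moreover have conv: "convex {x. 0 < h x}" using h(1) by (rule convex_superlevel) simp
  ultimately have "interior {x. 0 < h x} = {}" by (simp add: negligible_convex_interior)
  then obtain u c where u: "u \<noteq> 0" "{x. 0 < h x} \<subseteq> {x. u \<bullet> x = c}"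
    using empty_interior_subset_hyperplane[OF conv] by blast
  have "AE x in P. x \<in> {x. u \<bullet> x = c}" using pos by eventually_elim (use u in auto)
  moreover have "{x. u \<bullet> x = c} \<in> events" unfolding sets_eq by (intro borel_closed closed_hyperplane)
  ultimately have "prob {x. u \<bullet> x = c} = 1" by (subst prob_eq_1) auto
  then show False using hyperplane[OF u(1), of c] by simp
qed

text \<open>The upper semicontinuous hull raises the expected logarithm and keeps the Lebesgue
  integral; dividing by the mass then subtracts its logarithm. Hence a competitor need be neither
  semicontinuous nor normalised.\<close>

lemma ex_density_ge:
  assumes h: "log_concave h" "integrable lborel h" and hP: "log_integrable P h"
  obtains g where "g \<in> log_concave_densities" "log_integrable P g"
    "(\<integral>x. ln (h x) \<partial>P) - ln (\<integral>x. h x \<partial>lborel) \<le> (\<integral>x. ln (g x) \<partial>P)"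
proof -
  define I where "I = (\<integral>x. h x \<partial>lborel)"
  have I: "0 < I" unfolding I_def
    by (rule integral_pos_of_log_concave[OF h]) (use hP in \<open>auto simp: log_integrable_def\<close>)
  obtain B where B: "\<And>x. h x \<le> B"
    using log_concave_bounded[OF h] I by (auto simp: I_def)
  have h0: "\<And>x. 0 \<le> h x" using h by (simp add: log_concave_nonneg)
  define k where "k = usc_hull h"
  have k: "log_concave k" "upper_semicontinuous k" "\<And>x. h x \<le> k x" "\<And>x. k x \<le> B" "AE x in lborel. k x = h x"
    unfolding k_def
    by (rule log_concave_usc_hull[of h B] upper_semicontinuous_usc_hull[of h B] usc_hull_ge[of h B]
        usc_hull_bound[of h B] usc_hull_eq_AE[of h B]; use h0 B h in auto)+
  have k_meas [measurable]: "k \<in> borel_measurable borel" using k(2) by (rule upper_semicontinuous_measurable)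
  have kP: "log_integrable P k" "(\<integral>x. ln (h x) \<partial>P) \<le> (\<integral>x. ln (k x) \<partial>P)"
    using log_integrable_mono[OF hP k_meas k(3,4)] by auto
  define g where "g x = (1 / I) * k x" for x
  have "log_concave g" unfolding g_def using I k by (intro log_concave_cmult) auto
  moreover have "upper_semicontinuous g"
    unfolding upper_semicontinuous_def
  proof (intro allI impI)
    fix x a assume "g x < a"
    then have "k x < I * a" using I by (simp add: g_def field_simps)
    then have "\<forall>\<^sub>F z in nhds x. k z < I * a" using k(2) by (auto simp: upper_semicontinuous_def)
    then show "\<forall>\<^sub>F z in nhds x. g z < a"
      by eventually_elim (use I in \<open>simp add: g_def field_simps\<close>)
  qed
  moreover have "prob_density g"
    unfolding prob_density_def
  proof (intro conjI allI)
    show "g \<in> borel_measurable borel" unfolding g_def by measurable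
    show "0 \<le> g x" for x using \<open>log_concave g\<close> by (rule log_concave_nonneg)
    have "(\<integral>\<^sup>+x. ennreal (g x) \<partial>lborel) = (\<integral>\<^sup>+x. ennreal ((1 / I) * h x) \<partial>lborel)"
      by (rule nn_integral_cong_AE) (use k(5) in eventually_elim, simp add: g_def)
    also have "\<dots> = ennreal (\<integral>x. (1 / I) * h x \<partial>lborel)"
      using h(2) h0 I by (intro nn_integral_eq_integral) auto
    also have "\<dots> = 1" using I by (simp add: I_def[symmetric])
    finally show "(\<integral>\<^sup>+x. ennreal (g x) \<partial>lborel) = 1" .
  qed
  ultimately have "g \<in> log_concave_densities" by (simp add: log_concave_densities_def)
  moreover have pos: "AE x in P. 0 < k x" using kP by (simp add: log_integrable_def)
  have eq: "AE x in P. ln (g x) = ln (k x) - ln I"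
    using pos by eventually_elim (use I in \<open>simp add: g_def ln_div\<close>)
  have g_meas: "g \<in> borel_measurable borel" unfolding g_def by measurable
  have intk: "integrable P (\<lambda>x. ln (k x) - ln I)" using kP by (auto simp: log_integrable_def)
  have "integrable P (\<lambda>x. ln (g x))"
    using eq intk measurable_P[OF g_meas] by (subst integrable_cong_AE[OF _ _ eq]) auto
  then have "log_integrable P g"
    using pos I by (auto simp: log_integrable_def g_def elim: eventually_mono)
  moreover have "(\<integral>x. ln (g x) \<partial>P) = (\<integral>x. ln (k x) - ln I \<partial>P)"
    using eq intk measurable_P[OF g_meas] by (intro integral_cong_AE) auto
  then have "(\<integral>x. ln (g x) \<partial>P) = (\<integral>x. ln (k x) \<partial>P) - ln I"
    using kP prob_space by (simp add: log_integrable_def)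
  ultimately show ?thesis using that kP(2) by (auto simp: I_def)
qed

lemma integral_ln_le_ln_peak:
  assumes f: "log_concave_density f" and fP: "log_integrable P f"
  shows "(\<integral>x. ln (f x) \<partial>P) \<le> ln (log_concave_density.peak f)"
proof -
  interpret log_concave_density f by (fact f)
  have "(\<integral>x. ln (f x) \<partial>P) \<le> (\<integral>x. ln peak \<partial>P)"
    using fP by (intro integral_mono_AE) (auto simp: log_integrable_def le_peak ln_mono elim: eventually_mono)
  then show ?thesis using prob_space by simp
qed

text \<open>If the core fits into a slab of width \<open>w\<close>, integrating the decay outside
  the slab makes the expected logarithm fall below \<open>ln peak + 1\<close> by the deviation over
  \<open>4 * w\<close>. So a good expected logarithm forbids thin cores. The 8 is this 4 times the 2
  lost in recentring.\<close>

lemma core_inball_of_integral_ln: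
  assumes f: "log_concave_density f" and fP: "log_integrable P f"
    and K: "ln (log_concave_density.peak f) + 1 - (\<integral>x. ln (f x) \<partial>P) \<le> K"
  obtains c where "ball c (min_abs_deviation P / (8 * K * (real DIM('a) + 1))) \<subseteq> log_concave_density.core f"
proof -
  interpret log_concave_density f by (fact f)
  have K1: "1 \<le> K" using integral_ln_le_ln_peak[OF f fP] K by simp
  define w0 where "w0 = min_abs_deviation P / (8 * K)"
  have w0: "0 < w0" using min_abs_deviation_pos K1 by (simp add: w0_def)
  have width: "w0 \<le> w"
    if u: "norm u = 1" and w: "0 < w" and slab: "core \<subseteq> {x. a \<le> u \<bullet> x \<and> u \<bullet> x \<le> a + w}" for u a w
  proof -
    have int: "integrable P (\<lambda>x. \<bar>u \<bullet> x - a\<bar>)"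
      using integrable_id by (auto intro!: integrable_abs Bochner_Integration.integrable_diff integrable_inner_right)
    have pos: "AE x in P. 0 < f x" using fP by (simp add: log_integrable_def)
    have "(\<integral>x. ln (f x) \<partial>P) \<le> (\<integral>x. ln peak + 1 - \<bar>u \<bullet> x - a\<bar> / (4 * w) \<partial>P)"
    proof (rule integral_mono_AE)
      show "AE x in P. ln (f x) \<le> ln peak + 1 - \<bar>u \<bullet> x - a\<bar> / (4 * w)"
        using pos
      proof eventually_elim
        fix x assume "0 < f x"
        then have "ln (f x) \<le> ln (peak * exp (1 - \<bar>u \<bullet> x - a\<bar> / (4 * w)))"
          by (intro ln_mono decay_outside_slab[OF w slab])
        then show "ln (f x) \<le> ln peak + 1 - \<bar>u \<bullet> x - a\<bar> / (4 * w)"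
          using peak_pos by (simp add: ln_mult_pos)
      qed
    qed (use fP int in \<open>auto simp: log_integrable_def\<close>)
    also have "\<dots> = ln peak + 1 - (\<integral>x. \<bar>u \<bullet> x - a\<bar> \<partial>P) / (4 * w)"
      using int prob_space by simp
    finally have "(\<integral>x. \<bar>u \<bullet> x - a\<bar> \<partial>P) / (4 * w) \<le> K" using K by simp
    then have "(\<integral>x. \<bar>u \<bullet> x - a\<bar> \<partial>P) \<le> 4 * w * K" using w by (simp add: field_simps)
    then have "min_abs_deviation P \<le> 8 * K * w"
    proof -
      have "8 * K * w = 2 * (4 * w * K)" by simp
      with min_abs_deviation_le_double[OF u, of a] \<open>_ \<le> 4 * w * K\<close> show ?thesis by linarith
    qed
    then show "w0 \<le> w" using K1 by (simp add: w0_def field_simps)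
  qed
  obtain c where "ball c (w0 / (real DIM('a) + 1)) \<subseteq> core"
    by (rule core_inball[OF w0 width])
  then show ?thesis using that by (simp add: w0_def)
qed

text \<open>A high peak means a core of small volume, at most \<open>exp 1 / peak\<close>, whereas
  the inscribed ball has radius \<open>s / K\<close> with \<open>K\<close> growing only like
  \<open>ln peak\<close>. Taking logarithms pits \<open>ln peak\<close> against a multiple of its
  own logarithm.\<close>

lemma ln_peak_bounded:
  obtains M where "\<And>f. log_concave_density f \<Longrightarrow> log_integrable P f \<Longrightarrow> l0 \<le> (\<integral>x. ln (f x) \<partial>P) \<Longrightarrow>
    ln (log_concave_density.peak f) \<le> M"
proof -
  define d where "d = real DIM('a)"
  have d: "1 \<le> d" using DIM_positive[where 'a='a] by (simp add: d_def)
  define v where "v = measure lborel (ball (0::'a) 1)"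
  have v: "0 < v" by (simp add: v_def content_ball_pos)
  define s where "s = min_abs_deviation P / (8 * (d + 1))"
  have s: "0 < s" using min_abs_deviation_pos d by (simp add: s_def)
  define A where "A = 1 - ln v - d * ln s + d * ln (2 * d)"
  have "ln (log_concave_density.peak f) \<le> 2 * A + 1 - l0"
    if f: "log_concave_density f" and fP: "log_integrable P f" and l0: "l0 \<le> (\<integral>x. ln (f x) \<partial>P)" for f
  proof -
    interpret log_concave_density f by (fact f)
    define K where "K = ln peak + 1 - l0"
    have K: "1 \<le> K" using integral_ln_le_ln_peak[OF f fP] l0 by (simp add: K_def)
    obtain c where "ball c (min_abs_deviation P / (8 * K * (real DIM('a) + 1))) \<subseteq> core"
      by (rule core_inball_of_integral_ln[OF f fP, of K]) (use l0 K_def in auto)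
    moreover have "s / K = min_abs_deviation P / (8 * K * (real DIM('a) + 1))"
      by (simp add: s_def d_def mult_ac)
    ultimately have c: "ball c (s / K) \<subseteq> core" by (simp only:)
    have "emeasure lborel (ball c (s / K)) \<le> ennreal (exp 1 / peak)"
      using emeasure_mono[OF c, of lborel] emeasure_core_le by (auto intro: order_trans)
    then have "measure lborel (ball c (s / K)) \<le> exp 1 / peak"
      using peak_pos by (simp add: measure_def enn2real_leI)
    moreover have "measure lborel (ball c (s / K)) = (s / K) ^ DIM('a) * v"
      using content_ball_conv_unit_ball[of "s / K" c] s K by (simp add: v_def)
    ultimately have "ln ((s / K) ^ DIM('a) * v) \<le> ln (exp 1 / peak)"
      using s K v by (intro ln_mono) auto
    then have "d * (ln s - ln K) + ln v \<le> 1 - ln peak"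
      using s K v peak_pos by (simp add: ln_mult_pos ln_realpow ln_div d_def)
    \<comment> \<open>The tangent to \<open>ln\<close> is taken at \<open>2 * d\<close>, so that
      \<open>ln peak\<close> reappears with coefficient 1/2 and can be absorbed on the left.\<close>
    moreover have "d * ln K \<le> K / 2 + d * ln (2 * d)"
    proof -
      have "ln (K / (2 * d)) \<le> K / (2 * d) - 1" using K d by (intro ln_le_minus_one) auto
      then have "ln K \<le> K / (2 * d) + ln (2 * d)" using K d by (simp add: ln_div)
      then have "d * ln K \<le> d * (K / (2 * d) + ln (2 * d))" using d by (intro mult_left_mono) auto
      then show ?thesis using d by (simp add: distrib_left)
    qed
    ultimately have "ln peak \<le> A + K / 2" by (simp add: A_def algebra_simps)
    then show ?thesis by (simp add: K_def field_simps)
  qed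
  then show ?thesis using that by blast
qed

text \<open>The logarithm of the envelope of the uniform density on a ball is 1-Lipschitz, hence
  integrable by the finite first moment. Here the unit ball itself lies in the core, which gives the
  envelope finite mass.\<close>

lemma ex_log_integrable_density:
  obtains g where "g \<in> log_concave_densities" "log_integrable P g"
proof -
  define v where "v = measure lborel (ball (0::'a) 1)"
  have v: "0 < v" by (simp add: v_def content_ball_pos)
  define f where "f x = (1 / v) * indicator (ball (0::'a) 1) x" for x
  have lc: "log_concave f"
    unfolding f_def using v by (intro log_concave_cmult log_concave_indicator convex_ball) auto
  have "integrable lborel f" unfolding f_def
    using emeasure_lborel_ball_finite[of "0::'a" 1] by (intro integrable_mult_right integrable_real_indicator) auto
  moreover have "(\<integral>x. f x \<partial>lborel) = 1" unfolding f_def using v by (simp add: v_def)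
  ultimately interpret log_concave_density f using lc by unfold_locales
  have "peak \<le> 1 / v" unfolding peak_def using v by (intro cSUP_least) (auto simp: f_def indicator_def)
  moreover have "1 / v * exp (- 1) < 1 / v * 1" using v by (intro mult_strict_left_mono) auto
  ultimately have "peak * exp (- 1) < 1 / v"
    using mult_right_mono[of peak "1 / v" "exp (- 1)"] by simp
  then have ball: "ball 0 1 \<subseteq> core" by (auto simp: core_def f_def)
  define E where "E = log_lipschitz_envelope 1 f"
  have f0: "0 < f 0" using v by (simp add: f_def)
  have "integrable lborel E" unfolding E_def by (rule envelope_integral[OF ball]) auto
  moreover have "log_concave E"
    unfolding E_def by (rule log_concave_envelope[of f peak 1, OF nonneg le_peak _ lc]) auto
  moreover have "log_integrable P E"
    using envelope_pos[of f peak 1 0, OF nonneg le_peak _ f0]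
      integrable_lipschitz[OF ln_envelope_lipschitz[of f peak 1 0, OF nonneg le_peak _ f0]]
    by (simp add: log_integrable_def E_def)
  ultimately show ?thesis using that ex_density_ge by metis
qed

end

section \<open>Existence of the projection\<close>

text \<open>The limit inferior kept inside the reals, which is meaningful for bounded sequences.
  Tail infima inherit log-concavity, and they increase to the limit.\<close>

definition real_liminf :: "(nat \<Rightarrow> real) \<Rightarrow> real" where
  "real_liminf X = (SUP N. INF n. X (N + n))"

context
  fixes X :: "nat \<Rightarrow> real" and B :: real
  assumes X0: "\<And>n. 0 \<le> X n" and XB: "\<And>n. X n \<le> B"
begin

lemma INF_tail_le: "N \<le> n \<Longrightarrow> (INF n. X (N + n)) \<le> X n"
proof -
  assume "N \<le> n"
  moreover have "bdd_below (range (\<lambda>k. X (N + k)))" by (rule bdd_belowI2[of _ 0]) (rule X0)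
  ultimately show ?thesis using cINF_lower[of "\<lambda>k. X (N + k)" UNIV "n - N"] by simp
qed

lemma INF_tail_greatest: "(\<And>n. N \<le> n \<Longrightarrow> a \<le> X n) \<Longrightarrow> a \<le> (INF n. X (N + n))"
  by (rule cINF_greatest) auto

lemma INF_tail_nonneg: "0 \<le> (INF n. X (N + n))"
  using X0 by (intro INF_tail_greatest)

lemma INF_tail_le_bound: "(INF n. X (N + n)) \<le> B"
  using INF_tail_le[of N N] XB[of N] by simp

lemma INF_tail_le_liminf: "(INF n. X (N + n)) \<le> real_liminf X"
  unfolding real_liminf_def
  by (rule cSUP_upper) (auto intro!: bdd_aboveI2[of _ _ B] INF_tail_le_bound)

lemma real_liminf_least: "(\<And>N. (INF n. X (N + n)) \<le> a) \<Longrightarrow> real_liminf X \<le> a"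
  unfolding real_liminf_def by (rule cSUP_least) auto

lemma real_liminf_nonneg: "0 \<le> real_liminf X"
  using INF_tail_nonneg INF_tail_le_liminf order_trans by blast

lemma real_liminf_le_bound: "real_liminf X \<le> B"
  by (rule real_liminf_least) (rule INF_tail_le_bound)

lemma INF_tail_LIMSEQ: "(\<lambda>N. INF n. X (N + n)) \<longlonglongrightarrow> real_liminf X"
  unfolding real_liminf_def
proof (rule LIMSEQ_incseq_SUP)
  show "bdd_above (range (\<lambda>N. INF n. X (N + n)))"
    by (auto intro!: bdd_aboveI2[of _ _ B] INF_tail_le_bound)
  show "incseq (\<lambda>N. INF n. X (N + n))"
    by (intro incseq_SucI INF_tail_greatest INF_tail_le) auto
qed

lemma less_real_liminfD:
  assumes "a < real_liminf X" obtains N where "\<And>n. N \<le> n \<Longrightarrow> a < X n"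
proof -
  have "\<exists>N. a < (INF n. X (N + n))"
    using real_liminf_least[of a] assms by (meson not_le)
  then show ?thesis using that INF_tail_le less_le_trans by blast
qed

lemma real_liminf_eq_lim:
  assumes "X \<longlonglongrightarrow> l" shows "real_liminf X = l"
proof (rule antisym)
  show "real_liminf X \<le> l"
    using INF_tail_le by (intro real_liminf_least LIMSEQ_le_const[OF assms]) blast
  show "l \<le> real_liminf X"
  proof (rule field_le_epsilon)
    fix e :: real assume "0 < e"
    then have "\<forall>\<^sub>F n in sequentially. l - e < X n" using order_tendstoD(1)[OF assms, of "l - e"] by simp
    then obtain N where "\<And>n. N \<le> n \<Longrightarrow> l - e < X n" by (auto simp: eventually_sequentially)
    then have "l - e \<le> (INF n. X (N + n))" by (intro INF_tail_greatest less_imp_le)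
    then show "l \<le> real_liminf X + e" using INF_tail_le_liminf[of N] by simp
  qed
qed

end

lemma log_concave_real_liminf:
  assumes g: "\<And>n. log_concave (g n)" and B: "\<And>n x. g n x \<le> B"
  shows "log_concave (\<lambda>x. real_liminf (\<lambda>n. g n x))"
proof (rule log_concaveI)
  have g0: "\<And>n x. 0 \<le> g n x" using g by (simp add: log_concave_nonneg)
  fix x y t assume t: "0 < t" "t < (1::real)"
  let ?lo = "\<lambda>N x. INF n. g (N + n) x"
  have "(\<lambda>N. ?lo N x powr (1 - t) * ?lo N y powr t) \<longlonglongrightarrow>
      real_liminf (\<lambda>n. g n x) powr (1 - t) * real_liminf (\<lambda>n. g n y) powr t"
    using t INF_tail_LIMSEQ[of "\<lambda>n. g n x" B, OF g0 B] INF_tail_LIMSEQ[of "\<lambda>n. g n y" B, OF g0 B]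
      INF_tail_nonneg[of "\<lambda>n. g n x" B, OF g0 B] INF_tail_nonneg[of "\<lambda>n. g n y" B, OF g0 B]
    by (intro tendsto_intros tendsto_powr') auto
  moreover have "?lo N x powr (1 - t) * ?lo N y powr t \<le> real_liminf (\<lambda>n. g n ((1 - t) *\<^sub>R x + t *\<^sub>R y))" for N
  proof -
    have "?lo N x powr (1 - t) * ?lo N y powr t \<le> ?lo N ((1 - t) *\<^sub>R x + t *\<^sub>R y)"
    proof (rule INF_tail_greatest[of "\<lambda>n. g n ((1 - t) *\<^sub>R x + t *\<^sub>R y)" B, OF g0 B])
      fix n assume "N \<le> n"
      then show "?lo N x powr (1 - t) * ?lo N y powr t \<le> g n ((1 - t) *\<^sub>R x + t *\<^sub>R y)"
        using INF_tail_le[of "\<lambda>n. g n x" B, OF g0 B] INF_tail_le[of "\<lambda>n. g n y" B, OF g0 B]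
          INF_tail_nonneg[of "\<lambda>n. g n x" B, OF g0 B] INF_tail_nonneg[of "\<lambda>n. g n y" B, OF g0 B]
        by (intro log_concave_mix_le[OF g t]) auto
    qed
    also have "\<dots> \<le> real_liminf (\<lambda>n. g n ((1 - t) *\<^sub>R x + t *\<^sub>R y))"
      by (rule INF_tail_le_liminf[of "\<lambda>n. g n ((1 - t) *\<^sub>R x + t *\<^sub>R y)" B, OF g0 B])
    finally show ?thesis .
  qed
  ultimately show "real_liminf (\<lambda>n. g n x) powr (1 - t) * real_liminf (\<lambda>n. g n y) powr t
      \<le> real_liminf (\<lambda>n. g n ((1 - t) *\<^sub>R x + t *\<^sub>R y))"
    by (intro LIMSEQ_le_const2) auto
qed (use g B in \<open>auto intro!: real_liminf_nonneg[of _ B] simp: log_concave_nonneg\<close>)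

lemma measurable_real_liminf:
  assumes [measurable]: "\<And>n. g n \<in> borel_measurable M"
    and g0: "\<And>n x. 0 \<le> g n x" and B: "\<And>n x. g n x \<le> B"
  shows "(\<lambda>x. real_liminf (\<lambda>n. g n x)) \<in> borel_measurable M"
proof (rule borel_measurable_LIMSEQ_real)
  fix x
  show "(\<lambda>N. INF n. g (N + n) x) \<longlonglongrightarrow> real_liminf (\<lambda>n. g n x)"
    by (rule INF_tail_LIMSEQ[of "\<lambda>n. g n x" B, OF g0 B])
next
  show "(\<lambda>x. INF n. g (N + n) x) \<in> borel_measurable M" for N
    by (rule borel_measurable_cINF_real) auto
qed

text \<open>Almost everywhere convergence of log-concave functions controls the limit superior at every
  point: a large value at \<open>x\<close> forces large values on a cone with apex \<open>x\<close> over a ball.\<close>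

lemma eventually_le_usc_hull_liminf:
  fixes g :: "nat \<Rightarrow> 'a::euclidean_space \<Rightarrow> real"
  assumes g: "\<And>n. log_concave (g n)" and B: "\<And>n x. g n x \<le> B"
    and conv: "AE x in lborel. convergent (\<lambda>n. g n x)"
    and ball: "0 < b" "0 < \<rho>" "ball z \<rho> \<subseteq> {x. b < real_liminf (\<lambda>n. g n x)}"
    and c: "usc_hull (\<lambda>x. real_liminf (\<lambda>n. g n x)) x < c"
  shows "\<forall>\<^sub>F n in sequentially. g n x \<le> c"
proof (rule ccontr)
  assume "\<not> ?thesis"
  then have freq: "\<exists>\<^sub>F n in sequentially. c < g n x" by (simp add: frequently_def not_less)
  define f where "f = (\<lambda>x. real_liminf (\<lambda>n. g n x))"
  have g0: "\<And>n x. 0 \<le> g n x" using g by (simp add: log_concave_nonneg)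
  have f0: "\<And>x. 0 \<le> f x" and fB: "\<And>x. f x \<le> B"
    unfolding f_def using real_liminf_nonneg[OF g0 B] real_liminf_le_bound[OF g0 B] by auto
  obtain r c' where r: "0 < r" "c' < c" "\<And>y. y \<in> ball x r \<Longrightarrow> f y \<le> c'"
    using usc_hull_lessD[of f B x c] f0 fB c unfolding f_def[symmetric] by blast
  have "0 < c" using usc_hull_nonneg[of f B x] f0 fB c unfolding f_def[symmetric] by auto
  \<comment> \<open>Towards the apex the lower bound on the cone tends to \<open>c\<close>, which
    exceeds \<open>c'\<close>, while the cross-section shrinks to \<open>x\<close>. So some
    \<open>k < 1\<close> puts a whole cross-section into \<open>ball x r\<close> with a lower bound
    still above \<open>c'\<close>.\<close>
  have "((\<lambda>k::real. b powr (1 - k) * c powr k) \<longlongrightarrow> b powr (1 - 1) * c powr 1) (at_left 1)"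
    using ball \<open>0 < c\<close> by (intro tendsto_intros) auto
  then have "\<forall>\<^sub>F k in at_left 1. c' < b powr (1 - k) * c powr k"
    using r ball \<open>0 < c\<close> by (intro order_tendstoD) auto
  moreover have "((\<lambda>k::real. (1 - k) * (\<rho> + norm (z - x))) \<longlongrightarrow> (1 - 1) * (\<rho> + norm (z - x))) (at_left 1)"
    by (intro tendsto_intros)
  then have "\<forall>\<^sub>F k in at_left 1. (1 - k) * (\<rho> + norm (z - x)) < r"
    using r by (intro order_tendstoD) auto
  moreover have "\<forall>\<^sub>F k in at_left (1::real). 0 < k \<and> k < 1"
    using eventually_at_left_real[of 0 1] by simp
  ultimately have "\<forall>\<^sub>F k in at_left 1. c' < b powr (1 - k) * c powr k \<and>
      (1 - k) * (\<rho> + norm (z - x)) < r \<and> 0 < k \<and> k < 1"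
    by eventually_elim simp
  then obtain k where k: "c' < b powr (1 - k) * c powr k" "(1 - k) * (\<rho> + norm (z - x)) < r" "0 < k" "k < 1"
    using eventually_happens[of _ "at_left (1::real)"] by auto
  define U where "U = ball ((1 - k) *\<^sub>R z + k *\<^sub>R x) ((1 - k) * \<rho>)"
  \<comment> \<open>Only a ball, not the single point \<open>x\<close>, is guaranteed to meet the
    set of convergence.\<close>
  have "\<exists>y\<in>U. convergent (\<lambda>n. g n y)"
  proof (rule ccontr)
    assume "\<not> ?thesis"
    then have "AE y in lborel. y \<notin> U" using conv by (auto elim: eventually_mono)
    then have "U \<in> null_sets lborel" by (subst AE_iff_null_sets) (auto simp: U_def)
    then have "measure lborel U = 0" by (simp add: measure_def null_setsD1)
    moreover have "0 < (1 - k) * \<rho>" using k ball by simp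
    ultimately show False
      using content_ball_pos[of "(1 - k) * \<rho>" "(1 - k) *\<^sub>R z + k *\<^sub>R x"] unfolding U_def by simp
  qed
  then obtain y where y: "y \<in> U" "convergent (\<lambda>n. g n y)" by blast
  \<comment> \<open>The point in the base of the cone such that \<open>y\<close> divides the segment
    from \<open>w\<close> to the apex \<open>x\<close>.\<close>
  define w where "w = z + (1 / (1 - k)) *\<^sub>R (y - ((1 - k) *\<^sub>R z + k *\<^sub>R x))"
  have yw: "y = (1 - k) *\<^sub>R w + k *\<^sub>R x" using k by (simp add: w_def scaleR_add_right)
  have "norm (w - z) = norm (y - ((1 - k) *\<^sub>R z + k *\<^sub>R x)) / (1 - k)" using k by (simp add: w_def)
  also have "\<dots> < (1 - k) * \<rho> / (1 - k)"
    using y k by (intro divide_strict_right_mono) (auto simp: U_def dist_norm norm_minus_commute)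
  finally have wz: "norm (w - z) < \<rho>" using k by simp
  then have "w \<in> ball z \<rho>" by (simp add: dist_norm norm_minus_commute)
  then have "b < real_liminf (\<lambda>n. g n w)" using ball(3) by blast
  then obtain N where N: "\<And>n. N \<le> n \<Longrightarrow> b < g n w"
    using less_real_liminfD[of "\<lambda>n. g n w" B b] g0 B by blast
  have "norm (x - y) = (1 - k) * norm (w - x)"
  proof -
    have "x - y = (1 - k) *\<^sub>R (x - w)" by (simp add: yw algebra_simps)
    then show ?thesis using k by (simp add: norm_minus_commute)
  qed
  also have "\<dots> \<le> (1 - k) * (\<rho> + norm (z - x))"
    using k wz norm_triangle_ineq[of "w - z" "z - x"] by (intro mult_left_mono) auto
  finally have "y \<in> ball x r" using k by (simp add: dist_norm)
  then have "f y \<le> c'" by (rule r(3))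
  have "(\<lambda>n. g n y) \<longlonglongrightarrow> f y"
    using y(2) real_liminf_eq_lim[of "\<lambda>n. g n y" B, OF g0 B] unfolding convergent_def f_def by auto
  then have "\<forall>\<^sub>F n in sequentially. g n y < b powr (1 - k) * c powr k"
    by (rule order_tendstoD(2)) (use k(1) \<open>f y \<le> c'\<close> in simp)
  then have "\<forall>\<^sub>F n in sequentially. g n y < b powr (1 - k) * c powr k \<and> N \<le> n"
    using eventually_ge_at_top[of N] by (rule eventually_conj)
  with freq have "\<exists>\<^sub>F n in sequentially. c < g n x \<and> g n y < b powr (1 - k) * c powr k \<and> N \<le> n"
    by (rule frequently_eventually_frequently)
  then obtain n where n: "c < g n x" "g n y < b powr (1 - k) * c powr k" "N \<le> n"
    by (auto dest: frequently_ex)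
  have "b powr (1 - k) * c powr k \<le> g n ((1 - k) *\<^sub>R w + k *\<^sub>R x)"
    using N[OF n(3)] n(1) ball \<open>0 < c\<close> k by (intro log_concave_mix_le[OF g]) auto
  then show False using n(2) yw by simp
qed

section \<open>Hellinger affinity and closeness of near-maximisers\<close>

lemma integral_sqrt_diff_sq:
  fixes f g :: "'a \<Rightarrow> real"
  assumes f: "integrable M f" "\<And>x. 0 \<le> f x" and g: "integrable M g" "\<And>x. 0 \<le> g x"
  shows "integrable M (\<lambda>x. sqrt (f x * g x))" and "integrable M (\<lambda>x. (sqrt (f x) - sqrt (g x))\<^sup>2)"
    and "(\<integral>x. (sqrt (f x) - sqrt (g x))\<^sup>2 \<partial>M) =
      (\<integral>x. f x \<partial>M) + (\<integral>x. g x \<partial>M) - 2 * (\<integral>x. sqrt (f x * g x) \<partial>M)"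
proof -
  show int: "integrable M (\<lambda>x. sqrt (f x * g x))"
  proof (rule Bochner_Integration.integrable_bound)
    show "integrable M (\<lambda>x. f x + g x)" using f g by simp
    have "sqrt (f x * g x) \<le> f x + g x" for x
    proof -
      have "sqrt (f x * g x) \<le> (f x + g x) / 2" by (rule arith_geo_mean_sqrt) (use f g in auto)
      also have "\<dots> \<le> f x + g x" using f(2)[of x] g(2)[of x] by simp
      finally show ?thesis .
    qed
    then show "AE x in M. norm (sqrt (f x * g x)) \<le> norm (f x + g x)" using f g by simp
    show "(\<lambda>x. sqrt (f x * g x)) \<in> borel_measurable M" using f(1) g(1) by measurable
  qed
  have eq: "(sqrt (f x) - sqrt (g x))\<^sup>2 = f x + g x - 2 * sqrt (f x * g x)" for x
    using f(2)[of x] g(2)[of x] by (simp add: power2_diff real_sqrt_mult)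
  show "integrable M (\<lambda>x. (sqrt (f x) - sqrt (g x))\<^sup>2)" unfolding eq using int f g by simp
  show "(\<integral>x. (sqrt (f x) - sqrt (g x))\<^sup>2 \<partial>M) =
      (\<integral>x. f x \<partial>M) + (\<integral>x. g x \<partial>M) - 2 * (\<integral>x. sqrt (f x * g x) \<partial>M)"
    unfolding eq using int f g by simp
qed

text \<open>Factor the difference through square roots and apply Young's inequality with weight
  \<open>s\<close>. The bound integrates term by term, so closeness in Hellinger distance turns into
  closeness in \<open>L1\<close> by choosing \<open>s\<close> afterwards.\<close>

lemma abs_diff_le_sqrt_diff_sq:
  fixes a b s :: real
  assumes "0 \<le> a" "0 \<le> b" "0 < s"
  shows "\<bar>a - b\<bar> \<le> (sqrt a - sqrt b)\<^sup>2 / s + s * (a + b)"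
proof -
  define u v where "u = \<bar>sqrt a - sqrt b\<bar>" and "v = sqrt a + sqrt b"
  have "a - b = (sqrt a - sqrt b) * (sqrt a + sqrt b)"
    using assms by (simp add: algebra_simps)
  then have "\<bar>a - b\<bar> = u * v" using assms by (simp add: abs_mult u_def v_def)
  also have "u * v \<le> u\<^sup>2 / s + s * v\<^sup>2 / 4"
  proof -
    have "0 \<le> (u - s * v / 2)\<^sup>2 / s" using assms by simp
    also have "\<dots> = u\<^sup>2 / s + s * v\<^sup>2 / 4 - u * v"
      using assms by (simp add: power2_eq_square field_simps)
    finally show ?thesis by simp
  qed
  also have "v\<^sup>2 / 4 \<le> a + b"
  proof -
    have "0 \<le> (sqrt a - sqrt b)\<^sup>2" by simp
    then have "v\<^sup>2 \<le> 2 * (a + b)" using assms by (simp add: v_def power2_eq_square algebra_simps)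
    then show ?thesis using assms by simp
  qed
  then have "s * (v\<^sup>2 / 4) \<le> s * (a + b)" using assms by (intro mult_left_mono) auto
  then have "u\<^sup>2 / s + s * v\<^sup>2 / 4 \<le> u\<^sup>2 / s + s * (a + b)" by simp
  finally show ?thesis by (simp add: u_def)
qed

context nondegenerate_distribution begin

lemma log_integrable_sqrt_mult:
  assumes f: "f \<in> borel_measurable borel" "log_integrable P f"
    and g: "g \<in> borel_measurable borel" "log_integrable P g"
  shows "log_integrable P (\<lambda>x. sqrt (f x * g x))"
    and "(\<integral>x. ln (sqrt (f x * g x)) \<partial>P) = ((\<integral>x. ln (f x) \<partial>P) + (\<integral>x. ln (g x) \<partial>P)) / 2"
proof -
  have [measurable]: "f \<in> borel_measurable P" "g \<in> borel_measurable P"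
    using f(1) g(1) by (auto intro: measurable_P)
  have pos: "AE x in P. 0 < f x" "AE x in P. 0 < g x"
    and int: "integrable P (\<lambda>x. ln (f x))" "integrable P (\<lambda>x. ln (g x))"
    using f g by (auto simp: log_integrable_def)
  have int': "integrable P (\<lambda>x. (ln (f x) + ln (g x)) / 2)" using int by simp
  have eq: "AE x in P. ln (sqrt (f x * g x)) = (ln (f x) + ln (g x)) / 2"
    using pos by eventually_elim (simp add: ln_sqrt ln_mult_pos)
  have "AE x in P. 0 < sqrt (f x * g x)" using pos by eventually_elim simp
  moreover have "integrable P (\<lambda>x. ln (sqrt (f x * g x)))"
    using int' by (subst integrable_cong_AE[OF _ _ eq]) measurable
  ultimately show "log_integrable P (\<lambda>x. sqrt (f x * g x))" by (simp add: log_integrable_def)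
  have "(\<integral>x. ln (sqrt (f x * g x)) \<partial>P) = (\<integral>x. (ln (f x) + ln (g x)) / 2 \<partial>P)"
    by (rule integral_cong_AE[OF _ _ eq]) measurable
  then show "(\<integral>x. ln (sqrt (f x * g x)) \<partial>P) = ((\<integral>x. ln (f x) \<partial>P) + (\<integral>x. ln (g x) \<partial>P)) / 2"
    using int by simp
qed

text \<open>Restricting to log-integrable densities keeps the supremum real-valued; the remaining
  densities have expected logarithm minus infinity.\<close>

definition best_value :: real where
  "best_value = Sup {l. \<exists>g. g \<in> log_concave_densities \<and> log_integrable P g \<and> l = (\<integral>x. ln (g x) \<partial>P)}"

lemma le_best_value:
  assumes "g \<in> log_concave_densities" "log_integrable P g"
  shows "(\<integral>x. ln (g x) \<partial>P) \<le> best_value"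
  unfolding best_value_def
proof (rule cSup_upper)
  obtain M where M: "\<And>f. log_concave_density f \<Longrightarrow> log_integrable P f \<Longrightarrow> 0 \<le> (\<integral>x. ln (f x) \<partial>P) \<Longrightarrow>
    ln (log_concave_density.peak f) \<le> M"
    using ln_peak_bounded[of 0] by blast
  show "bdd_above {l. \<exists>g. g \<in> log_concave_densities \<and> log_integrable P g \<and> l = (\<integral>x. ln (g x) \<partial>P)}"
  proof (rule bdd_aboveI, clarify)
    fix g assume g: "g \<in> log_concave_densities" "log_integrable P g"
    show "(\<integral>x. ln (g x) \<partial>P) \<le> max 0 M"
    proof (cases "0 \<le> (\<integral>x. ln (g x) \<partial>P)")
      case True
      have "log_concave_density g" using g(1) by (rule log_concave_density_of_mem)
      then show ?thesis using M[OF _ g(2) True] integral_ln_le_ln_peak[OF _ g(2)] by fastforce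
    qed simp
  qed
qed (use assms in blast)

lemma near_best_value:
  assumes "l < best_value"
  obtains g where "g \<in> log_concave_densities" "log_integrable P g" "l < (\<integral>x. ln (g x) \<partial>P)"
proof -
  obtain g0 where "g0 \<in> log_concave_densities" "log_integrable P g0"
    using ex_log_integrable_density by blast
  then have "{l. \<exists>g. g \<in> log_concave_densities \<and> log_integrable P g \<and> l = (\<integral>x. ln (g x) \<partial>P)} \<noteq> {}" by blast
  from less_cSupD[OF this assms[unfolded best_value_def]] show ?thesis using that by blast
qed

lemma integral_ln_le_best_value:
  assumes h: "log_concave h" "integrable lborel h" and hP: "log_integrable P h"
  shows "(\<integral>x. ln (h x) \<partial>P) - ln (\<integral>x. h x \<partial>lborel) \<le> best_value"
  using ex_density_ge[OF assms] le_best_value order_trans by metis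

text \<open>The normalised geometric mean of two near-maximisers is a competitor, hence they are close.\<close>

lemma sqrt_diff_sq_le:
  assumes f: "log_concave f" "integrable lborel f" "log_integrable P f"
    and g: "log_concave g" "integrable lborel g" "log_integrable P g"
  shows "(\<integral>x. (sqrt (f x) - sqrt (g x))\<^sup>2 \<partial>lborel) \<le> (\<integral>x. f x \<partial>lborel) + (\<integral>x. g x \<partial>lborel) - 2 +
    (2 * best_value - (\<integral>x. ln (f x) \<partial>P) - (\<integral>x. ln (g x) \<partial>P))"
proof -
  define h where "h x = sqrt (f x * g x)" for x
  have f0: "\<And>x. 0 \<le> f x" and g0: "\<And>x. 0 \<le> g x" using f g by (auto simp: log_concave_nonneg)
  have meas: "f \<in> borel_measurable borel" "g \<in> borel_measurable borel" using f g by auto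
  have h_lc: "log_concave h" unfolding h_def using f g by (intro log_concave_sqrt log_concave_mult)
  have h_int: "integrable lborel h"
    unfolding h_def by (rule integral_sqrt_diff_sq(1)[OF f(2) f0 g(2) g0])
  have hP: "log_integrable P h"
    and ln_h: "(\<integral>x. ln (h x) \<partial>P) = ((\<integral>x. ln (f x) \<partial>P) + (\<integral>x. ln (g x) \<partial>P)) / 2"
    unfolding h_def using log_integrable_sqrt_mult[OF meas(1) f(3) meas(2) g(3)] by auto
  define A where "A = (\<integral>x. h x \<partial>lborel)"
  have A: "0 < A" unfolding A_def
    using hP by (intro integral_pos_of_log_concave h_lc h_int) (simp add: log_integrable_def)
  have "((\<integral>x. ln (f x) \<partial>P) + (\<integral>x. ln (g x) \<partial>P)) / 2 - ln A \<le> best_value"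
    using integral_ln_le_best_value[OF h_lc h_int hP] by (simp add: ln_h A_def)
  \<comment> \<open>This makes the optimality inequality linear in the affinity \<open>A\<close>,
    the quantity that appears when the squared difference of square roots is expanded.\<close>
  moreover have "ln A \<le> A - 1" using A by (rule ln_le_minus_one)
  ultimately have "2 - 2 * A \<le> 2 * best_value - (\<integral>x. ln (f x) \<partial>P) - (\<integral>x. ln (g x) \<partial>P)"
    by (simp add: field_simps)
  moreover have "(\<integral>x. (sqrt (f x) - sqrt (g x))\<^sup>2 \<partial>lborel) =
      (\<integral>x. f x \<partial>lborel) + (\<integral>x. g x \<partial>lborel) - 2 * A"
    unfolding A_def h_def by (rule integral_sqrt_diff_sq(3)[OF f(2) f0 g(2) g0])
  ultimately show ?thesis by linarith
qed

lemma integral_abs_diff_le: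
  assumes f: "f \<in> log_concave_densities" "log_integrable P f" "best_value - \<delta> \<le> (\<integral>x. ln (f x) \<partial>P)"
    and g: "g \<in> log_concave_densities" "log_integrable P g" "best_value - \<delta> \<le> (\<integral>x. ln (g x) \<partial>P)"
    and s: "0 < s"
  shows "(\<integral>x. \<bar>f x - g x\<bar> \<partial>lborel) \<le> 2 * \<delta> / s + 2 * s"
proof -
  interpret f: log_concave_density f using f(1) by (rule log_concave_density_of_mem)
  interpret g: log_concave_density g using g(1) by (rule log_concave_density_of_mem)
  have int: "integrable lborel (\<lambda>x. (sqrt (f x) - sqrt (g x))\<^sup>2)"
    by (rule integral_sqrt_diff_sq(2)[OF f.integrable f.nonneg g.integrable g.nonneg])
  have "(\<integral>x. \<bar>f x - g x\<bar> \<partial>lborel) \<le> (\<integral>x. (sqrt (f x) - sqrt (g x))\<^sup>2 / s + s * (f x + g x) \<partial>lborel)"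
    using f.integrable g.integrable int f.nonneg g.nonneg s
    by (intro integral_mono abs_diff_le_sqrt_diff_sq) auto
  also have "\<dots> = (\<integral>x. (sqrt (f x) - sqrt (g x))\<^sup>2 \<partial>lborel) / s + s * 2"
    using f.integrable g.integrable int f.integral_1 g.integral_1 by simp
  also have "(\<integral>x. (sqrt (f x) - sqrt (g x))\<^sup>2 \<partial>lborel) \<le> 2 * \<delta>"
    using sqrt_diff_sq_le[OF f.log_concave f.integrable f(2) g.log_concave g.integrable g(2)]
      f.integral_1 g.integral_1 f(3) g(3) by simp
  then have "(\<integral>x. (sqrt (f x) - sqrt (g x))\<^sup>2 \<partial>lborel) / s + s * 2 \<le> 2 * \<delta> / s + 2 * s"
    using s by (simp add: divide_right_mono)
  finally show ?thesis .
qed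

text \<open>Near-maximisers are \<open>L1\<close>-close, so a maximising sequence is Cauchy in
  \<open>L1\<close> and a subsequence converges almost everywhere. The uniform bound
  \<open>B\<close> comes from the bound on peaks.\<close>

lemma ex_maximizing_sequence:
  obtains g B where "\<And>n. g n \<in> log_concave_densities" "\<And>n. log_integrable P (g n)"
    "\<And>n. best_value - 1 / real (Suc n) \<le> (\<integral>x. ln (g n x) \<partial>P)"
    "\<And>n x. g n x \<le> B" "AE x in lborel. convergent (\<lambda>n. g n x)"
    "\<And>m n. (\<integral>x. \<bar>g m x - g n x\<bar> \<partial>lborel) \<le> 1 / 2"
proof -
  \<comment> \<open>The 64 makes any two members of the sequence \<open>L1\<close>-close to within
    1/2, on taking \<open>s = 1/8\<close> in the estimate for near-maximisers; later this keeps the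
    limit from vanishing.\<close>
  define ok where "ok n f \<longleftrightarrow> f \<in> log_concave_densities \<and> log_integrable P f \<and>
    best_value - 1 / (64 * real (Suc n)) \<le> (\<integral>x. ln (f x) \<partial>P)" for n f
  have "\<exists>f. ok n f" for n
    using near_best_value[of "best_value - 1 / (64 * real (Suc n))"] unfolding ok_def
    by (metis diff_less_eq less_add_same_cancel1 less_imp_le mult_pos_pos of_nat_0_less_iff zero_less_Suc
        zero_less_divide_1_iff zero_less_numeral)
  then obtain f where f: "\<And>n. ok n (f n)" by metis
  have ok_mono: "ok m (f n)" if "m \<le> n" for m n
  proof -
    have "1 / (64 * real (Suc n)) \<le> 1 / (64 * real (Suc m))" using that by (intro divide_left_mono) auto
    then show ?thesis using f[of n] unfolding ok_def by linarith
  qed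
  have close: "(\<integral>x. \<bar>f i x - f j x\<bar> \<partial>lborel) \<le> 2 * (1 / (64 * real (Suc m))) / s + 2 * s"
    if "m \<le> i" "m \<le> j" "0 < s" for i j m s
    using ok_mono[OF that(1)] ok_mono[OF that(2)] that(3) unfolding ok_def by (intro integral_abs_diff_le) auto
  have dens: "log_concave_density (f n)" for n
    using f[of n] unfolding ok_def by (intro log_concave_density_of_mem) auto
  have int: "integrable lborel (f n)" for n
    using dens by (simp add: log_concave_density_def)
  obtain r where r: "strict_mono r" "AE x in lborel. Cauchy (\<lambda>i. f (r i) x)"
  proof (rule cauchy_L1_AE_cauchy_subseq[OF int])
    fix e :: real assume e: "0 < e"
    obtain m where m: "2 / e\<^sup>2 < real m" using reals_Archimedean2 by blast
    have "2 * (1 / (64 * real (Suc m))) / (e / 4) + 2 * (e / 4) < e"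
    proof -
      have "2 < real m * e\<^sup>2" using m e by (simp add: field_simps)
      also have "\<dots> \<le> real (Suc m) * e\<^sup>2" by (intro mult_right_mono) auto
      finally have "2 < real (Suc m) * e\<^sup>2" .
      moreover define N where "N = real (Suc m)"
      ultimately have "2 < N * e\<^sup>2" "0 < N" by auto
      then have "2 * (1 / (64 * N)) / (e / 4) < e / 2" using e by (simp add: field_simps power2_eq_square)
      then have "2 * (1 / (64 * real (Suc m))) / (e / 4) < e / 2" by (simp only: N_def)
      then show ?thesis by simp
    qed
    note small = this
    have "LINT x|lborel. norm (f i x - f j x) < e" if "m \<le> i" "m \<le> j" for i j
    proof -
      have "LINT x|lborel. norm (f i x - f j x) \<le> 2 * (1 / (64 * real (Suc m))) / (e / 4) + 2 * (e / 4)"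
        unfolding real_norm_def using that e by (intro close) auto
      then show ?thesis using small by (rule le_less_trans)
    qed
    then show "\<exists>N. \<forall>i\<ge>N. \<forall>j\<ge>N. LINT x|lborel. norm (f i x - f j x) < e" by blast
  qed blast
  obtain M where M: "\<And>f. log_concave_density f \<Longrightarrow> log_integrable P f \<Longrightarrow> best_value - 1 \<le> (\<integral>x. ln (f x) \<partial>P) \<Longrightarrow>
    ln (log_concave_density.peak f) \<le> M"
    using ln_peak_bounded[of "best_value - 1"] by blast
  have best: "best_value - 1 / real (Suc n) \<le> (\<integral>x. ln (f (r n) x) \<partial>P)" for n
  proof -
    have "1 / (64 * real (Suc n)) \<le> 1 / real (Suc n)" by (simp add: field_simps)
    then show ?thesis using ok_mono[OF seq_suble[OF r(1), of n]] unfolding ok_def by linarith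
  qed
  show ?thesis
  proof (rule that[of "\<lambda>n. f (r n)" "exp M"])
    show "f (r n) \<in> log_concave_densities" "log_integrable P (f (r n))" for n
      using f[of "r n"] by (auto simp: ok_def)
    show "best_value - 1 / real (Suc n) \<le> (\<integral>x. ln (f (r n) x) \<partial>P)" for n by (rule best)
    show "f (r n) x \<le> exp M" for n x
    proof -
      interpret log_concave_density "f (r n)" by (rule dens)
      have "best_value - 1 \<le> (\<integral>x. ln (f (r n) x) \<partial>P)"
      proof -
        have "1 / real (Suc n) \<le> 1" by simp
        then show ?thesis using best[of n] by linarith
      qed
      then have "ln peak \<le> M" using f[of "r n"] by (intro M dens) (auto simp: ok_def)
      then have "exp (ln peak) \<le> exp M" by simp
      then show ?thesis using peak_pos le_peak[of x] by simp
    qed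
    show "AE x in lborel. convergent (\<lambda>n. f (r n) x)"
      using r(2) by eventually_elim (simp add: Cauchy_convergent)
    show "(\<integral>x. \<bar>f (r m) x - f (r n) x\<bar> \<partial>lborel) \<le> 1 / 2" for m n
      using close[of 0 "r m" "r n" "1/8"] by simp
  qed
qed

end

section \<open>The limit of a maximising sequence is a maximiser\<close>

context nondegenerate_distribution begin

text \<open>Fatou's lemma for the nonnegative functions \<open>ln B - ln (g n x)\<close>. The
  one-sided pointwise hypothesis \<open>lim\<close> is exactly what bounds their limit inferior from
  below, and it is assumed at every point because \<open>P\<close> may be singular to Lebesgue
  measure.\<close>

lemma fatou_log_integrable:
  assumes gP: "\<And>n. log_integrable P (g n)" and g: "\<And>n. g n \<in> borel_measurable borel" "\<And>n x. g n x \<le> B"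
    and l: "\<And>e. 0 < e \<Longrightarrow> \<forall>\<^sub>F n in sequentially. l - e \<le> (\<integral>x. ln (g n x) \<partial>P)"
    and F: "F \<in> borel_measurable borel" "\<And>x. 0 \<le> F x" "\<And>x. F x \<le> B" and B: "0 < B"
    and lim: "\<And>x c. F x < c \<Longrightarrow> \<forall>\<^sub>F n in sequentially. g n x \<le> c"
  shows "log_integrable P F" and "l \<le> (\<integral>x. ln (F x) \<partial>P)"
proof -
  have [measurable]: "g n \<in> borel_measurable P" "F \<in> borel_measurable P" for n
    using g(1) F(1) by (auto intro: measurable_P)
  define k where "k n x = ennreal (ln B - ln (g n x))" for n x
  \<comment> \<open>The value infinity at zeros of \<open>F\<close> lets the finiteness of the
    integral also prove that \<open>F\<close> is positive \<open>P\<close>-almost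
    everywhere.\<close>
  define kF where "kF x = (if 0 < F x then ennreal (ln B - ln (F x)) else \<infinity>)" for x
  have [measurable]: "k n \<in> borel_measurable P" "kF \<in> borel_measurable P" for n
    unfolding k_def kF_def by measurable
  have "AE x in P. \<forall>n. 0 < g n x"
    unfolding AE_all_countable using gP by (simp add: log_integrable_def)
  then have le: "AE x in P. kF x \<le> liminf (\<lambda>n. k n x)"
  proof eventually_elim
    case (elim x)
    show ?case
      unfolding le_Liminf_iff
    proof (intro allI impI)
      fix y assume y: "y < kF x"
      then have "y < \<infinity>" using less_le_trans top_greatest by (metis infinity_ennreal_def)
      then obtain s where s: "0 \<le> s" "y = ennreal s" by (cases y) auto
      have "F x < exp (ln B - s)"
      proof (cases "0 < F x")
        case True
        then have "ennreal s < ennreal (ln B - ln (F x))" using y s by (simp add: kF_def)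
        then have "s < ln B - ln (F x)" using s by (simp add: ennreal_less_iff)
        then have "ln (F x) < ln B - s" by simp
        then have "exp (ln (F x)) < exp (ln B - s)" by simp
        then show ?thesis using True by simp
      next
        case False
        then have "F x \<le> 0" by simp
        then show ?thesis using exp_gt_zero le_less_trans by blast
      qed
      then obtain c where c: "F x < c" "c < exp (ln B - s)" using dense by blast
      show "\<forall>\<^sub>F n in sequentially. y < k n x"
        using lim[OF c(1)]
      proof eventually_elim
        fix n assume "g n x \<le> c"
        then have "g n x < exp (ln B - s)" using c by simp
        then have "ln (g n x) < ln (exp (ln B - s))" using elim by (intro ln_less_cancel_iff[THEN iffD2]) auto
        then show "y < k n x" using s by (simp add: k_def ennreal_less_iff)
      qed
    qed
  qed
  have int_k: "(\<integral>\<^sup>+x. k n x \<partial>P) = ennreal (ln B - (\<integral>x. ln (g n x) \<partial>P))" for n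
  proof -
    have "AE x in P. 0 \<le> ln B - ln (g n x)"
      using gP[of n, unfolded log_integrable_def, THEN conjunct1] by eventually_elim (use g(2) in \<open>simp add: ln_mono\<close>)
    then have "(\<integral>\<^sup>+x. k n x \<partial>P) = ennreal (\<integral>x. ln B - ln (g n x) \<partial>P)"
      unfolding k_def using gP[of n] by (intro nn_integral_eq_integral) (auto simp: log_integrable_def)
    then show ?thesis using gP[of n] prob_space by (simp add: log_integrable_def)
  qed
  have bound: "(\<integral>\<^sup>+x. kF x \<partial>P) \<le> ennreal (ln B - l + e)" if e: "0 < e" for e
  proof -
    have "(\<integral>\<^sup>+x. kF x \<partial>P) \<le> (\<integral>\<^sup>+x. liminf (\<lambda>n. k n x) \<partial>P)" by (rule nn_integral_mono_AE[OF le])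
    also have "\<dots> \<le> liminf (\<lambda>n. \<integral>\<^sup>+x. k n x \<partial>P)" by (rule nn_integral_liminf) measurable
    also have "\<dots> \<le> liminf (\<lambda>n. ennreal (ln B - l + e))"
      using l[OF e] by (intro Liminf_mono) (auto simp: int_k elim!: eventually_mono intro!: ennreal_leI)
    also have "\<dots> = ennreal (ln B - l + e)" by (simp add: Liminf_const)
    finally show ?thesis .
  qed
  have fin: "(\<integral>\<^sup>+x. kF x \<partial>P) < \<infinity>" using bound[of 1] by (auto intro: le_less_trans)
  then have "AE x in P. kF x \<noteq> \<infinity>" by (intro nn_integral_PInf_AE) auto
  then have pos: "AE x in P. 0 < F x" by eventually_elim (auto simp: kF_def split: if_splits)
  have nonneg: "AE x in P. 0 \<le> ln B - ln (F x)"
    using pos by eventually_elim (use F(3) in \<open>simp add: ln_mono\<close>)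
  have eq: "(\<integral>\<^sup>+x. kF x \<partial>P) = (\<integral>\<^sup>+x. ennreal (ln B - ln (F x)) \<partial>P)"
    by (rule nn_integral_cong_AE) (use pos in \<open>auto simp: kF_def elim: eventually_mono\<close>)
  have int: "integrable P (\<lambda>x. ln B - ln (F x))"
    using fin nonneg by (intro integrableI_nonneg) (auto simp: eq)
  have intF: "integrable P (\<lambda>x. ln (F x))"
    using Bochner_Integration.integrable_diff[OF integrable_const[of "ln B"] int]
    by (rule back_subst[of "integrable P"]) auto
  then show "log_integrable P F" using pos by (simp add: log_integrable_def)
  show "l \<le> (\<integral>x. ln (F x) \<partial>P)"
  proof (rule field_le_epsilon)
    fix e :: real assume e: "0 < e"
    have "ennreal (\<integral>x. ln B - ln (F x) \<partial>P) \<le> ennreal (ln B - l + e)"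
      using bound[OF e] nn_integral_eq_integral[OF int nonneg] by (simp add: eq)
    moreover have I: "(\<integral>x. ln B - ln (F x) \<partial>P) = ln B - (\<integral>x. ln (F x) \<partial>P)"
      using intF prob_space by simp
    moreover have "0 \<le> ln B - l + e"
    proof -
      obtain n where n: "l - e \<le> (\<integral>x. ln (g n x) \<partial>P)" using l[OF e] eventually_happens by fastforce
      have "(\<integral>x. ln (g n x) \<partial>P) \<le> (\<integral>x. ln B \<partial>P)"
        using gP[of n] g(2) by (intro integral_mono_AE) (auto simp: log_integrable_def ln_mono elim!: eventually_mono)
      then show ?thesis using n prob_space by simp
    qed
    ultimately show "l \<le> (\<integral>x. ln (F x) \<partial>P) + e" by (simp add: ennreal_le_iff)
  qed
qed

text \<open>The candidate is the upper semicontinuous hull of the limit inferior. It loses nothing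
  in expected logarithm by the reverse form of Fatou's lemma, and its mass is at most 1, so
  normalisation can only help.\<close>

lemma ex_maximizer:
  obtains f where "f \<in> log_concave_densities" "log_integrable P f" "best_value \<le> (\<integral>x. ln (f x) \<partial>P)"
proof -
  obtain g B where g: "\<And>n. g n \<in> log_concave_densities" "\<And>n. log_integrable P (g n)"
      "\<And>n. best_value - 1 / real (Suc n) \<le> (\<integral>x. ln (g n x) \<partial>P)"
      "\<And>n x. g n x \<le> B" "AE x in lborel. convergent (\<lambda>n. g n x)"
      "\<And>m n. (\<integral>x. \<bar>g m x - g n x\<bar> \<partial>lborel) \<le> 1 / 2"
    by (rule ex_maximizing_sequence) blast
  have dens: "log_concave_density (g n)" for n using g(1) by (rule log_concave_density_of_mem)
  have lc: "log_concave (g n)" and g_int: "integrable lborel (g n)" for n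
    using dens by (auto simp: log_concave_density_def)
  have meas [measurable]: "g n \<in> borel_measurable borel" for n using g_int by auto
  have g0: "\<And>n x. 0 \<le> g n x" using lc by (simp add: log_concave_nonneg)
  have g1: "(\<integral>\<^sup>+x. ennreal (g n x) \<partial>lborel) = 1" for n
    using dens by (rule log_concave_density.nn_integral_1)
  define f where "f = (\<lambda>x. real_liminf (\<lambda>n. g n x))"
  have f_lc: "log_concave f" unfolding f_def by (rule log_concave_real_liminf[OF lc g(4)])
  have f0: "\<And>x. 0 \<le> f x" and fB: "\<And>x. f x \<le> B"
    unfolding f_def using real_liminf_nonneg[OF g0 g(4)] real_liminf_le_bound[OF g0 g(4)] by auto
  have [measurable]: "f \<in> borel_measurable borel"
    unfolding f_def by (rule measurable_real_liminf[OF meas g0 g(4)])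
  have conv: "AE x in lborel. (\<lambda>n. g n x) \<longlonglongrightarrow> f x"
    using g(5)
  proof eventually_elim
    case (elim x)
    then obtain y where "(\<lambda>n. g n x) \<longlonglongrightarrow> y" by (auto simp: convergent_def)
    then show ?case using real_liminf_eq_lim[of "\<lambda>n. g n x" B, OF g0 g(4)] by (simp add: f_def)
  qed
  have f_le: "(\<integral>\<^sup>+x. ennreal (f x) \<partial>lborel) \<le> 1"
  proof -
    have "(\<integral>\<^sup>+x. ennreal (f x) \<partial>lborel) = (\<integral>\<^sup>+x. liminf (\<lambda>n. ennreal (g n x)) \<partial>lborel)"
    proof (rule nn_integral_cong_AE)
      show "AE x in lborel. ennreal (f x) = liminf (\<lambda>n. ennreal (g n x))"
        using conv by eventually_elim (intro lim_imp_Liminf[symmetric] tendsto_ennrealI; simp)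
    qed
    also have "\<dots> \<le> liminf (\<lambda>n. \<integral>\<^sup>+x. ennreal (g n x) \<partial>lborel)" by (rule nn_integral_liminf) measurable
    finally show ?thesis by (simp add: g1 Liminf_const)
  qed
  \<comment> \<open>Mass could be lost in the limit, but the limit is within 1/2 of
    \<open>g 0\<close> in \<open>L1\<close>, and \<open>g 0\<close> has mass 1.\<close>
  have f_pos: "0 < (\<integral>\<^sup>+x. ennreal (f x) \<partial>lborel)"
  proof (rule ccontr)
    assume "\<not> ?thesis"
    then have z: "(\<integral>\<^sup>+x. ennreal (f x) \<partial>lborel) = 0" by simp
    have "1 = (\<integral>\<^sup>+x. ennreal (g 0 x) \<partial>lborel)" by (simp add: g1)
    also have "\<dots> \<le> (\<integral>\<^sup>+x. ennreal (f x) + ennreal \<bar>g 0 x - f x\<bar> \<partial>lborel)"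
    proof (rule nn_integral_mono)
      fix x
      have "ennreal (g 0 x) \<le> ennreal (f x + \<bar>g 0 x - f x\<bar>)" by (rule ennreal_leI) simp
      also have "\<dots> = ennreal (f x) + ennreal \<bar>g 0 x - f x\<bar>" using f0 by (intro ennreal_plus) auto
      finally show "ennreal (g 0 x) \<le> ennreal (f x) + ennreal \<bar>g 0 x - f x\<bar>" .
    qed
    also have "\<dots> = (\<integral>\<^sup>+x. ennreal \<bar>g 0 x - f x\<bar> \<partial>lborel)"
      by (subst nn_integral_add) (auto simp: z)
    also have "\<dots> = (\<integral>\<^sup>+x. liminf (\<lambda>n. ennreal \<bar>g 0 x - g n x\<bar>) \<partial>lborel)"
    proof (rule nn_integral_cong_AE)
      show "AE x in lborel. ennreal \<bar>g 0 x - f x\<bar> = liminf (\<lambda>n. ennreal \<bar>g 0 x - g n x\<bar>)"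
        using conv by eventually_elim (intro lim_imp_Liminf[symmetric] tendsto_ennrealI tendsto_intros; simp)
    qed
    also have "\<dots> \<le> liminf (\<lambda>n. \<integral>\<^sup>+x. ennreal \<bar>g 0 x - g n x\<bar> \<partial>lborel)"
      by (rule nn_integral_liminf) measurable
    also have "\<dots> \<le> liminf (\<lambda>n. ennreal (1 / 2))"
    proof (intro Liminf_mono always_eventually allI)
      fix n
      have "(\<integral>\<^sup>+x. ennreal \<bar>g 0 x - g n x\<bar> \<partial>lborel) = ennreal (\<integral>x. \<bar>g 0 x - g n x\<bar> \<partial>lborel)"
        using g_int by (intro nn_integral_eq_integral) auto
      then show "(\<integral>\<^sup>+x. ennreal \<bar>g 0 x - g n x\<bar> \<partial>lborel) \<le> ennreal (1 / 2)"
        using g(6)[of 0 n] by (simp only: ennreal_leI)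
    qed
    also have "\<dots> = ennreal (1 / 2)" by (simp add: Liminf_const)
    finally have "ennreal 1 \<le> ennreal (1 / 2)" by simp
    then show False by (subst (asm) ennreal_le_iff) auto
  qed
  obtain b z \<rho> where ball: "0 < b" "0 < \<rho>" "ball z \<rho> \<subseteq> {x. b < f x}"
    by (rule ex_ball_superlevel[OF f_lc _ f_pos]) measurable
  define F where "F = usc_hull f"
  have F: "log_concave F" "upper_semicontinuous F" "\<And>x. 0 \<le> F x" "\<And>x. F x \<le> B" "AE x in lborel. F x = f x"
    unfolding F_def
    by (rule log_concave_usc_hull[of f B] upper_semicontinuous_usc_hull[of f B] usc_hull_nonneg[of f B]
        usc_hull_bound[of f B] usc_hull_eq_AE[of f B]; use f0 fB f_lc in auto)+
  have F_meas [measurable]: "F \<in> borel_measurable borel" using F(2) by (rule upper_semicontinuous_measurable)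
  have "z \<in> ball z \<rho>" using ball by simp
  then have "b < f z" using ball by blast
  then have "0 < B" using ball fB[of z] by linarith
  have "(\<integral>\<^sup>+x. ennreal (F x) \<partial>lborel) = (\<integral>\<^sup>+x. ennreal (f x) \<partial>lborel)"
    by (rule nn_integral_cong_AE) (use F(5) in eventually_elim, simp)
  then have F_le: "(\<integral>\<^sup>+x. ennreal (F x) \<partial>lborel) \<le> 1" using f_le by simp
  then have F_int: "integrable lborel F" using F(3) by (intro integrableI_nonneg) (auto intro: le_less_trans)
  have "ennreal (\<integral>x. F x \<partial>lborel) \<le> ennreal 1"
    using F_le nn_integral_eq_integral[OF F_int] F(3) by simp
  then have F_le1: "(\<integral>x. F x \<partial>lborel) \<le> 1" by (subst (asm) ennreal_le_iff) auto
  have l: "\<forall>\<^sub>F n in sequentially. best_value - e \<le> (\<integral>x. ln (g n x) \<partial>P)" if "0 < e" for e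
  proof -
    have "(\<lambda>n. 1 / real (Suc n)) \<longlonglongrightarrow> 0" by (rule LIMSEQ_Suc[OF lim_1_over_n])
    then have "\<forall>\<^sub>F n in sequentially. 1 / real (Suc n) < e" using that by (rule order_tendstoD)
    then show ?thesis
    proof eventually_elim
      fix n assume "1 / real (Suc n) < e"
      then show "best_value - e \<le> (\<integral>x. ln (g n x) \<partial>P)" using g(3)[of n] by linarith
    qed
  qed
  have lim: "\<forall>\<^sub>F n in sequentially. g n x \<le> c" if "F x < c" for x c
    by (rule eventually_le_usc_hull_liminf[OF lc g(4) g(5) ball[unfolded f_def]])
      (use that in \<open>simp add: F_def f_def\<close>)
  have FP: "log_integrable P F" "best_value \<le> (\<integral>x. ln (F x) \<partial>P)"
    using fatou_log_integrable[OF g(2) meas g(4) l F_meas F(3) F(4) \<open>0 < B\<close> lim] by auto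
  obtain h where h: "h \<in> log_concave_densities" "log_integrable P h"
      "(\<integral>x. ln (F x) \<partial>P) - ln (\<integral>x. F x \<partial>lborel) \<le> (\<integral>x. ln (h x) \<partial>P)"
    by (rule ex_density_ge[OF F(1) F_int FP(1)])
  have "0 < (\<integral>x. F x \<partial>lborel)"
    using FP(1) by (intro integral_pos_of_log_concave F(1) F_int) (simp add: log_integrable_def)
  \<comment> \<open>Dividing by a mass of at most 1 does not lower the value.\<close>
  then have "ln (\<integral>x. F x \<partial>lborel) \<le> 0" using F_le1 by simp
  then show ?thesis using that[OF h(1,2)] h(3) FP(2) by linarith
qed

text \<open>The projection is a choice among maximisers, so exhibiting one maximiser
  \<open>h\<close> transfers the optimal value to whatever is chosen. Densities that are not
  log-integrable have value minus infinity and cannot compete.\<close>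

lemma log_concave_projection:
  "log_concave_projection P \<in> log_concave_densities"
  "log_integrable P (log_concave_projection P)"
  "(\<integral>x. ln (log_concave_projection P x) \<partial>P) = best_value"
proof -
  define f where "f = log_concave_projection P"
  obtain h where h: "h \<in> log_concave_densities" "log_integrable P h" "best_value \<le> (\<integral>x. ln (h x) \<partial>P)"
    by (rule ex_maximizer)
  have li: "log_integrable P g" if g: "g \<in> log_concave_densities" "expected_log P g \<noteq> - \<infinity>" for g
  proof -
    interpret log_concave_density g using g(1) by (rule log_concave_density_of_mem)
    show ?thesis
      by (rule log_integrableI_expected_log[OF prob_space_axioms _ nonneg le_peak g(2)]) measurable
  qed
  have eh: "expected_log P h = ereal (\<integral>x. ln (h x) \<partial>P)" using h(2) by (rule expected_log_eq_integral)
  have "is_arg_max (expected_log P) (\<lambda>x. x \<in> log_concave_densities) h"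
    unfolding is_arg_max_def
  proof (intro conjI h(1) notI)
    assume "\<exists>y. y \<in> log_concave_densities \<and> expected_log P y > expected_log P h"
    then obtain y where y: "y \<in> log_concave_densities" "expected_log P h < expected_log P y" by blast
    then have "expected_log P y \<noteq> - \<infinity>" by auto
    then have "log_integrable P y" by (rule li[OF y(1)])
    then show False using y(2) h(3) le_best_value[OF y(1)] by (simp add: expected_log_eq_integral eh)
  qed
  then have "is_arg_max (expected_log P) (\<lambda>x. x \<in> log_concave_densities) f"
    unfolding f_def log_concave_projection_def arg_max_on_def arg_max_def
    by (rule someI[where P = "is_arg_max (expected_log P) (\<lambda>x. x \<in> log_concave_densities)"])
  then have f: "f \<in> log_concave_densities" "expected_log P h \<le> expected_log P f"
    unfolding is_arg_max_def using h(1) by (auto simp: not_less)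
  have "log_integrable P f" using f by (intro li) (auto simp: eh)
  moreover have "(\<integral>x. ln (f x) \<partial>P) = best_value"
    using f(2) h(3) le_best_value[OF f(1) \<open>log_integrable P f\<close>]
    by (simp add: eh expected_log_eq_integral[OF \<open>log_integrable P f\<close>])
  ultimately show "log_concave_projection P \<in> log_concave_densities"
      "log_integrable P (log_concave_projection P)" "(\<integral>x. ln (log_concave_projection P x) \<partial>P) = best_value"
    using f(1) by (auto simp: f_def)
qed

end

section \<open>Continuity of the projection\<close>

context nondegenerate_distribution begin

text \<open>Comparison with a stretched copy of \<open>f\<close> shows that
  \<open>ln peak + 1\<close> exceeds the optimal value by at most \<open>2 * (d + 1)\<close>, a
  bound free of \<open>P\<close>. The constant is then 16 = 8 * 2, with one factor
  \<open>d + 1\<close> from this gap and one from the inscribed ball.\<close>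

lemma core_inball_projection:
  obtains c where "ball c (min_abs_deviation P / (16 * (real DIM('a) + 1)\<^sup>2))
    \<subseteq> log_concave_density.core (log_concave_projection P)"
proof -
  define f where "f = log_concave_projection P"
  have f: "f \<in> log_concave_densities" "log_integrable P f" "(\<integral>x. ln (f x) \<partial>P) = best_value"
    unfolding f_def by (rule log_concave_projection)+
  have dens: "log_concave_density f" using f(1) by (rule log_concave_density_of_mem)
  interpret log_concave_density f by (fact dens)
  define d where "d = DIM('a)"
  obtain x0 where x0: "peak * exp (- 1) < f x0" using near_peak_exp[of 1] by auto
  have "0 < peak * exp (- 1)" using peak_pos by simp
  then have fx0: "0 < f x0" using x0 by linarith
  have "ln (peak * exp (- 1)) \<le> ln (f x0)" using x0 peak_pos by (intro ln_mono) auto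
  then have ln_fx0: "ln peak - 1 \<le> ln (f x0)" using peak_pos by (simp add: ln_mult_pos)
  define s where "s x = sqrt (f x * f x0)" for x
  \<comment> \<open>The dilation of \<open>f\<close> by the factor 2 about \<open>x0\<close>, with
    mass \<open>2 ^ d\<close>. Log-concavity puts it above the geometric mean \<open>s\<close> of
    \<open>f\<close> and the constant \<open>f x0\<close>.\<close>
  define h where "h x = f ((1/2) *\<^sub>R x0 + (1/2) *\<^sub>R x)" for x
  have const: "log_integrable P (\<lambda>_. f x0)" using fx0 by (simp add: log_integrable_def)
  have s: "log_integrable P s" "(\<integral>x. ln (s x) \<partial>P) = (best_value + ln (f x0)) / 2"
    unfolding s_def using log_integrable_sqrt_mult[OF measurable_f f(2) _ const] prob_space by (auto simp: f(3))
  have h_meas [measurable]: "h \<in> borel_measurable borel" unfolding h_def by measurable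
  have h_lc: "log_concave h" unfolding h_def by (rule log_concave_affine[OF log_concave])
  have sh: "s x \<le> h x" for x
  proof -
    have "f x0 powr (1 - 1/2) * f x powr (1/2) \<le> f ((1 - 1/2) *\<^sub>R x0 + (1/2) *\<^sub>R x)"
      by (rule log_concaveD[OF log_concave]) auto
    then show ?thesis using nonneg fx0 by (simp add: s_def h_def powr_half_sqrt real_sqrt_mult mult.commute)
  qed
  have hP: "log_integrable P h" "(\<integral>x. ln (s x) \<partial>P) \<le> (\<integral>x. ln (h x) \<partial>P)"
  proof -
    have "h x \<le> peak" for x unfolding h_def by (rule le_peak)
    from log_integrable_mono[OF s(1) h_meas sh this]
    show "log_integrable P h" "(\<integral>x. ln (s x) \<partial>P) \<le> (\<integral>x. ln (h x) \<partial>P)" .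
  qed
  have "1 = ennreal ((1/2) ^ d) * (\<integral>\<^sup>+x. ennreal (h x) \<partial>lborel)"
    using nn_integral_affine[of "\<lambda>x. ennreal (f x)" "1/2" "(1/2) *\<^sub>R x0"] by (simp add: nn_integral_1 h_def d_def)
  then have "ennreal (2 ^ d) * 1 = ennreal (2 ^ d) * (ennreal ((1/2) ^ d) * (\<integral>\<^sup>+x. ennreal (h x) \<partial>lborel))"
    by simp
  also have "\<dots> = (ennreal (2 ^ d) * ennreal ((1/2) ^ d)) * (\<integral>\<^sup>+x. ennreal (h x) \<partial>lborel)"
    by (simp only: mult.assoc)
  also have "ennreal (2 ^ d) * ennreal ((1/2) ^ d) = 1"
    by (subst ennreal_mult[symmetric]) (auto simp flip: power_mult_distrib)
  finally have h2: "(\<integral>\<^sup>+x. ennreal (h x) \<partial>lborel) = ennreal (2 ^ d)" by simp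
  have h0: "\<And>x. 0 \<le> h x" by (simp add: h_def nonneg)
  have h_int: "integrable lborel h" using h2 h0 by (intro integrableI_nonneg) auto
  have "(\<integral>x. h x \<partial>lborel) = 2 ^ d" using h2 h0 by (subst integral_eq_nn_integral) auto
  then have "(\<integral>x. ln (h x) \<partial>P) - real d * ln 2 \<le> best_value"
    using integral_ln_le_best_value[OF h_lc h_int hP(1)] by (simp add: ln_realpow)
  then have "(best_value + ln (f x0)) / 2 - real d * ln 2 \<le> best_value" using hP(2) s(2) by linarith
  moreover have "real d * ln 2 \<le> real d * 1" using ln_le_minus_one[of 2] by (intro mult_left_mono) auto
  ultimately have "ln peak + 1 - best_value \<le> 2 * (real d + 1)" using ln_fx0 by (simp add: field_simps)
  then obtain c where "ball c (min_abs_deviation P / (8 * (2 * (real d + 1)) * (real DIM('a) + 1))) \<subseteq> core"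
    using core_inball_of_integral_ln[OF dens f(2), of "2 * (real d + 1)"] by (auto simp: f(3))
  then show ?thesis using that by (simp add: f_def d_def power2_eq_square mult_ac)
qed

end

section \<open>Wasserstein distance, Lipschitz functions and deviations\<close>

lemma product_coupling:
  assumes "prob_space P" "prob_space Q"
  shows "P \<Otimes>\<^sub>M Q \<in> couplings P Q"
proof -
  interpret P: prob_space P by fact
  interpret Q: prob_space Q by fact
  have "distr (P \<Otimes>\<^sub>M Q) Q snd = Q"
  proof (rule measure_eqI)
    fix A assume "A \<in> sets (distr (P \<Otimes>\<^sub>M Q) Q snd)"
    then have A: "A \<in> sets Q" by simp
    then have "snd -` A \<inter> space (P \<Otimes>\<^sub>M Q) = space P \<times> A"
      using sets.sets_into_space[OF A] by (auto simp: space_pair_measure)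
    then show "emeasure (distr (P \<Otimes>\<^sub>M Q) Q snd) A = emeasure Q A"
      using A by (simp add: emeasure_distr Q.emeasure_pair_measure_Times P.emeasure_space_1)
  qed simp
  then show ?thesis
    by (simp add: couplings_def Q.distr_pair_fst)
qed

text \<open>The elementary half of Kantorovich-Rubinstein duality: under any coupling the difference
  of the integrals is the mean of \<open>h (fst z) - h (snd z)\<close>.\<close>

lemma lipschitz_integral_diff_le:
  fixes h :: "'a::euclidean_space \<Rightarrow> real"
  assumes P: "nondegenerate_distribution P" and Q: "nondegenerate_distribution Q"
    and h: "L-lipschitz_on UNIV h" and L: "0 < L"
  shows "\<bar>(\<integral>x. h x \<partial>P) - (\<integral>x. h x \<partial>Q)\<bar> \<le> L * wasserstein P Q"
proof -
  interpret P: nondegenerate_distribution P by fact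
  interpret Q: nondegenerate_distribution Q by fact
  define cost where "cost \<pi> = (\<integral>\<^sup>+z. ennreal (norm (fst z - snd z)) \<partial>\<pi>)" for \<pi> :: "('a \<times> 'a) measure"
  define \<Delta> where "\<Delta> = \<bar>(\<integral>x. h x \<partial>P) - (\<integral>x. h x \<partial>Q)\<bar>"
  have marginal: "fst \<in> measurable \<pi> P" "snd \<in> measurable \<pi> Q" "distr \<pi> P fst = P" "distr \<pi> Q snd = Q"
    if "\<pi> \<in> couplings P Q" for \<pi>
  proof -
    have "sets \<pi> = sets (P \<Otimes>\<^sub>M Q)" using that by (simp add: couplings_def)
    then have "measurable \<pi> N = measurable (P \<Otimes>\<^sub>M Q) N" for N :: "'a measure"
      by (rule measurable_cong_sets) simp
    then show "fst \<in> measurable \<pi> P" "snd \<in> measurable \<pi> Q" "distr \<pi> P fst = P" "distr \<pi> Q snd = Q"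
      using that by (auto simp: couplings_def)
  qed
  have le: "ennreal (\<Delta> / L) \<le> cost \<pi>" if \<pi>: "\<pi> \<in> couplings P Q" for \<pi>
  proof -
    note m = marginal[OF \<pi>]
    have hm: "h \<in> borel_measurable P" "h \<in> borel_measurable Q"
      using P.integrable_lipschitz[OF h] Q.integrable_lipschitz[OF h] by auto
    have int: "integrable \<pi> (\<lambda>z. h (fst z))" "integrable \<pi> (\<lambda>z. h (snd z))"
      using P.integrable_lipschitz[OF h] Q.integrable_lipschitz[OF h]
        integrable_distr_eq[OF m(1) hm(1)] integrable_distr_eq[OF m(2) hm(2)] m(3,4) by auto
    have eq: "(\<integral>x. h x \<partial>P) = (\<integral>z. h (fst z) \<partial>\<pi>)" "(\<integral>x. h x \<partial>Q) = (\<integral>z. h (snd z) \<partial>\<pi>)"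
      using integral_distr[OF m(1) hm(1)] integral_distr[OF m(2) hm(2)] m(3,4) by auto
    have "ennreal (\<Delta> / L) = ennreal (norm (\<integral>z. (h (fst z) - h (snd z)) / L \<partial>\<pi>))"
      unfolding \<Delta>_def eq using int L by simp
    also have "\<dots> \<le> (\<integral>\<^sup>+z. ennreal (norm ((h (fst z) - h (snd z)) / L)) \<partial>\<pi>)"
      using int by (intro integral_norm_bound_ennreal) auto
    also have "\<dots> \<le> cost \<pi>"
      unfolding cost_def
    proof (intro nn_integral_mono ennreal_leI)
      fix z :: "'a \<times> 'a"
      have "\<bar>h (fst z) - h (snd z)\<bar> \<le> L * norm (fst z - snd z)"
        using lipschitz_onD[OF h, of "fst z" "snd z"] by (simp add: dist_norm)
      then show "norm ((h (fst z) - h (snd z)) / L) \<le> norm (fst z - snd z)"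
        using L by (simp add: field_simps)
    qed
    finally show ?thesis .
  qed
  have prod: "P \<Otimes>\<^sub>M Q \<in> couplings P Q"
    by (rule product_coupling) (rule P.prob_space_axioms Q.prob_space_axioms)+
  \<comment> \<open>\<open>enn2real\<close> sends infinity to 0, so a lower bound on the infimum
    survives the conversion only once the infimum is known to be finite.\<close>
  have "cost (P \<Otimes>\<^sub>M Q) < \<infinity>"
  proof -
    note m = marginal[OF prod]
    have norm_meas: "(\<lambda>x::'a. ennreal (norm x)) \<in> borel_measurable P" "(\<lambda>x::'a. ennreal (norm x)) \<in> borel_measurable Q"
      using P.integrable_norm Q.integrable_norm by auto
    have "cost (P \<Otimes>\<^sub>M Q) \<le> (\<integral>\<^sup>+z. ennreal (norm (fst z)) + ennreal (norm (snd z)) \<partial>(P \<Otimes>\<^sub>M Q))"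
      unfolding cost_def
      by (intro nn_integral_mono) (auto simp flip: ennreal_plus intro!: ennreal_leI norm_triangle_ineq4)
    also have "\<dots> = (\<integral>\<^sup>+z. ennreal (norm (fst z)) \<partial>(P \<Otimes>\<^sub>M Q)) + (\<integral>\<^sup>+z. ennreal (norm (snd z)) \<partial>(P \<Otimes>\<^sub>M Q))"
      using measurable_compose[OF m(1) norm_meas(1)] measurable_compose[OF m(2) norm_meas(2)]
      by (intro nn_integral_add) auto
    also have "\<dots> = (\<integral>\<^sup>+x. ennreal (norm x) \<partial>P) + (\<integral>\<^sup>+x. ennreal (norm x) \<partial>Q)"
      using nn_integral_distr[OF m(1), of "\<lambda>x. ennreal (norm x)"] nn_integral_distr[OF m(2), of "\<lambda>x. ennreal (norm x)"]
        norm_meas m(3,4) by simp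
    also have "\<dots> < \<infinity>"
      using P.integrable_norm Q.integrable_norm by (simp add: integrable_iff_bounded)
    finally show ?thesis .
  qed
  then have fin: "(INF \<pi>\<in>couplings P Q. cost \<pi>) < \<infinity>" using INF_lower[OF prod, of cost] by (rule le_less_trans[rotated])
  have "ennreal (\<Delta> / L) \<le> (INF \<pi>\<in>couplings P Q. cost \<pi>)" by (rule INF_greatest) (rule le)
  then have "enn2real (ennreal (\<Delta> / L)) \<le> enn2real (INF \<pi>\<in>couplings P Q. cost \<pi>)"
    using fin by (intro enn2real_mono) auto
  then have "\<Delta> / L \<le> wasserstein P Q" using L by (simp add: \<Delta>_def wasserstein_def cost_def)
  then show ?thesis using L by (simp add: \<Delta>_def field_simps)
qed

lemma wasserstein_nonneg: "0 \<le> wasserstein P Q"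
  by (simp add: wasserstein_def)

text \<open>In each direction one distance pays for moving the mean and another for changing the
  measure, because both integrands are 1-Lipschitz.\<close>

lemma min_abs_deviation_diff_le:
  fixes P Q :: "'a::euclidean_space measure"
  assumes P: "nondegenerate_distribution P" and Q: "nondegenerate_distribution Q"
  shows "\<bar>min_abs_deviation P - min_abs_deviation Q\<bar> \<le> 2 * wasserstein P Q"
proof -
  \<comment> \<open>The distance is abstracted to a bound \<open>W\<close> on differences of
    integrals. That bound is visibly symmetric, so the roles of the two measures can be
    exchanged.\<close>
  have *: "min_abs_deviation P \<le> min_abs_deviation Q + 2 * W"
    if P: "nondegenerate_distribution P" and Q: "nondegenerate_distribution Q"
      and W: "\<And>h :: 'a \<Rightarrow> real. 1-lipschitz_on UNIV h \<Longrightarrow> \<bar>(\<integral>x. h x \<partial>P) - (\<integral>x. h x \<partial>Q)\<bar> \<le> W"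
    for P Q :: "'a measure" and W
  proof -
    interpret P: nondegenerate_distribution P by fact
    interpret Q: nondegenerate_distribution Q by fact
    have "min_abs_deviation P - 2 * W \<le> (\<integral>x. \<bar>u \<bullet> (x - mean Q)\<bar> \<partial>Q)" if "u \<in> sphere 0 1" for u
    proof -
      have u: "norm u = 1" using that by simp
      have "1-lipschitz_on UNIV (\<lambda>x. u \<bullet> x)"
      proof (rule lipschitz_onI)
        fix x y
        have "\<bar>u \<bullet> (x - y)\<bar> \<le> norm u * norm (x - y)" by (rule Cauchy_Schwarz_ineq2)
        then show "dist (u \<bullet> x) (u \<bullet> y) \<le> 1 * dist x y" using u by (simp add: dist_norm inner_diff_right)
      qed simp
      from W[OF this] have m: "\<bar>u \<bullet> mean P - u \<bullet> mean Q\<bar> \<le> W"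
        using P.integrable_id Q.integrable_id by (simp add: mean_def)
      have "min_abs_deviation P \<le> (\<integral>x. \<bar>u \<bullet> (x - mean P)\<bar> \<partial>P)" by (rule P.min_abs_deviation_le[OF u])
      also have "\<dots> \<le> (\<integral>x. \<bar>u \<bullet> (x - mean Q)\<bar> + W \<partial>P)"
        using P.integrable_lipschitz[OF P.abs_inner_lipschitz[OF u]] m
        by (intro integral_mono) (auto simp: inner_diff_right)
      also have "\<dots> = (\<integral>x. \<bar>u \<bullet> (x - mean Q)\<bar> \<partial>P) + W"
        using P.integrable_lipschitz[OF P.abs_inner_lipschitz[OF u]] P.prob_space by simp
      also have "(\<integral>x. \<bar>u \<bullet> (x - mean Q)\<bar> \<partial>P) \<le> (\<integral>x. \<bar>u \<bullet> (x - mean Q)\<bar> \<partial>Q) + W"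
        using W[OF P.abs_inner_lipschitz[OF u, of "mean Q"]] by linarith
      finally show ?thesis by simp
    qed
    then have "min_abs_deviation P - 2 * W \<le> min_abs_deviation Q"
      unfolding min_abs_deviation_def[of Q] by (intro cINF_greatest) auto
    then show ?thesis by simp
  qed
  have W: "\<bar>(\<integral>x. h x \<partial>P) - (\<integral>x. h x \<partial>Q)\<bar> \<le> wasserstein P Q" if "1-lipschitz_on UNIV h" for h :: "'a \<Rightarrow> real"
    using lipschitz_integral_diff_le[OF P Q that] by simp
  have "min_abs_deviation P \<le> min_abs_deviation Q + 2 * wasserstein P Q" by (rule *[OF P Q W])
  moreover have "min_abs_deviation Q \<le> min_abs_deviation P + 2 * wasserstein P Q"
    by (rule *[OF Q P]) (subst abs_minus_commute, rule W)
  ultimately show ?thesis by linarith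
qed

text \<open>Pointwise, for \<open>f\<close> below \<open>g\<close>, the square expands to at most
  \<open>g x - f x\<close>. So a majorant is as close in squared Hellinger distance as its surplus
  mass.\<close>

lemma integral_sqrt_diff_sq_le_of_le:
  assumes f: "integrable M f" "\<And>x. 0 \<le> f x" and g: "integrable M g" "\<And>x. f x \<le> g x"
  shows "(\<integral>x. (sqrt (f x) - sqrt (g x))\<^sup>2 \<partial>M) \<le> (\<integral>x. g x \<partial>M) - (\<integral>x. f x \<partial>M)"
proof -
  have g0: "\<And>x. 0 \<le> g x" using f(2) g(2) order_trans by blast
  have "(\<integral>x. (sqrt (f x) - sqrt (g x))\<^sup>2 \<partial>M) \<le> (\<integral>x. g x - f x \<partial>M)"
  proof (rule integral_mono)
    show "integrable M (\<lambda>x. (sqrt (f x) - sqrt (g x))\<^sup>2)" by (rule integral_sqrt_diff_sq(2)[OF f g(1) g0])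
    fix x
    have "sqrt (f x) * sqrt (f x) \<le> sqrt (f x) * sqrt (g x)" using f(2) g(2) by (intro mult_left_mono) auto
    then show "(sqrt (f x) - sqrt (g x))\<^sup>2 \<le> g x - f x"
      using f(2)[of x] g0[of x] by (simp add: power2_diff)
  qed (use f g in auto)
  then show ?thesis using f g by simp
qed

text \<open>With \<eta> bounding the surplus mass of both envelopes, the optimal value for
  \<open>P\<close> is at most the expectation of \<open>ln F\<close> under \<open>P\<close>, then
  under \<open>Q\<close> plus \<open>L * W\<close>, then the optimal value for \<open>Q\<close> plus
  \<eta>, then the expectation of \<open>ln G\<close> under \<open>Q\<close>, and finally under
  \<open>P\<close> plus another \<open>L * W\<close>. So \<open>G\<close> is nearly optimal for
  \<open>P\<close>, hence close to \<open>f\<close>, and it is close to \<open>g\<close> as a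
  majorant of small surplus. The constants 4 and 6 come from joining
  \<open>2 * (L * W) + 2 * \<eta>\<close> and \<eta> with a factor 2 each.\<close>

lemma hellinger_sq_projection_le:
  fixes P Q :: "'a::euclidean_space measure"
  assumes P: "nondegenerate_distribution P" and Q: "nondegenerate_distribution Q"
  defines "k \<equiv> 1 / (16 * (real DIM('a) + 1)\<^sup>2)"
  assumes \<epsilon>: "0 < \<epsilon>" "\<epsilon> \<le> min_abs_deviation P" "\<epsilon> \<le> min_abs_deviation Q" and L: "1 \<le> L * (k * \<epsilon>)"
  shows "(\<integral>x. (sqrt (log_concave_projection P x) - sqrt (log_concave_projection Q x))\<^sup>2 \<partial>lborel)
    \<le> 4 * L * wasserstein P Q + 6 * (envelope_const DIM('a) / (L * (k * \<epsilon>)))"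
proof -
  interpret P: nondegenerate_distribution P by fact
  interpret Q: nondegenerate_distribution Q by fact
  define f where "f = log_concave_projection P"
  define g where "g = log_concave_projection Q"
  interpret f: log_concave_density f
    unfolding f_def by (rule log_concave_density_of_mem) (rule P.log_concave_projection)
  interpret g: log_concave_density g
    unfolding g_def by (rule log_concave_density_of_mem) (rule Q.log_concave_projection)
  have fP: "log_integrable P f" "(\<integral>x. ln (f x) \<partial>P) = P.best_value"
    unfolding f_def by (rule P.log_concave_projection)+
  have gQ: "log_integrable Q g" "(\<integral>x. ln (g x) \<partial>Q) = Q.best_value"
    unfolding g_def by (rule Q.log_concave_projection)+
  have k: "0 < k" by (simp add: k_def)
  have "0 < k * \<epsilon>" using k \<epsilon> by simp
  then have "0 < L" using L by (metis less_le_trans zero_less_mult_pos2 zero_less_one)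
  then have L0: "0 \<le> L" by simp
  define W where "W = wasserstein P Q"
  define \<eta> where "\<eta> = envelope_const DIM('a) / (L * (k * \<epsilon>))"
  define F where "F = log_lipschitz_envelope L f"
  define G where "G = log_lipschitz_envelope L g"
  have ball: "\<exists>c. ball c (k * \<epsilon>) \<subseteq> log_concave_density.core (log_concave_projection R)"
    if R: "nondegenerate_distribution R" and le: "\<epsilon> \<le> min_abs_deviation R" for R :: "'a measure"
  proof -
    have "k * \<epsilon> \<le> k * min_abs_deviation R" using k le by (intro mult_left_mono) auto
    also have "\<dots> = min_abs_deviation R / (16 * (real DIM('a) + 1)\<^sup>2)" by (simp add: k_def)
    finally have "ball c (k * \<epsilon>) \<subseteq> ball c (min_abs_deviation R / (16 * (real DIM('a) + 1)\<^sup>2))" for c :: 'a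
      by (rule subset_ball)
    moreover obtain c where "ball c (min_abs_deviation R / (16 * (real DIM('a) + 1)\<^sup>2))
        \<subseteq> log_concave_density.core (log_concave_projection R)"
      using nondegenerate_distribution.core_inball_projection[OF R] by blast
    ultimately show ?thesis by blast
  qed
  obtain c where c: "ball c (k * \<epsilon>) \<subseteq> f.core" using ball[OF P \<epsilon>(2)] unfolding f_def by blast
  obtain c' where c': "ball c' (k * \<epsilon>) \<subseteq> g.core" using ball[OF Q \<epsilon>(3)] unfolding g_def by blast
  have F: "integrable lborel F" "(\<integral>x. F x \<partial>lborel) \<le> 1 + \<eta>"
    unfolding F_def \<eta>_def using f.envelope_integral[OF c \<open>0 < k * \<epsilon>\<close> L] by auto
  have G: "integrable lborel G" "(\<integral>x. G x \<partial>lborel) \<le> 1 + \<eta>"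
    unfolding G_def \<eta>_def using g.envelope_integral[OF c' \<open>0 < k * \<epsilon>\<close> L] by auto
  have F_lc: "log_concave F"
    unfolding F_def by (rule log_concave_envelope[of f f.peak L, OF f.nonneg f.le_peak L0 f.log_concave])
  have G_lc: "log_concave G"
    unfolding G_def by (rule log_concave_envelope[of g g.peak L, OF g.nonneg g.le_peak L0 g.log_concave])
  have fF: "f x \<le> F x" for x unfolding F_def by (rule envelope_ge_self[of f f.peak L, OF f.nonneg f.le_peak L0])
  have gG: "g x \<le> G x" for x unfolding G_def by (rule envelope_ge_self[of g g.peak L, OF g.nonneg g.le_peak L0])
  have F_le: "F x \<le> f.peak" for x unfolding F_def by (rule envelope_le_bound[of f f.peak L, OF f.nonneg f.le_peak L0])
  have G_le: "G x \<le> g.peak" for x unfolding G_def by (rule envelope_le_bound[of g g.peak L, OF g.nonneg g.le_peak L0])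
  obtain z where z: "0 < f z" using f.near_peak[OF f.peak_pos] by blast
  obtain z' where z': "0 < g z'" using g.near_peak[OF g.peak_pos] by blast
  have F_pos: "0 < F x" for x unfolding F_def by (rule envelope_pos[of f f.peak L z, OF f.nonneg f.le_peak L0 z])
  have G_pos: "0 < G x" for x unfolding G_def by (rule envelope_pos[of g g.peak L z', OF g.nonneg g.le_peak L0 z'])
  have F_lip: "L-lipschitz_on UNIV (\<lambda>x. ln (F x))"
    unfolding F_def by (rule ln_envelope_lipschitz[of f f.peak L z, OF f.nonneg f.le_peak L0 z])
  have G_lip: "L-lipschitz_on UNIV (\<lambda>x. ln (G x))"
    unfolding G_def by (rule ln_envelope_lipschitz[of g g.peak L z', OF g.nonneg g.le_peak L0 z'])
  have FQ: "log_integrable Q F" using Q.integrable_lipschitz[OF F_lip] F_pos by (simp add: log_integrable_def)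
  have GP: "log_integrable P G" using P.integrable_lipschitz[OF G_lip] G_pos by (simp add: log_integrable_def)
  have F_meas: "F \<in> borel_measurable borel" and G_meas: "G \<in> borel_measurable borel" using F G by auto
  have "P.best_value \<le> (\<integral>x. ln (F x) \<partial>P)"
    using P.log_integrable_mono(2)[OF fP(1) F_meas fF F_le] by (simp add: fP(2))
  moreover have "(\<integral>x. ln (F x) \<partial>P) \<le> (\<integral>x. ln (F x) \<partial>Q) + L * W"
    using lipschitz_integral_diff_le[OF P Q F_lip \<open>0 < L\<close>] unfolding W_def by linarith
  moreover have "(\<integral>x. ln (F x) \<partial>Q) - ln (\<integral>x. F x \<partial>lborel) \<le> Q.best_value"
    by (rule Q.integral_ln_le_best_value[OF F_lc F(1) FQ])
  moreover have "ln (\<integral>x. F x \<partial>lborel) \<le> \<eta>"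
  proof -
    have "0 < (\<integral>x. F x \<partial>lborel)"
      using F_pos by (intro P.integral_pos_of_log_concave F_lc F) simp
    then show ?thesis using ln_le_minus_one F(2) by fastforce
  qed
  moreover have "Q.best_value \<le> (\<integral>x. ln (G x) \<partial>Q)"
    using Q.log_integrable_mono(2)[OF gQ(1) G_meas gG G_le] by (simp add: gQ(2))
  moreover have "(\<integral>x. ln (G x) \<partial>Q) \<le> (\<integral>x. ln (G x) \<partial>P) + L * W"
    using lipschitz_integral_diff_le[OF P Q G_lip \<open>0 < L\<close>] unfolding W_def by linarith
  ultimately have gap: "P.best_value - (\<integral>x. ln (G x) \<partial>P) \<le> 2 * (L * W) + \<eta>" by linarith
  have "(\<integral>x. (sqrt (f x) - sqrt (G x))\<^sup>2 \<partial>lborel) \<le> (\<integral>x. f x \<partial>lborel) + (\<integral>x. G x \<partial>lborel) - 2 +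
      (2 * P.best_value - (\<integral>x. ln (f x) \<partial>P) - (\<integral>x. ln (G x) \<partial>P))"
    by (rule P.sqrt_diff_sq_le[OF f.log_concave f.integrable fP(1) G_lc G(1) GP])
  then have fG_le: "(\<integral>x. (sqrt (f x) - sqrt (G x))\<^sup>2 \<partial>lborel) \<le> 2 * (L * W) + 2 * \<eta>"
    using gap G(2) unfolding f.integral_1 fP(2) by linarith
  have "(\<integral>x. (sqrt (g x) - sqrt (G x))\<^sup>2 \<partial>lborel) \<le> (\<integral>x. G x \<partial>lborel) - (\<integral>x. g x \<partial>lborel)"
    by (rule integral_sqrt_diff_sq_le_of_le[OF g.integrable g.nonneg G(1) gG])
  then have gG_le: "(\<integral>x. (sqrt (g x) - sqrt (G x))\<^sup>2 \<partial>lborel) \<le> \<eta>"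
    using G(2) unfolding g.integral_1 by linarith
  have G0: "\<And>x. 0 \<le> G x" using G_pos less_imp_le by blast
  note int = integral_sqrt_diff_sq(2)[OF f.integrable f.nonneg G(1) G0]
    integral_sqrt_diff_sq(2)[OF g.integrable g.nonneg G(1) G0]
    integral_sqrt_diff_sq(2)[OF f.integrable f.nonneg g.integrable g.nonneg]
  have "(\<integral>x. (sqrt (f x) - sqrt (g x))\<^sup>2 \<partial>lborel) \<le>
      (\<integral>x. 2 * (sqrt (f x) - sqrt (G x))\<^sup>2 + 2 * (sqrt (g x) - sqrt (G x))\<^sup>2 \<partial>lborel)"
  proof (rule integral_mono)
    fix x
    have "(a - b)\<^sup>2 \<le> 2 * (a - c)\<^sup>2 + 2 * (b - c)\<^sup>2" for a b c :: real
      using zero_le_power2[of "a + b - 2 * c"] by (simp add: power2_eq_square algebra_simps)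
    then show "(sqrt (f x) - sqrt (g x))\<^sup>2 \<le> 2 * (sqrt (f x) - sqrt (G x))\<^sup>2 + 2 * (sqrt (g x) - sqrt (G x))\<^sup>2" .
  qed (use int in auto)
  also have "\<dots> = 2 * (\<integral>x. (sqrt (f x) - sqrt (G x))\<^sup>2 \<partial>lborel) + 2 * (\<integral>x. (sqrt (g x) - sqrt (G x))\<^sup>2 \<partial>lborel)"
    using int by simp
  also have "\<dots> \<le> 4 * (L * W) + 6 * \<eta>" using fG_le gG_le by linarith
  finally show ?thesis by (simp add: f_def g_def W_def \<eta>_def)
qed

lemma hellinger_sq_projection_le_2:
  fixes P Q :: "'a::euclidean_space measure"
  assumes P: "nondegenerate_distribution P" and Q: "nondegenerate_distribution Q"
  shows "(\<integral>x. (sqrt (log_concave_projection P x) - sqrt (log_concave_projection Q x))\<^sup>2 \<partial>lborel) \<le> 2"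
proof -
  define f where "f = log_concave_projection P"
  define g where "g = log_concave_projection Q"
  interpret f: log_concave_density f
    unfolding f_def by (intro log_concave_density_of_mem nondegenerate_distribution.log_concave_projection P)
  interpret g: log_concave_density g
    unfolding g_def by (intro log_concave_density_of_mem nondegenerate_distribution.log_concave_projection Q)
  have "0 \<le> (\<integral>x. sqrt (f x * g x) \<partial>lborel)"
    using f.nonneg g.nonneg by (intro integral_nonneg_AE) simp
  then show ?thesis
    using integral_sqrt_diff_sq(3)[OF f.integrable f.nonneg g.integrable g.nonneg] f.integral_1 g.integral_1
    unfolding f_def[symmetric] g_def[symmetric] by linarith
qed

text \<open>If the distance is at most \<open>m * (k/2)\<^sup>2\<close>, both deviations are at
  least \<open>m / 2\<close> and the balanced \<open>L\<close> is large enough for the envelope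
  estimate. Otherwise the summand \<open>4 / k\<close> alone brings the right side above the trivial
  bound 2.\<close>

lemma hellinger_sq_projection_bound:
  fixes P Q :: "'a::euclidean_space measure"
  assumes P: "nondegenerate_distribution P" and Q: "nondegenerate_distribution Q"
  defines "k \<equiv> 1 / (16 * (real DIM('a) + 1)\<^sup>2)"
  defines "m \<equiv> max (min_abs_deviation P) (min_abs_deviation Q)"
  shows "(\<integral>x. (sqrt (log_concave_projection P x) - sqrt (log_concave_projection Q x))\<^sup>2 \<partial>lborel)
    \<le> (4 + 12 * envelope_const DIM('a) / k + 4 / k) * sqrt (wasserstein P Q / m)"
proof -
  define H where "H = (\<integral>x. (sqrt (log_concave_projection P x) - sqrt (log_concave_projection Q x))\<^sup>2 \<partial>lborel)"
  define W where "W = wasserstein P Q"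
  define C where "C = envelope_const DIM('a)"
  have C: "0 \<le> C" by (simp add: C_def envelope_const_def)
  have W: "0 \<le> W" unfolding W_def by (rule wasserstein_nonneg)
  have "1 \<le> 16 * (real DIM('a) + 1)\<^sup>2"
    using one_le_power[of "real DIM('a) + 1" 2] by linarith
  then have k: "0 < k" "k \<le> 1" by (auto simp: k_def)
  have m: "0 < m"
    using nondegenerate_distribution.min_abs_deviation_pos[OF P] by (simp add: m_def)
  \<comment> \<open>\<open>D\<close> stands in for \<open>W\<close> because the balancing slope is
    infinite when \<open>W = 0\<close>; that case is reached by letting \<open>D\<close> tend to
    0.\<close>
  have bound: "H \<le> (4 + 12 * C / k) * sqrt (D / m)" if D: "0 < D" "W \<le> D" "D \<le> m * (k/2)\<^sup>2" for D
  proof -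
    \<comment> \<open>The slope at which \<open>L * D\<close> and \<open>1 / (L * m)\<close> are
      equal, both being \<open>sqrt (D / m)\<close>.\<close>
    define L where "L = 1 / sqrt (D * m)"
    have L: "0 < L" using D m by (simp add: L_def)
    have sq: "L * D = sqrt (D / m)" "L * m = 1 / sqrt (D / m)"
      using D m by (auto simp: L_def real_sqrt_mult real_sqrt_divide field_simps)
    have "(k/2)\<^sup>2 \<le> (1/2)\<^sup>2" using k by (intro power_mono) auto
    then have "m * (k/2)\<^sup>2 \<le> m * (1/4)" using m by (intro mult_left_mono) (auto simp: power_divide)
    then have "4 * W \<le> m" using D by linarith
    \<comment> \<open>The larger deviation is \<open>m\<close>, and the two differ by at most
      \<open>2 * W\<close>, which is at most \<open>m / 2\<close>.\<close>
    then have \<epsilon>: "m / 2 \<le> min_abs_deviation P" "m / 2 \<le> min_abs_deviation Q"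
      using min_abs_deviation_diff_le[OF P Q] unfolding W_def m_def by linarith+
    have "sqrt (D / m) \<le> sqrt ((k/2)\<^sup>2)" using D m by (intro real_sqrt_le_mono) (simp add: field_simps)
    then have "sqrt (D / m) \<le> k / 2" using k by simp
    then have Lk: "1 \<le> L * (k * (m / 2))"
    proof -
      have "L * (k * (m / 2)) = (k / 2) * (L * m)" by simp
      also have "\<dots> = (k / 2) / sqrt (D / m)" by (simp add: sq)
      finally show ?thesis using \<open>sqrt (D / m) \<le> k / 2\<close> D m by (simp add: pos_le_divide_eq)
    qed
    have "H \<le> 4 * L * W + 6 * (C / (L * (k * (m / 2))))"
      unfolding H_def W_def C_def k_def
      by (rule hellinger_sq_projection_le[OF P Q _ \<epsilon>]) (use m Lk in \<open>auto simp: k_def\<close>)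
    also have "4 * L * W \<le> 4 * L * D" using D L by (intro mult_left_mono) auto
    also have "4 * L * D = 4 * sqrt (D / m)" using sq by simp
    also have "C / (L * (k * (m / 2))) = 2 * C / k * sqrt (D / m)"
    proof -
      have "C / (L * (k * (m / 2))) = 2 * C / k * (1 / (L * m))" by (simp add: mult_ac)
      then show ?thesis by (simp add: sq)
    qed
    finally show ?thesis by (simp add: algebra_simps)
  qed
  have "H \<le> (4 + 12 * C / k + 4 / k) * sqrt (W / m)"
  proof (cases "W \<le> m * (k/2)\<^sup>2")
    case True
    have small: "H \<le> (4 + 12 * C / k) * sqrt (W / m)"
    proof (cases "W = 0")
      case True
      have "H \<le> 0"
      proof (rule field_le_epsilon)
        fix e :: real assume e: "0 < e"
        define c where "c = 4 + 12 * C / k"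
        have c: "0 < c" using C k by (simp add: c_def add_pos_nonneg)
        \<comment> \<open>The first bound keeps \<open>D\<close> in the admissible range, the second
          makes \<open>c * sqrt (D / m)\<close> at most \<open>e\<close>.\<close>
        define D where "D = min (m * (k/2)\<^sup>2) (m * (e / c)\<^sup>2)"
        have D: "0 < D" using m k e c by (simp add: D_def)
        have "H \<le> c * sqrt (D / m)" unfolding c_def by (rule bound) (use D W True in \<open>auto simp: D_def\<close>)
        also have "\<dots> \<le> c * sqrt ((e / c)\<^sup>2)"
          using m c by (intro mult_left_mono real_sqrt_le_mono) (auto simp: D_def divide_le_eq mult.commute)
        also have "\<dots> = e" using e c by simp
        finally show "H \<le> 0 + e" by simp
      qed
      then show ?thesis using True by simp
    next
      case False
      then show ?thesis using \<open>W \<le> m * (k/2)\<^sup>2\<close> W by (intro bound) auto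
    qed
    moreover have "0 \<le> 4 / k * sqrt (W / m)" using k W m by simp
    ultimately show ?thesis by (simp add: distrib_right)
  next
    case False
    then have "(k/2)\<^sup>2 \<le> W / m" using m by (simp add: field_simps)
    then have "sqrt ((k/2)\<^sup>2) \<le> sqrt (W / m)" by (rule real_sqrt_le_mono)
    then have "k / 2 \<le> sqrt (W / m)" using k by simp
    then have "4 / k * (k / 2) \<le> 4 / k * sqrt (W / m)" using k by (intro mult_left_mono) auto
    then have "2 \<le> 4 / k * sqrt (W / m)" using k by simp
    moreover have "H \<le> 2" unfolding H_def by (rule hellinger_sq_projection_le_2[OF P Q])
    moreover have "0 \<le> (4 + 12 * C / k) * sqrt (W / m)" using C k W m by simp
    ultimately show ?thesis by (simp add: distrib_right)
  qed
  then show ?thesis by (simp add: H_def C_def W_def)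
qed

text \<open>The constant is \<open>sqrt A\<close>, where \<open>A\<close> is an explicit expression
  in the dimension alone; the types \<open>real ^ 'n\<close> cover every dimension from 1
  on.\<close>

theorem theorem2:
  shows "\<exists>C>0. \<forall>P \<in> nondegenerate_distributions. \<forall>Q \<in> nondegenerate_distributions.
    hellinger (log_concave_projection P) (log_concave_projection (Q :: (real ^ 'n) measure))
      \<le> C * (wasserstein P Q / max (min_abs_deviation P) (min_abs_deviation Q)) powr (1 / 4)"
proof -
  define k where "k = 1 / (16 * (real DIM(real ^ 'n) + 1)\<^sup>2)"
  define A where "A = 4 + 12 * envelope_const DIM(real ^ 'n) / k + 4 / k"
  have "0 < k" by (simp add: k_def)
  then have A: "0 < A" by (simp add: A_def envelope_const_def add_pos_nonneg)
  have "hellinger (log_concave_projection P) (log_concave_projection Q)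
      \<le> sqrt A * (wasserstein P Q / max (min_abs_deviation P) (min_abs_deviation Q)) powr (1 / 4)"
    if "P \<in> nondegenerate_distributions" "Q \<in> nondegenerate_distributions" for P Q :: "(real ^ 'n) measure"
  proof -
    have P: "nondegenerate_distribution P" and Q: "nondegenerate_distribution Q"
      using that by (auto simp: nondegenerate_distribution_iff)
    define y where "y = wasserstein P Q / max (min_abs_deviation P) (min_abs_deviation Q)"
    have y: "0 \<le> y"
      unfolding y_def using nondegenerate_distribution.min_abs_deviation_pos[OF P]
      by (intro divide_nonneg_nonneg wasserstein_nonneg) auto
    have "hellinger (log_concave_projection P) (log_concave_projection Q) \<le> sqrt (A * sqrt y)"
      unfolding hellinger_def y_def A_def k_def
      by (intro real_sqrt_le_mono hellinger_sq_projection_bound P Q)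
    also have "\<dots> = sqrt A * (y powr (1/2)) powr (1/2)"
      using y by (simp add: real_sqrt_mult powr_half_sqrt)
    also have "(y powr (1/2)) powr (1/2) = y powr (1/4)" by (simp add: powr_powr)
    finally show ?thesis by (simp add: y_def)
  qed
  then show ?thesis using A by (intro exI[of _ "sqrt A"]) auto
qed

end
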